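(* Let $f(z)$ be a transcendental meromorphic function in $\mathbb{C}$ with hyper order $\sigma_2(f)<1$ and Nevanlinna deficiency $\delta(\infty,f)>\frac12$. Let $\eta$ be a non-zero complex number and let $n\ge 3$ be an integer. If $s(z)\not\equiv 0$ is a small meromorphic function of $f(z)$, then $f(z)^nf(z+\eta)-s(z)$ has infinitely many zeros.
   Context: Standard notation of Nevanlinna theory is used: $T(r,f)$ is the characteristic function and $N(r,f)$ is the integrated counting function of the poles of $f$ counted with multiplicity. The hyper order is $\sigma_2(f)=\limsup_{r\to\infty}\frac{\log^+\log^+T(r,f)}{\log r}$, and the deficiency is $\delta(\infty,f)=1-\limsup_{r\to\infty}\frac{N(r,f)}{T(r,f)}$. $S(r,f)$ denotes any real function that is $o(T(r,f))$ as $r\to\infty$ outside a possible exceptional set $E$ of finite logarithmic measure ($\int_{E\cap[1,\infty)}dr/r<\infty$). A meromorphic function $\alpha$ is a small function of $f$ if $T(r,\alpha)=S(r,f)$. *)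

theory Defs
  imports
    "HOL-Complex_Analysis.Complex_Analysis"
    "HOL-Computational_Algebra.Polynomial"
    "HOL-Library.Landau_Symbols"
begin

text \<open>
  A meromorphic function in the plane is represented by its unique representative that is
  continuous at every non-pole and has the dummy value 0 at every pole
  (\<^term>\<open>f nicely_meromorphic_on UNIV\<close>).  Identities between such functions, e.g. that a
  function is not identically zero, can then be read pointwise.
\<close>

definition rational_function :: "(complex \<Rightarrow> complex) \<Rightarrow> bool" where
  "rational_function f \<longleftrightarrow>
     (\<exists>p q :: complex poly. q \<noteq> 0 \<and> (\<forall>z. poly q z \<noteq> 0 \<longrightarrow> f z = poly p z / poly q z))"

definition transcendental_meromorphic :: "(complex \<Rightarrow> complex) \<Rightarrow> bool" where
  "transcendental_meromorphic f \<longleftrightarrow> f nicely_meromorphic_on UNIV \<and> \<not> rational_function f"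

definition log_plus :: "real \<Rightarrow> real" where
  "log_plus x = ln (max 1 x)"

definition proximity :: "(complex \<Rightarrow> complex) \<Rightarrow> real \<Rightarrow> real" where
  "proximity f r =
     (LINT \<theta>:{0..2 * pi}|lborel. log_plus (cmod (f (rcis r \<theta>)))) / (2 * pi)"

text \<open>
  The order \<^term>\<open>zorder f z\<close> of a pole is negative, so \<^term>\<open>- zorder f z\<close> is its
  multiplicity.  The sum is finite because \<open>f\<close> has finitely many poles in a closed disc.
\<close>
definition pole_count :: "(complex \<Rightarrow> complex) \<Rightarrow> real \<Rightarrow> real" where
  "pole_count f t = (\<Sum>z\<in>{z. is_pole f z \<and> cmod z \<le> t}. real_of_int (- zorder f z))"

definition integrated_pole_count :: "(complex \<Rightarrow> complex) \<Rightarrow> real \<Rightarrow> real" where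
  "integrated_pole_count f r =
     (LINT t:{0..r}|lborel. (pole_count f t - pole_count f 0) / t) + pole_count f 0 * ln r"

definition nevanlinna_char :: "(complex \<Rightarrow> complex) \<Rightarrow> real \<Rightarrow> real" where
  "nevanlinna_char f r = proximity f r + integrated_pole_count f r"

definition hyper_order :: "(complex \<Rightarrow> complex) \<Rightarrow> ereal" where
  "hyper_order f =
     Limsup at_top (\<lambda>r. ereal (log_plus (log_plus (nevanlinna_char f r)) / ln r))"

definition deficiency_infinity :: "(complex \<Rightarrow> complex) \<Rightarrow> ereal" where
  "deficiency_infinity f =
     1 - Limsup at_top (\<lambda>r. ereal (integrated_pole_count f r / nevanlinna_char f r))"

definition finite_log_measure :: "real set \<Rightarrow> bool" where
  "finite_log_measure E \<longleftrightarrow>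
     E \<in> sets lebesgue \<and> (\<integral>\<^sup>+ r\<in>E \<inter> {1..}. ennreal (1 / r) \<partial>lebesgue) < \<infinity>"

text \<open>The error class \<open>S(r, f)\<close>; the filter expresses \<open>r \<longlongrightarrow> \<infinity>\<close> with \<open>r \<notin> E\<close>.\<close>
definition S_class :: "(complex \<Rightarrow> complex) \<Rightarrow> (real \<Rightarrow> real) set" where
  "S_class f =
     {g. \<exists>E. finite_log_measure E \<and> g \<in> o[inf at_top (principal (- E))](nevanlinna_char f)}"

definition small_function :: "(complex \<Rightarrow> complex) \<Rightarrow> (complex \<Rightarrow> complex) \<Rightarrow> bool" where
  "small_function \<alpha> f \<longleftrightarrow> \<alpha> nicely_meromorphic_on UNIV \<and> nevanlinna_char \<alpha> \<in> S_class f"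

text \<open>
  An expression built pointwise from meromorphic functions need not itself be normalised: its
  value at a point where some constituent has a pole is meaningless.  Zeros are therefore
  the points at which it has limit 0 (without vanishing identically nearby), which is
  \<^const>\<open>isolated_zero\<close>.
\<close>
definition zeros_of :: "(complex \<Rightarrow> complex) \<Rightarrow> complex set" where
  "zeros_of F = {z. isolated_zero F z}"

end

theory Submission
  imports Defs
begin

text \<open>
  Put \<open>F = f\<^sup>n f(z + \<eta>)\<close>, \<open>G = F / s\<close> and \<open>h = G' / (G (G - 1))\<close>, and suppose that \<open>F - s\<close> has finitely many
  zeros.  By the difference analogue of the lemma on the logarithmic derivative (this uses hyper order less
  than 1), \<open>(n + 1) m(r, f) \<le> m(r, F) + S(r, f)\<close>.  Since \<open>G = (G' / (G - 1)) / h\<close>, the lemma on the logarithmic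
  derivative and the first main theorem bound \<open>m(r, F)\<close> by \<open>N(r, h) + S(r, f)\<close>.  The poles of \<open>h\<close> are simple
  and lie, up to poles of \<open>s\<close>, at zeros of \<open>f\<close>, of \<open>f(z + \<eta>)\<close> or of \<open>F - s\<close>, so that
  \<open>N(r, h) \<le> 2 T(r, f) + S(r, f)\<close>.  Hence \<open>4 m(r, f) \<le> 2 T(r, f) + S(r, f)\<close>, whereas \<open>\<delta>(\<infinity>, f) > 1/2\<close> says that
  \<open>m(r, f)\<close> exceeds \<open>(1/2 + \<epsilon>) T(r, f)\<close>.  If \<open>G\<close> is constant, then already \<open>m(r, F) = S(r, f)\<close>.

  Circles through zeros or poles of the functions involved are avoided throughout: their radii form a
  countable set, and on all other circles every integrand is continuous.
\<close>

section \<open>Means over circles and the Poisson formula\<close>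

text \<open>The o(T) claims are not proved for all radii off an exceptional set: a contradiction
  needs only one sequence of radii r_k tending to infinity, so the sequence is fixed first and every
  error is compared with T(r_k, f). Put x = 2^k and d = x^\<beta>. Working between circles a
  distance d apart, the difference estimate costs about T/d plus (R/d) r^(-\<alpha>) T, with T taken
  a few steps d further out. This is o(T(r_k, f)) once 1 - \<beta> < \<alpha> < 1 and T(r_k + 4 d)
  <= K T(r_k). The hyper order enters through the second condition: log^+ T is at most about
  x^\<sigma> with \<sigma> < 1, so it can rise by ln K across only O(x^\<sigma>) cells of length
  O(d), and these fill a vanishing part of [x, 2x] when \<sigma> + \<beta> < 1. The exceptional set
  of s, having finite logarithmic measure, also fills a vanishing part and is avoided at the same
  time. K must be close to 1, because the zeros of f(z + \<eta>) are counted through T at a larger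
  radius and the inequality to be contradicted has little room.\<close>

definition circle_mean :: "(complex \<Rightarrow> real) \<Rightarrow> real \<Rightarrow> real" where
  "circle_mean u r = integral {0..2 * pi} (\<lambda>\<theta>. u (rcis r \<theta>)) / (2 * pi)"

lemma continuous_on_circle:
  fixes u :: "complex \<Rightarrow> 'a::topological_space"
  assumes "continuous_on (sphere 0 r) u" "r \<ge> 0"
  shows "continuous_on {0..2 * pi} (\<lambda>\<theta>. u (rcis r \<theta>))"
proof -
  have "continuous_on {0..2 * pi} (\<lambda>\<theta>. rcis r \<theta>)"
    unfolding rcis_def cis_conv_exp by (intro continuous_intros)
  then show ?thesis
    by (rule continuous_on_compose2[OF assms(1)]) (use assms(2) in auto)
qed

lemma integrable_on_circle:
  fixes u :: "complex \<Rightarrow> real"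
  assumes "continuous_on (sphere 0 r) u" "r \<ge> 0"
  shows "(\<lambda>\<theta>. u (rcis r \<theta>)) integrable_on {0..2 * pi}"
  by (intro integrable_continuous_real continuous_on_circle assms)

lemma circle_mean_cong:
  assumes "\<And>z. cmod z = r \<Longrightarrow> u z = v z" "r \<ge> 0"
  shows "circle_mean u r = circle_mean v r"
  unfolding circle_mean_def using assms by simp

lemma circle_mean_mono:
  assumes "continuous_on (sphere 0 r) u" "continuous_on (sphere 0 r) v" "r \<ge> 0"
    and "\<And>z. cmod z = r \<Longrightarrow> u z \<le> v z"
  shows "circle_mean u r \<le> circle_mean v r"
  unfolding circle_mean_def
  by (intro divide_right_mono integral_le integrable_on_circle) (use assms in auto)

lemma circle_mean_add:
  assumes "continuous_on (sphere 0 r) u" "continuous_on (sphere 0 r) v" "r \<ge> 0"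
  shows "circle_mean (\<lambda>z. u z + v z) r = circle_mean u r + circle_mean v r"
  unfolding circle_mean_def
  by (simp add: Henstock_Kurzweil_Integration.integral_add integrable_on_circle assms add_divide_distrib)

lemma circle_mean_diff:
  assumes "continuous_on (sphere 0 r) u" "continuous_on (sphere 0 r) v" "r \<ge> 0"
  shows "circle_mean (\<lambda>z. u z - v z) r = circle_mean u r - circle_mean v r"
  unfolding circle_mean_def
  by (simp add: Henstock_Kurzweil_Integration.integral_diff integrable_on_circle assms diff_divide_distrib)

lemma circle_mean_cmult: "circle_mean (\<lambda>z. c * u z) r = c * circle_mean u r"
  unfolding circle_mean_def by simp

lemma circle_mean_cmult_right: "circle_mean (\<lambda>z. u z * c) r = circle_mean u r * c"
  unfolding circle_mean_def by simp

lemma circle_mean_uminus: "circle_mean (\<lambda>z. - u z) r = - circle_mean u r"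
  unfolding circle_mean_def by simp

lemma circle_mean_const [simp]: "circle_mean (\<lambda>z. c) r = c"
  unfolding circle_mean_def by simp

lemma circle_mean_nonneg:
  assumes "continuous_on (sphere 0 r) u" "r \<ge> 0" "\<And>z. cmod z = r \<Longrightarrow> u z \<ge> 0"
  shows "circle_mean u r \<ge> 0"
  using circle_mean_mono[of r "\<lambda>_. 0" u] assms by (simp add: continuous_on_const)

lemma circle_mean_sum:
  assumes "\<And>i. i \<in> I \<Longrightarrow> continuous_on (sphere 0 r) (u i)" "r \<ge> 0" "finite I"
  shows "circle_mean (\<lambda>z. \<Sum>i\<in>I. u i z) r = (\<Sum>i\<in>I. circle_mean (u i) r)"
  using assms(3,1)
  by (induction rule: finite_induct)
     (auto simp: circle_mean_add continuous_on_sum assms(2))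

lemma circle_mean_abs_le:
  assumes "continuous_on (sphere 0 r) u" "r \<ge> 0"
  shows "\<bar>circle_mean u r\<bar> \<le> circle_mean (\<lambda>z. \<bar>u z\<bar>) r"
proof -
  have c: "continuous_on (sphere 0 r) (\<lambda>z. \<bar>u z\<bar>)"
    by (intro continuous_intros assms)
  have "circle_mean u r \<le> circle_mean (\<lambda>z. \<bar>u z\<bar>) r"
    by (rule circle_mean_mono) (use assms c in auto)
  moreover have "circle_mean (\<lambda>z. - u z) r \<le> circle_mean (\<lambda>z. \<bar>u z\<bar>) r"
    by (rule circle_mean_mono) (use assms c in \<open>auto intro!: continuous_intros\<close>)
  ultimately show ?thesis by (simp add: circle_mean_uminus)
qed

lemma continuous_on_two_circles:
  fixes k :: "complex \<Rightarrow> complex \<Rightarrow> real"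
  assumes "continuous_on (sphere 0 r \<times> sphere 0 R) (\<lambda>(z, w). k z w)" "r \<ge> 0" "R \<ge> 0"
  shows "continuous_on (cbox (0, 0) (2 * pi, 2 * pi)) (\<lambda>(x, y). k (rcis r x) (rcis R y))"
proof -
  have "continuous_on (cbox (0, 0) (2 * pi, 2 * pi)) (\<lambda>p::real \<times> real. (rcis r (fst p), rcis R (snd p)))"
    unfolding rcis_def cis_conv_exp by (intro continuous_intros)
  then have "continuous_on (cbox (0, 0) (2 * pi, 2 * pi))
      (\<lambda>p. (\<lambda>(z, w). k z w) (rcis r (fst p), rcis R (snd p)))"
    by (rule continuous_on_compose2[OF assms(1)]) (use assms in auto)
  then show ?thesis by (simp add: case_prod_unfold)
qed

lemma circle_mean_swap:
  assumes "continuous_on (sphere 0 r \<times> sphere 0 R) (\<lambda>(z, w). k z w)" "r \<ge> 0" "R \<ge> 0"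
  shows "circle_mean (\<lambda>z. circle_mean (\<lambda>w. k z w) R) r = circle_mean (\<lambda>w. circle_mean (\<lambda>z. k z w) r) R"
  using integral_swap_continuous[OF continuous_on_two_circles[OF assms]]
  unfolding circle_mean_def by simp

lemma continuous_on_circle_mean:
  fixes k :: "complex \<Rightarrow> complex \<Rightarrow> real"
  assumes "continuous_on (U \<times> sphere 0 R) (\<lambda>(z, w). k z w)" "R \<ge> 0"
  shows "continuous_on U (\<lambda>z. circle_mean (\<lambda>w. k z w) R)"
proof -
  have "continuous_on (U \<times> cbox 0 (2*pi)) (\<lambda>p. (fst p, rcis R (snd p)))"
    unfolding rcis_def cis_conv_exp by (intro continuous_intros)
  then have "continuous_on (U \<times> cbox 0 (2*pi)) (\<lambda>p. (\<lambda>(z, w). k z w) (fst p, rcis R (snd p)))"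
    by (rule continuous_on_compose2[OF assms(1)]) (use assms in auto)
  then have "continuous_on U (\<lambda>z. integral (cbox 0 (2*pi)) (\<lambda>t. k z (rcis R t)))"
    by (intro integral_continuous_on_param) (simp add: case_prod_unfold)
  then show ?thesis
    unfolding circle_mean_def by (intro continuous_intros) auto
qed

section \<open>The Poisson kernel and logarithmic means\<close>

definition poisson_kernel :: "real \<Rightarrow> complex \<Rightarrow> complex \<Rightarrow> real" where
  "poisson_kernel R z w = (R\<^sup>2 - (cmod z)\<^sup>2) / (cmod (w - z))\<^sup>2"

text \<open>Cauchy's formula for \<open>w \<mapsto> L w (R\<^sup>2 - \<bar>z\<bar>\<^sup>2) / (R\<^sup>2 - cnj z w)\<close>, which takes the value
  \<open>L z\<close> at \<open>z\<close>: on the circle the Cauchy kernel turns into the Poisson kernel.\<close>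
lemma poisson_formula:
  assumes "L holomorphic_on cball 0 R" "cmod z < R"
  shows "Re (L z) = circle_mean (\<lambda>w. Re (L w) * poisson_kernel R z w) R"
proof -
  have R: "R > 0" using assms(2) norm_ge_zero[of z] by linarith
  define g where "g = (\<lambda>w. L w * (of_real (R\<^sup>2 - (cmod z)\<^sup>2) / (of_real (R\<^sup>2) - cnj z * w)))"
  have nz: "of_real (R\<^sup>2) - cnj z * w \<noteq> 0" if "cmod w \<le> R" for w
  proof
    assume "of_real (R\<^sup>2) - cnj z * w = 0"
    then have "cmod (of_real (R\<^sup>2)) = cmod (cnj z * w)" by simp
    then have "R\<^sup>2 = cmod z * cmod w" by (simp add: norm_mult norm_power)
    moreover have "cmod z * cmod w \<le> cmod z * R" using that by (intro mult_left_mono) auto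
    moreover have "cmod z * R < R * R" using assms R by (intro mult_strict_right_mono) auto
    ultimately show False by (simp add: power2_eq_square)
  qed
  have "g holomorphic_on cball 0 R"
    unfolding g_def using nz by (intro holomorphic_intros assms) auto
  then have "((\<lambda>u. g u / (u - z)) has_contour_integral (2 * of_real pi * \<i> * g z)) (circlepath 0 R)"
    by (rule Cauchy_integral_circlepath_simple) (use assms in auto)
  then have 1: "((\<lambda>t. g (0 + of_real R * cis t) / (0 + of_real R * cis t - z) * of_real R * \<i> * cis t)
      has_integral (2 * of_real pi * \<i> * g z)) {0..2 * pi}"
    unfolding circlepath_def by (subst (asm) has_contour_integral_part_circlepath_iff) auto
  have gz: "g z = L z"
  proof -
    have "of_real (R\<^sup>2 - (cmod z)\<^sup>2) = (of_real (R\<^sup>2) - cnj z * z :: complex)"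
      by (simp add: complex_norm_square mult.commute del: of_real_power)
    with nz[of z] assms show ?thesis by (simp add: g_def)
  qed
  have 2: "g (0 + of_real R * cis t) / (0 + of_real R * cis t - z) * of_real R * \<i> * cis t
      = \<i> * (L (rcis R t) * of_real (poisson_kernel R z (rcis R t)))" for t
  proof -
    define w where "w = rcis R t"
    have ww: "of_real (R\<^sup>2) = w * cnj w"
      using R by (simp add: w_def complex_norm_square[symmetric] del: of_real_power)
    have wz: "w \<noteq> z" using assms R by (auto simp: w_def)
    have wz': "cnj w \<noteq> cnj z" using wz by (simp del: complex_cnj_cancel_iff add: complex_cnj_cancel_iff)
    have wn: "w \<noteq> 0" using R by (simp add: w_def)
    have e: "of_real ((cmod (w - z))\<^sup>2) = (w - z) * (cnj w - cnj z)"
      by (simp add: complex_norm_square del: of_real_power)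
    \<comment> \<open>On the circle R^2 = w * cnj w, so the denominator splits off a factor w, which
      cancels against the w in dw = i w dt.\<close>
    have "of_real (R\<^sup>2) - cnj z * w = w * (cnj w - cnj z)"
      by (simp add: ww algebra_simps del: of_real_power)
    moreover have "l * (c / (w * B)) / A * w * \<i> = \<i> * (l * (c / (A * B)))"
      if "A \<noteq> 0" "B \<noteq> 0" for l c A B :: complex
      using that wn by (simp add: field_simps)
    ultimately have "g w / (w - z) * w * \<i> = \<i> * (L w * of_real (poisson_kernel R z w))"
      using wz wz' unfolding g_def poisson_kernel_def of_real_divide e by simp
    then show ?thesis by (simp add: w_def rcis_def mult_ac)
  qed
  have "((\<lambda>t. - \<i> * (\<i> * (L (rcis R t) * of_real (poisson_kernel R z (rcis R t))))) has_integral
      - \<i> * (2 * of_real pi * \<i> * L z)) {0..2 * pi}"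
    using 1 unfolding 2 gz by (rule has_integral_mult_right)
  moreover have "- \<i> * (\<i> * x) = x" "- \<i> * (2 * of_real pi * \<i> * x) = 2 * of_real pi * x" for x
    by (simp_all flip: mult.assoc)
  ultimately have "((\<lambda>t. L (rcis R t) * of_real (poisson_kernel R z (rcis R t))) has_integral
      (2 * of_real pi * L z)) {0..2 * pi}"
    by (simp only:)
  from has_integral_linear[OF this bounded_linear_Re]
  have "((\<lambda>t. Re (L (rcis R t)) * poisson_kernel R z (rcis R t)) has_integral (2 * pi * Re (L z))) {0..2 * pi}"
    by (simp add: o_def)
  then show ?thesis
    unfolding circle_mean_def by (simp add: integral_unique)
qed

lemma mean_value_formula:
  assumes "L holomorphic_on cball 0 R" "R > 0"
  shows "Re (L 0) = circle_mean (\<lambda>w. Re (L w)) R"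
proof -
  have "Re (L 0) = circle_mean (\<lambda>w. Re (L w) * poisson_kernel R 0 w) R"
    using poisson_formula[OF assms(1), of 0] assms(2) by simp
  also have "\<dots> = circle_mean (\<lambda>w. Re (L w)) R"
    by (rule circle_mean_cong) (use assms in \<open>auto simp: poisson_kernel_def\<close>)
  finally show ?thesis .
qed

lemma circle_mean_poisson_kernel:
  assumes "cmod z < R"
  shows "circle_mean (poisson_kernel R z) R = 1"
  using poisson_formula[of "\<lambda>_. 1" R z] assms by (simp add: holomorphic_on_const)

text \<open>The distance between R e^(i \<psi>) and r e^(i \<theta>) does not change when the two
  angles are exchanged. The mean over the small circle is therefore a mean over the large one, where
  the integrand is a multiple of the Poisson kernel, which has mean one.\<close>

lemma circle_mean_inverse_dist_square:
  assumes "0 \<le> r" "r < cmod v"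
  shows "circle_mean (\<lambda>z. 1 / (cmod (v - z))\<^sup>2) r = 1 / ((cmod v)\<^sup>2 - r\<^sup>2)"
proof -
  define R \<psi> where "R = cmod v" and "\<psi> = Arg v"
  have v: "v = rcis R \<psi>" by (simp add: R_def \<psi>_def rcis_cmod_Arg)
  have R: "r < R" using assms by (simp add: R_def)
  have sym: "cmod (rcis R \<psi> - rcis r \<theta>) = cmod (rcis R \<theta> - rcis r \<psi>)" for \<theta>
  proof -
    have "(cmod (rcis R a - rcis r b))\<^sup>2 = R\<^sup>2 + r\<^sup>2 - 2 * R * r * cos (a - b)" for a b
    proof -
      have "(cmod (rcis R a - rcis r b))\<^sup>2 = R\<^sup>2 * ((sin a)\<^sup>2 + (cos a)\<^sup>2) + r\<^sup>2 * ((sin b)\<^sup>2 + (cos b)\<^sup>2)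
          - 2 * R * r * (cos a * cos b + sin a * sin b)"
      proof -
        have "(R * x - r * y)\<^sup>2 + (R * x' - r * y')\<^sup>2 =
            R\<^sup>2 * (x'\<^sup>2 + x\<^sup>2) + r\<^sup>2 * (y'\<^sup>2 + y\<^sup>2) - 2 * R * r * (x * y + x' * y')" for x y x' y'
          by (simp add: power2_eq_square algebra_simps)
        from this[of "cos a" "cos b" "sin a" "sin b"] show ?thesis
          unfolding cmod_power2 by (simp only: rcis_def) simp
      qed
      then show ?thesis by (simp add: cos_diff)
    qed
    moreover have "cos (\<psi> - \<theta>) = cos (\<theta> - \<psi>)" by (simp add: cos_diff mult.commute)
    ultimately have "(cmod (rcis R \<psi> - rcis r \<theta>))\<^sup>2 = (cmod (rcis R \<theta> - rcis r \<psi>))\<^sup>2"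
      by simp
    then show ?thesis by (simp add: power2_eq_iff_nonneg)
  qed
  have r2: "R\<^sup>2 - r\<^sup>2 \<noteq> 0" using R assms(1) by (simp add: power2_eq_iff_nonneg)
  have "circle_mean (\<lambda>z. 1 / (cmod (v - z))\<^sup>2) r = circle_mean (\<lambda>w. poisson_kernel R (rcis r \<psi>) w / (R\<^sup>2 - r\<^sup>2)) R"
    unfolding circle_mean_def v sym poisson_kernel_def using r2 assms by simp
  also have "\<dots> = circle_mean (\<lambda>w. (1 / (R\<^sup>2 - r\<^sup>2)) * poisson_kernel R (rcis r \<psi>) w) R" by simp
  also have "\<dots> = 1 / (R\<^sup>2 - r\<^sup>2)"
    by (subst circle_mean_cmult, subst circle_mean_poisson_kernel) (use R assms in auto)
  finally show ?thesis by (simp add: R_def)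
qed

text \<open>On the closed disc 1 - c z stays in the right half-plane, so its principal logarithm is
  holomorphic and the mean value formula applies to the real part.\<close>

lemma circle_mean_ln_one_minus:
  assumes "r > 0" "cmod c * r < 1"
  shows "circle_mean (\<lambda>z. ln (cmod (1 - c * z))) r = 0"
proof -
  have re: "Re (1 - c * z) > 0" if "cmod z \<le> r" for z
  proof -
    have "Re (c * z) \<le> cmod (c * z)" by (rule complex_Re_le_cmod)
    also have "\<dots> \<le> cmod c * r" using that by (simp add: norm_mult mult_left_mono)
    finally show ?thesis using assms by simp
  qed
  have "(\<lambda>z. Ln (1 - c * z)) holomorphic_on cball 0 r"
    using re by (intro holomorphic_intros) (force simp: complex_nonpos_Reals_iff)
  from mean_value_formula[OF this assms(1)]
  have "0 = circle_mean (\<lambda>z. Re (Ln (1 - c * z))) r" by simp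
  also have "\<dots> = circle_mean (\<lambda>z. ln (cmod (1 - c * z))) r"
  proof (rule circle_mean_cong)
    fix z assume "cmod z = r"
    then have "1 - c * z \<noteq> 0" using re[of z] by (metis less_irrefl order_refl zero_complex.simps(1))
    then show "Re (Ln (1 - c * z)) = ln (cmod (1 - c * z))" by simp
  qed (use assms in auto)
  finally show ?thesis by simp
qed

text \<open>On the circle |z - b| equals t |1 - c z| for some c with |c| r < 1: for b outside take c
  = 1 / b, for b inside take the reciprocal of the reflected point r^2 / cnj b. The logarithm of |1
  - c z| has mean zero, so only ln t survives.\<close>

lemma circle_mean_ln_dist:
  assumes "r > 0" "cmod b \<noteq> r"
  shows "circle_mean (\<lambda>z. ln (cmod (z - b))) r = ln (max r (cmod b))"
proof -
  obtain c t where c: "cmod c * r < 1" "t > 0" "t = max r (cmod b)"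
    and e: "\<And>z. cmod z = r \<Longrightarrow> cmod (z - b) = t * cmod (1 - c * z)"
  proof (cases "cmod b < r")
    case True
    show ?thesis
    proof (rule that[of "cnj b / r\<^sup>2" r])
      show "cmod (cnj b / r\<^sup>2) * r < 1"
      proof -
        have "cmod (cnj b / r\<^sup>2) * r = cmod b / r"
          using assms by (simp add: norm_divide norm_mult power2_eq_square)
        then show ?thesis using True assms by simp
      qed
      fix z assume z: "cmod z = r"
      have zz: "z * cnj z = r\<^sup>2" using z by (simp add: complex_norm_square[symmetric])
      have "cmod (z - b) = cmod (cnj (z - b))" by (rule complex_mod_cnj[symmetric])
      also have "\<dots> * r = cmod (cnj (z - b) * z)" by (simp add: norm_mult z)
      also have "cnj (z - b) * z = r\<^sup>2 * (1 - cnj b / r\<^sup>2 * z)"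
        using assms zz by (simp add: algebra_simps)
      also have "cmod \<dots> = r * cmod (1 - cnj b / r\<^sup>2 * z) * r"
        by (simp add: norm_mult power2_eq_square)
      finally show "cmod (z - b) = r * cmod (1 - cnj b / r\<^sup>2 * z)" using assms by simp
    qed (use True assms in auto)
  next
    case False
    then have b: "cmod b > r" using assms by simp
    then have bn: "b \<noteq> 0" using assms by auto
    show ?thesis
    proof (rule that[of "1 / b" "cmod b"])
      fix z assume z: "cmod z = r"
      have "z - b = - b * (1 - 1 / b * z)" using bn by (simp add: field_simps)
      then show "cmod (z - b) = cmod b * cmod (1 - 1 / b * z)" by (metis norm_mult norm_minus_cancel)
    qed (use b bn assms in \<open>auto simp: norm_divide field_simps\<close>)
  qed
  have nz: "1 - c * z \<noteq> 0" if "cmod z = r" for z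
  proof
    assume "1 - c * z = 0"
    then have "cmod (c * z) = 1" by (metis eq_iff_diff_eq_0 norm_one)
    then show False using c that by (simp add: norm_mult)
  qed
  have "circle_mean (\<lambda>z. ln (cmod (z - b))) r = circle_mean (\<lambda>z. ln t + ln (cmod (1 - c * z))) r"
    by (rule circle_mean_cong) (use e nz c assms in \<open>auto simp: ln_mult\<close>)
  also have "\<dots> = ln t"
    by (subst circle_mean_add)
       (use assms c nz in \<open>auto intro!: continuous_intros simp: circle_mean_ln_one_minus\<close>)
  finally show ?thesis using c by simp
qed

section \<open>Means of negative powers of the distance to a point\<close>

lemma abs_sin_ge_half:
  fixes y :: real
  assumes "\<bar>y\<bar> \<le> pi / 2"
  shows "\<bar>sin y\<bar> \<ge> \<bar>y\<bar> / 2"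
proof -
  have "\<bar>sin y - y\<bar> \<le> \<bar>y\<bar> ^ 3 / 6"
    using Maclaurin_sin_bound[of y 3]
    by (simp add: sin_coeff_def eval_nat_numeral fact_numeral lessThan_Suc)
  moreover have "\<bar>y\<bar> ^ 3 \<le> 3 * \<bar>y\<bar>"
  proof -
    \<comment> \<open>Since pi / 2 < 1.6 and 1.6^2 < 3, the cubic error term is at most |y| /
      2.\<close>
    have "\<bar>y\<bar> \<le> 1.6" using assms pi_approx by simp
    then have "\<bar>y\<bar> * \<bar>y\<bar> \<le> 1.6 * 1.6" by (intro mult_mono) auto
    then have "\<bar>y\<bar> * \<bar>y\<bar> * \<bar>y\<bar> \<le> 3 * \<bar>y\<bar>" by (intro mult_right_mono) auto
    then show ?thesis by (simp add: eval_nat_numeral)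
  qed
  ultimately show ?thesis by linarith
qed

text \<open>The interval is the range of \<theta> - Arg a for \<theta> in [0, 2 pi]. It contains
  five multiples of pi, and k is the index of the nearest one.\<close>

lemma abs_sin_ge_near_multiple:
  assumes "-pi \<le> x" "x \<le> 3 * pi"
  obtains k where "k \<in> {-1..3::int}" "\<bar>sin x\<bar> \<ge> \<bar>x - of_int k * pi\<bar> / 2"
proof -
  define k where "k = round (x / pi)"
  have "\<bar>x / pi - of_int k\<bar> \<le> 1 / 2"
    unfolding k_def using of_int_round_abs_le[of "x / pi"] by (simp add: abs_minus_commute)
  then have "\<bar>x / pi - of_int k\<bar> * pi \<le> 1 / 2 * pi" by (intro mult_right_mono) auto
  moreover have "\<bar>x / pi - of_int k\<bar> * pi = \<bar>x - of_int k * pi\<bar>"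
  proof -
    have "(x / pi - of_int k) * pi = x - of_int k * pi" by (simp add: field_simps)
    then show ?thesis by (metis abs_mult abs_of_pos pi_gt_zero)
  qed
  ultimately have d: "\<bar>x - of_int k * pi\<bar> \<le> pi / 2" by simp
  have "sin x = sin ((x - of_int k * pi) + of_int k * pi)" by simp
  also have "\<dots> = sin (x - of_int k * pi) * cos (of_int k * pi)"
    unfolding sin_add by (simp add: mult.commute[of _ pi] sin_integer_2pi sin_zero_iff_int2)
  finally have "\<bar>sin x\<bar> = \<bar>sin (x - of_int k * pi)\<bar>"
    by (simp add: abs_mult mult.commute[of _ pi] cos_int_times_real)
  with abs_sin_ge_half[OF d] have b: "\<bar>sin x\<bar> \<ge> \<bar>x - of_int k * pi\<bar> / 2" by simp
  have "-1 \<le> x / pi" "x / pi \<le> 3" using assms by (auto simp: field_simps)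
  then have "-1 \<le> k" "k \<le> 3"
    using round_mono[of "-1" "x / pi"] round_mono[of "x / pi" 3] round_of_int[where 'a = real, of "-1"]
    by (simp_all add: k_def)
  then have "k \<in> {-1..3}" by simp
  with b show ?thesis using that by blast
qed

lemma has_integral_abs_powr:
  assumes "a > (-1::real)" "c \<ge> 0"
  shows "((\<lambda>x. \<bar>x\<bar> powr a) has_integral (2 * (c powr (a + 1) / (a + 1)))) {-c..c}"
proof -
  have 1: "((\<lambda>x. \<bar>x\<bar> powr a) has_integral (c powr (a + 1) / (a + 1))) {0..c}"
    using has_integral_powr_from_0[OF assms] by (rule has_integral_eq[rotated]) auto
  then have "((\<lambda>x. \<bar>-x\<bar> powr a) has_integral (c powr (a + 1) / (a + 1))) {-c..-0}"
    by (subst has_integral_reflect_real) simp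
  then have "((\<lambda>x. \<bar>x\<bar> powr a) has_integral (c powr (a + 1) / (a + 1))) {-c..0}" by simp
  from has_integral_combine[OF _ _ this 1] show ?thesis using assms by simp
qed

text \<open>The bound must not depend on c: after the shift the interval lies in [-6 pi, 6 pi]. The
  points c in use are Arg a + k * pi with k in {-1..3}, hence |c| <= 4 pi.\<close>

lemma integral_abs_powr_shift_bound:
  assumes "0 < \<alpha>" "\<alpha> < 1" "\<bar>c\<bar> \<le> 4 * pi"
  shows "(\<lambda>x. \<bar>x - c\<bar> powr (-\<alpha>)) integrable_on {0..2 * pi}"
    and "integral {0..2 * pi} (\<lambda>x. \<bar>x - c\<bar> powr (-\<alpha>)) \<le> 2 * ((6 * pi) powr (1 - \<alpha>) / (1 - \<alpha>))"
proof -
  define f where "f = (\<lambda>x::real. \<bar>x\<bar> powr (-\<alpha>))"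
  have f: "(f has_integral (2 * ((6 * pi) powr (1 - \<alpha>) / (1 - \<alpha>)))) {-(6*pi)..6*pi}"
    unfolding f_def using has_integral_abs_powr[of "-\<alpha>" "6*pi"] assms by (simp add: add.commute)
  have sub: "{-c..2*pi-c} \<subseteq> {-(6*pi)..6*pi}" using assms by auto
  have fi: "f integrable_on {-c..2*pi-c}"
    by (rule integrable_on_subinterval[OF _ sub]) (use f in blast)
  from integrable_shift_real_ivl[OF this, of "-c"]
  show "(\<lambda>x. \<bar>x - c\<bar> powr (-\<alpha>)) integrable_on {0..2 * pi}" by (simp add: f_def)
  have "integral {0..2 * pi} (\<lambda>x. \<bar>x - c\<bar> powr (-\<alpha>)) = integral {-c..2*pi-c} f"
    using integral_shift_real_ivl[of "-c" "-c" "2*pi-c" f] by (simp add: f_def)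
  also have "\<dots> \<le> integral {-(6*pi)..6*pi} f"
    by (rule integral_subset_le[OF sub fi]) (use f in \<open>auto simp: f_def\<close>)
  also have "\<dots> = 2 * ((6 * pi) powr (1 - \<alpha>) / (1 - \<alpha>))" using f by (rule integral_unique)
  finally show "integral {0..2 * pi} (\<lambda>x. \<bar>x - c\<bar> powr (-\<alpha>)) \<le> 2 * ((6 * pi) powr (1 - \<alpha>) / (1 - \<alpha>))" .
qed

text \<open>A rotation puts a on the nonnegative real axis, where the distance is at least the
  imaginary part.\<close>

lemma dist_rcis_ge:
  assumes "r \<ge> 0"
  shows "cmod (rcis r \<theta> - a) \<ge> r * \<bar>sin (\<theta> - Arg a)\<bar>"
proof -
  have "(rcis r \<theta> - a) * cis (- Arg a) = rcis r (\<theta> - Arg a) - rcis (cmod a) 0"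
  proof -
    have "a * cis (- Arg a) = rcis (cmod a) (Arg a) * rcis 1 (- Arg a)" by (simp add: rcis_cmod_Arg) (simp add: rcis_def)
    also have "\<dots> = rcis (cmod a) 0" by (simp add: rcis_mult)
    finally show ?thesis
      by (simp add: left_diff_distrib rcis_def mult.assoc cis_mult)
  qed
  then have "Im ((rcis r \<theta> - a) * cis (- Arg a)) = r * sin (\<theta> - Arg a)" by simp
  then have "\<bar>r * sin (\<theta> - Arg a)\<bar> \<le> cmod ((rcis r \<theta> - a) * cis (- Arg a))"
    by (metis abs_Im_le_cmod)
  then show ?thesis using assms by (simp add: norm_mult abs_mult)
qed

text \<open>The point is uniformity in a, which may lie arbitrarily close to the circle. The
  distance is at least r |sin (\<theta> - Arg a)|, and the sine is comparable to the distance from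
  the nearest multiple of pi; such a singularity is integrable because \<alpha> < 1.\<close>

lemma circle_mean_dist_powr:
  assumes "0 < \<alpha>" "\<alpha> < 1"
  shows "\<exists>C>0. \<forall>r>0. \<forall>a. cmod a \<noteq> r \<longrightarrow> circle_mean (\<lambda>z. cmod (z - a) powr (-\<alpha>)) r \<le> C * r powr (-\<alpha>)"
proof -
  define K where "K = 2 * ((6 * pi) powr (1 - \<alpha>) / (1 - \<alpha>))"
  define C where "C = 2 powr \<alpha> * (5 * K) / (2 * pi)"
  have K: "K > 0" using assms by (simp add: K_def)
  have C: "C > 0" using K by (simp add: C_def)
  have "circle_mean (\<lambda>z. cmod (z - a) powr (-\<alpha>)) r \<le> C * r powr (-\<alpha>)" if r: "r > 0" "cmod a \<noteq> r" for r a
  proof -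
    define c where "c = (\<lambda>k::int. Arg a + of_int k * pi)"
    have cb: "\<bar>c k\<bar> \<le> 4 * pi" if "k \<in> {-1..3}" for k
    proof -
      have "(-1::real) \<le> of_int k" "of_int k \<le> (3::real)" using that by auto
      from this[THEN mult_right_mono, OF pi_ge_zero]
      have "-1 * pi \<le> of_int k * pi" "of_int k * pi \<le> 3 * pi" by auto
      then show ?thesis using Arg_bounded[of a] unfolding c_def by linarith
    qed
    define lhs where "lhs = (\<lambda>\<theta>. cmod (rcis r \<theta> - a) powr (-\<alpha>))"
    \<comment> \<open>\<open>0 powr (-\<alpha>)\<close> is 0, so the majorant loses its singular
      term at the five points \<open>c k\<close> and may be too small there. Replacing the integrand
      by 0 at these points leaves the integral unchanged.\<close>
    define lhs' where "lhs' = (\<lambda>\<theta>. if \<theta> \<in> c ` {-1..3} then 0 else lhs \<theta>)"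
    define rhs where "rhs = (\<lambda>\<theta>. (r / 2) powr (-\<alpha>) * (\<Sum>k\<in>{-1..3}. \<bar>\<theta> - c k\<bar> powr (-\<alpha>)))"
    have cont: "continuous_on (sphere 0 r) (\<lambda>z. cmod (z - a) powr (-\<alpha>))"
      using r by (intro continuous_intros) auto
    have li: "lhs integrable_on {0..2*pi}"
      unfolding lhs_def by (rule integrable_on_circle[OF cont]) (use r in simp)
    have li': "lhs' integrable_on {0..2*pi}"
      by (rule integrable_spike_finite[OF _ _ li, of "c ` {-1..3}"]) (auto simp: lhs'_def)
    have leq: "integral {0..2*pi} lhs = integral {0..2*pi} lhs'"
      by (rule integral_spike[of "c ` {-1..3}"]) (auto simp: lhs'_def negligible_finite)
    have ri: "rhs integrable_on {0..2*pi}"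
      unfolding rhs_def
      by (intro integrable_on_mult_right integrable_sum integral_abs_powr_shift_bound assms cb) auto
    have le: "lhs' \<theta> \<le> rhs \<theta>" if \<theta>: "\<theta> \<in> {0..2*pi}" for \<theta>
    proof (cases "\<theta> \<in> c ` {-1..3}")
      case True
      then show ?thesis by (simp add: lhs'_def rhs_def sum_nonneg)
    next
      case False
      have "-pi \<le> \<theta> - Arg a" "\<theta> - Arg a \<le> 3 * pi" using \<theta> Arg_bounded[of a] by auto
      then obtain k where k: "k \<in> {-1..3}" "\<bar>sin (\<theta> - Arg a)\<bar> \<ge> \<bar>\<theta> - Arg a - of_int k * pi\<bar> / 2"
        by (rule abs_sin_ge_near_multiple)
      have "\<theta> \<noteq> c k" using False k by auto
      then have pos: "\<bar>\<theta> - c k\<bar> > 0" by simp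
      have "r / 2 * \<bar>\<theta> - c k\<bar> = r * (\<bar>\<theta> - Arg a - of_int k * pi\<bar> / 2)" by (simp add: c_def algebra_simps)
      also have "\<dots> \<le> r * \<bar>sin (\<theta> - Arg a)\<bar>" using k r by (intro mult_left_mono) auto
      also have "\<dots> \<le> cmod (rcis r \<theta> - a)" by (rule dist_rcis_ge) (use r in simp)
      finally have "lhs \<theta> \<le> (r / 2 * \<bar>\<theta> - c k\<bar>) powr (-\<alpha>)"
        unfolding lhs_def by (intro powr_mono2') (use assms r pos in auto)
      also have "\<dots> = (r / 2) powr (-\<alpha>) * \<bar>\<theta> - c k\<bar> powr (-\<alpha>)" using r by (subst powr_mult) auto
      also have "\<dots> \<le> rhs \<theta>"
        unfolding rhs_def by (intro mult_left_mono member_le_sum k) auto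
      finally show ?thesis using False by (simp add: lhs'_def)
    qed
    have "integral {0..2*pi} lhs \<le> integral {0..2*pi} rhs"
      unfolding leq by (rule integral_le[OF li' ri le])
    also have "\<dots> = (r / 2) powr (-\<alpha>) * (\<Sum>k\<in>{-1..3}. integral {0..2*pi} (\<lambda>\<theta>. \<bar>\<theta> - c k\<bar> powr (-\<alpha>)))"
      unfolding rhs_def integral_mult_right
      by (subst integral_sum) (auto intro!: integral_abs_powr_shift_bound assms cb)
    also have "\<dots> \<le> (r / 2) powr (-\<alpha>) * (\<Sum>k\<in>{-1..3::int}. K)"
      unfolding K_def by (intro mult_left_mono sum_mono integral_abs_powr_shift_bound assms cb) auto
    also have "\<dots> = (2 powr \<alpha> * (5 * K)) * r powr (-\<alpha>)"
      using r by (simp add: powr_divide powr_minus divide_simps)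
    finally show ?thesis
      unfolding circle_mean_def C_def lhs_def using pi_gt_zero by (simp add: divide_simps)
  qed
  with C show ?thesis by blast
qed

text \<open>For exponents at most 1 the power is subadditive, so (1 + x)^\<alpha> <= 1 + x^\<alpha>;
  then ln (1 + y) <= y. It trades the logarithmic singularities of the estimates below for powers
  with a known mean.\<close>

lemma ln_one_plus_le_powr:
  fixes x :: real
  assumes "0 < \<alpha>" "\<alpha> \<le> 1" "x \<ge> 0"
  shows "ln (1 + x) \<le> x powr \<alpha> / \<alpha>"
proof (cases "x = 0")
  case False
  then have x: "x > 0" using assms by simp
  have "1 + x \<le> (1 + x powr \<alpha>) powr (1 / \<alpha>)"
  proof -
    define u where "u = 1 / (1 + x)"
    have u: "0 < u" "u < 1" using x by (auto simp: u_def)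
    have xu: "x / (1 + x) = 1 - u" using x by (simp add: u_def field_simps)
    have p: "t \<le> t powr \<alpha>" if "0 < t" "t \<le> 1" for t :: real
      using powr_mono'[of \<alpha> 1 t] that assms by simp
    have "1 = u + (1 - u)" by simp
    also have "\<dots> \<le> u powr \<alpha> + (1 - u) powr \<alpha>" using u by (intro add_mono p) auto
    also have "\<dots> = (1 + x powr \<alpha>) / (1 + x) powr \<alpha>"
      unfolding xu[symmetric] unfolding u_def using x by (simp add: powr_divide add_divide_distrib)
    finally have "(1 + x) powr \<alpha> \<le> 1 + x powr \<alpha>" using x by (simp add: field_simps)
    then have "((1 + x) powr \<alpha>) powr (1 / \<alpha>) \<le> (1 + x powr \<alpha>) powr (1 / \<alpha>)"
      using assms by (intro powr_mono2) auto
    then show ?thesis using assms x by (simp add: powr_powr)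
  qed
  then have "ln (1 + x) \<le> ln ((1 + x powr \<alpha>) powr (1 / \<alpha>))" using x by (subst ln_le_cancel_iff) auto
  also have "\<dots> = ln (1 + x powr \<alpha>) / \<alpha>" using x by (simp add: ln_powr)
  also have "\<dots> \<le> x powr \<alpha> / \<alpha>" using assms by (intro divide_right_mono ln_add_one_self_le_self) auto
  finally show ?thesis .
qed (use assms in auto)

section \<open>The Poisson-Jensen formula\<close>

text \<open>This includes removable singularities at which g carries a wrong value. Expressions
  built pointwise thus need no normalisation: such points have order 0, contribute nothing to the
  sums over bad points, and still form a sparse set together with the zeros and poles.\<close>

definition bad_points :: "(complex \<Rightarrow> complex) \<Rightarrow> complex set" where
  "bad_points g = {z. \<not> g analytic_on {z} \<or> g z = 0}"

definition nonzero_meromorphic :: "(complex \<Rightarrow> complex) \<Rightarrow> bool" where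
  "nonzero_meromorphic g \<longleftrightarrow> g meromorphic_on UNIV \<and> eventually (\<lambda>z. g z \<noteq> 0) (cosparse UNIV)"

definition good_radius :: "(complex \<Rightarrow> complex) \<Rightarrow> real \<Rightarrow> bool" where
  "good_radius g r \<longleftrightarrow> r > 0 \<and> (\<forall>z. cmod z = r \<longrightarrow> z \<notin> bad_points g)"

lemma nonzero_meromorphic_at:
  assumes "nonzero_meromorphic g"
  shows "g meromorphic_on {z}" "eventually (\<lambda>w. g w \<noteq> 0) (at z)" "\<exists>\<^sub>F w in at z. g w \<noteq> 0"
proof -
  show "g meromorphic_on {z}"
    using assms unfolding nonzero_meromorphic_def by (meson meromorphic_on_subset subset_UNIV)
  show ev: "eventually (\<lambda>w. g w \<noteq> 0) (at z)"
    using assms eventually_cosparse_imp_eventually_at[of _ UNIV z UNIV]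
    unfolding nonzero_meromorphic_def by auto
  then show "\<exists>\<^sub>F w in at z. g w \<noteq> 0" by (intro eventually_frequently) auto
qed

lemma nonzero_meromorphicI:
  assumes "g meromorphic_on UNIV" "\<exists>\<^sub>F w in at z. g w \<noteq> 0"
  shows "nonzero_meromorphic g"
proof -
  have "\<not> eventually (\<lambda>z. g z = 0) (cosparse UNIV)"
    using assms(2) eventually_cosparse_imp_eventually_at[of _ UNIV z UNIV] by (auto simp: frequently_def)
  then show ?thesis
    using meromorphic_imp_constant_or_avoid[OF assms(1) open_UNIV connected_UNIV, of 0] assms(1)
    unfolding nonzero_meromorphic_def by blast
qed

lemma bad_points_sparse:
  assumes "nonzero_meromorphic g"
  shows "bad_points g sparse_in UNIV"
proof -
  have "eventually (\<lambda>z. g analytic_on {z} \<and> g z \<noteq> 0) (cosparse UNIV)"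
    using assms unfolding nonzero_meromorphic_def
    by (auto intro: eventually_conj meromorphic_on_imp_analytic_cosparse)
  then show ?thesis unfolding eventually_cosparse bad_points_def by simp
qed

lemma eventually_not_bad:
  assumes "nonzero_meromorphic g"
  shows "eventually (\<lambda>w. w \<notin> bad_points g) (at z)"
proof -
  have "eventually (\<lambda>w. w \<notin> bad_points g) (cosparse UNIV)"
    unfolding eventually_cosparse using bad_points_sparse[OF assms] by simp
  then show ?thesis by (rule eventually_cosparse_imp_eventually_at) auto
qed

lemma finite_bad_points_cball:
  assumes "nonzero_meromorphic g"
  shows "finite (cball 0 r \<inter> bad_points g)"
  using sparse_in_subset[OF bad_points_sparse[OF assms] subset_UNIV] compact_cball
  by (rule sparse_in_compact_finite)

lemma finite_bad_points_ball:
  assumes "nonzero_meromorphic g"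
  shows "finite (bad_points g \<inter> ball 0 r)"
  by (rule finite_subset[OF _ finite_bad_points_cball[OF assms, of r]]) auto

lemma countable_bad_radii:
  assumes "nonzero_meromorphic g"
  shows "countable {r. r > 0 \<and> \<not> good_radius g r}"
proof -
  have "countable (bad_points g)"
    using sparse_imp_countable[OF open_UNIV bad_points_sparse[OF assms]] by simp
  then have "countable (cmod ` bad_points g)" by simp
  then show ?thesis by (rule countable_subset[rotated]) (auto simp: good_radius_def)
qed

lemma zorder_not_bad: "z \<notin> bad_points g \<Longrightarrow> zorder g z = 0"
  by (auto simp: bad_points_def intro: zorder_eq_0I)

lemma good_radius_continuous:
  assumes "good_radius g r"
  shows "continuous_on (sphere 0 r) g"
proof -
  have "g analytic_on sphere 0 r"
    using assms by (subst analytic_on_analytic_at) (auto simp: good_radius_def bad_points_def)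
  then show ?thesis
    by (meson analytic_imp_holomorphic holomorphic_on_imp_continuous_on)
qed

lemma good_radius_nonzero: "good_radius g r \<Longrightarrow> cmod z = r \<Longrightarrow> g z \<noteq> 0"
  by (auto simp: good_radius_def bad_points_def)

lemma good_radius_pos: "good_radius g r \<Longrightarrow> r > 0"
  by (simp add: good_radius_def)

lemma good_radius_continuous_ln:
  assumes "good_radius g r"
  shows "continuous_on (sphere 0 r) (\<lambda>z. ln (cmod (g z)))"
  using good_radius_continuous[OF assms] good_radius_nonzero[OF assms]
  by (intro continuous_intros) auto

lemma zorder_0_remove_sings:
  assumes "g meromorphic_on {z}" "\<exists>\<^sub>F w in at z. g w \<noteq> 0" "zorder g z = 0"
  shows "remove_sings g analytic_on {z}" "remove_sings g z \<noteq> 0"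
proof -
  have iso: "isolated_singularity_at g z" "not_essential g z"
    using assms(1) by (auto simp: meromorphic_at_iff)
  obtain r where nz: "zor_poly g z z \<noteq> 0" and r: "r > 0" "zor_poly g z holomorphic_on cball z r"
      "\<forall>w\<in>cball z r - {z}. g w = zor_poly g z w * (w - z) powi zorder g z \<and> zor_poly g z w \<noteq> 0"
    using zorder_exist[OF iso assms(2)] by blast
  have "isCont (zor_poly g z) z"
    using r by (meson analytic_at_imp_isCont analytic_at ball_subset_cball centre_in_ball holomorphic_on_subset open_ball)
  then have "zor_poly g z \<midarrow>z\<rightarrow> zor_poly g z z" by (simp add: isCont_def)
  moreover have "eventually (\<lambda>w. g w = zor_poly g z w) (at z)"
  proof -
    have "eventually (\<lambda>w. w \<in> ball z r - {z}) (at z)"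
      using r by (intro eventually_at_in_open) auto
    then show ?thesis by eventually_elim (use r assms(3) in auto)
  qed
  ultimately have lim: "g \<midarrow>z\<rightarrow> zor_poly g z z" by (simp add: tendsto_cong)
  show "remove_sings g analytic_on {z}" using remove_sings_analytic_at[OF iso(1) lim] .
  show "remove_sings g z \<noteq> 0" using remove_sings_eqI[OF lim] nz by simp
qed

text \<open>\<open>zor_poly g z z\<close> is the leading Laurent coefficient at z; at the origin it
  is the constant of Jensen's formula.\<close>

lemma zor_poly_limit:
  assumes "nonzero_meromorphic g"
  shows "zor_poly g z z \<noteq> 0" "((\<lambda>w. g w * (w - z) powi (- zorder g z)) \<longlongrightarrow> zor_poly g z z) (at z)"
proof -
  have iso: "isolated_singularity_at g z" "not_essential g z"
    using nonzero_meromorphic_at(1)[OF assms] by (auto simp: meromorphic_at_iff)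
  obtain r where nz: "zor_poly g z z \<noteq> 0" and r: "r > 0" "zor_poly g z holomorphic_on cball z r"
      "\<forall>w\<in>cball z r - {z}. g w = zor_poly g z w * (w - z) powi zorder g z \<and> zor_poly g z w \<noteq> 0"
    using zorder_exist[OF iso nonzero_meromorphic_at(3)[OF assms]] by blast
  show "zor_poly g z z \<noteq> 0" by fact
  have "isCont (zor_poly g z) z"
    using r by (meson analytic_at_imp_isCont analytic_at ball_subset_cball centre_in_ball holomorphic_on_subset open_ball)
  then have "zor_poly g z \<midarrow>z\<rightarrow> zor_poly g z z" by (simp add: isCont_def)
  moreover have "eventually (\<lambda>w. g w * (w - z) powi (- zorder g z) = zor_poly g z w) (at z)"
  proof -
    have "eventually (\<lambda>w. w \<in> ball z r - {z}) (at z)"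
      using r by (intro eventually_at_in_open) auto
    then show ?thesis
      by eventually_elim (use r in \<open>auto simp: power_int_minus field_simps\<close>)
  qed
  ultimately show "((\<lambda>w. g w * (w - z) powi (- zorder g z)) \<longlongrightarrow> zor_poly g z z) (at z)"
    by (simp add: tendsto_cong)
qed

section \<open>Blaschke factors and the formulas of Poisson-Jensen and Jensen\<close>

definition blaschke :: "real \<Rightarrow> complex \<Rightarrow> complex \<Rightarrow> complex" where
  "blaschke R a z = of_real R * (z - a) / (of_real (R\<^sup>2) - cnj a * z)"

lemma blaschke_denom_nonzero:
  assumes "cmod a < R" "cmod z \<le> R"
  shows "of_real (R\<^sup>2) - cnj a * z \<noteq> 0"
proof
  assume "of_real (R\<^sup>2) - cnj a * z = 0"
  then have "cmod (of_real (R\<^sup>2)) = cmod (cnj a * z)" by simp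
  then have "R\<^sup>2 = cmod a * cmod z" by (simp add: norm_mult norm_power)
  moreover have "cmod a * cmod z \<le> cmod a * R" using assms by (intro mult_left_mono) auto
  moreover have "0 < R" using assms(1) norm_ge_zero[of a] by linarith
  moreover have "cmod a * R < R * R" using assms \<open>0 < R\<close> by (intro mult_strict_right_mono) auto
  ultimately show False by (simp add: power2_eq_square)
qed

lemma norm_blaschke_circle:
  assumes "cmod a < R" "cmod z = R"
  shows "cmod (blaschke R a z) = 1"
proof -
  have R: "R > 0" using assms(1) norm_ge_zero[of a] by linarith
  have "of_real (R\<^sup>2) - cnj a * z = z * cnj (z - a)"
    using assms(2) by (simp add: complex_norm_square[of z, symmetric] algebra_simps flip: of_real_power)
  then have "cmod (of_real (R\<^sup>2) - cnj a * z) = R * cmod (z - a)"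
    using assms(2) by (simp add: norm_mult del: of_real_power complex_cnj_diff)
  moreover have "z \<noteq> a" using assms by auto
  ultimately show ?thesis using R by (simp add: blaschke_def norm_divide norm_mult del: of_real_power)
qed

lemma blaschke_nonzero:
  assumes "cmod a < R" "cmod z \<le> R" "z \<noteq> a"
  shows "blaschke R a z \<noteq> 0"
proof -
  have "R > 0" using assms(1) norm_ge_zero[of a] by linarith
  then show ?thesis
    using blaschke_denom_nonzero[OF assms(1,2)] assms(3) by (simp add: blaschke_def)
qed

text \<open>Multiplying g by the powers (z - a)^(-order) leaves order 0 at every point of the closed
  disc. The denominators of the Blaschke factors have no zeros there, so their powers can be put
  into u.\<close>

lemma blaschke_factorization:
  assumes g: "nonzero_meromorphic g" and R: "good_radius g R"
  defines "S \<equiv> bad_points g \<inter> ball 0 R"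
  obtains u where "u holomorphic_on cball 0 R" "\<And>z. z \<in> cball 0 R \<Longrightarrow> u z \<noteq> 0"
    "\<And>z. z \<in> cball 0 R - S \<Longrightarrow> g z = u z * (\<Prod>a\<in>S. blaschke R a z powi zorder g a)"
proof -
  have fin: "finite S" unfolding S_def by (rule finite_bad_points_ball[OF g])
  have R0: "R > 0" using R by (rule good_radius_pos)
  define P where "P = (\<lambda>z. \<Prod>a\<in>S. (z - a) powi (- zorder g a))"
  define v0 where "v0 = (\<lambda>z. g z * P z)"
  \<comment> \<open>At a point of S only the limit of g * P is meaningful, so the singularities are
    removed before the function is claimed to be analytic.\<close>
  define v where "v = remove_sings v0"
  have Pmer: "P meromorphic_on A" for A unfolding P_def by (intro meromorphic_intros)
  have Pan: "P analytic_on {z}" if "z \<notin> S" for z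
    unfolding P_def using that by (intro analytic_intros) auto
  have Pnz: "P z \<noteq> 0" if "z \<notin> S" for z
    unfolding P_def using that fin by (auto simp: power_int_eq_0_iff)
  have Pev: "eventually (\<lambda>z. P z \<noteq> 0) (at z)" for z
  proof -
    have "eventually (\<lambda>w. w \<notin> bad_points g) (at z)" by (rule eventually_not_bad[OF g])
    then show ?thesis by eventually_elim (rule Pnz, auto simp: S_def)
  qed
  have Pzo: "zorder P z = - zorder g z" if z: "z \<in> S" for z
  proof -
    have "zorder P z = (\<Sum>a\<in>S. zorder (\<lambda>w. (w - a) powi (- zorder g a)) z)"
      unfolding P_def
      by (rule zorder_prod) (use Pev[of z] in \<open>auto intro!: meromorphic_intros simp: P_def\<close>)
    also have "\<dots> = (\<Sum>a\<in>S. if a = z then - zorder g z else 0)"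
    proof (rule sum.cong)
      fix a assume a: "a \<in> S"
      show "zorder (\<lambda>w. (w - a) powi (- zorder g a)) z = (if a = z then - zorder g z else 0)"
      proof (cases "a = z")
        case True
        have "zorder (\<lambda>w. (w - a) powi (- zorder g a)) z = - zorder g a"
          by (rule zorder_eqI[of UNIV _ "\<lambda>_. 1"]) (use True in auto)
        then show ?thesis using True by simp
      next
        case False
        then show ?thesis
          by (simp, intro zorder_eq_0I) (auto intro!: analytic_intros simp: power_int_eq_0_iff)
      qed
    qed simp
    also have "\<dots> = - zorder g z" using z fin by simp
    finally show ?thesis .
  qed
  have v_ok: "v analytic_on {z} \<and> v z \<noteq> 0" if z: "z \<notin> bad_points g - S" for z
  proof (cases "z \<in> S")
    case True
    have "zorder v0 z = zorder g z + zorder P z"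
      unfolding v0_def
      by (intro zorder_mult nonzero_meromorphic_at[OF g] Pmer eventually_frequently Pev) auto
    then have "zorder v0 z = 0" using Pzo[OF True] by simp
    moreover have "v0 meromorphic_on {z}"
      unfolding v0_def by (intro meromorphic_intros nonzero_meromorphic_at[OF g] Pmer)
    moreover have "\<exists>\<^sub>F w in at z. v0 w \<noteq> 0"
      using eventually_conj[OF nonzero_meromorphic_at(2)[OF g] Pev, of z]
      by (intro eventually_frequently) (auto simp: v0_def elim!: eventually_mono)
    ultimately show ?thesis unfolding v_def using zorder_0_remove_sings by blast
  next
    case False
    then have nb: "z \<notin> bad_points g" using z by simp
    then have "v0 analytic_on {z}"
      unfolding v0_def using False by (intro analytic_intros Pan) (auto simp: bad_points_def)
    moreover have "v0 z \<noteq> 0" using nb Pnz[OF False] by (auto simp: v0_def bad_points_def)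
    ultimately show ?thesis unfolding v_def
      by (simp add: remove_sings_analytic_on)
  qed
  have out: "z \<notin> bad_points g - S" if "z \<in> cball 0 R" for z
    using that R by (force simp: S_def good_radius_def)
  define u where "u = (\<lambda>z. v z * (\<Prod>a\<in>S. ((of_real (R\<^sup>2) - cnj a * z) / of_real R) powi zorder g a))"
  have dn: "of_real (R\<^sup>2) - cnj a * z \<noteq> 0" if "a \<in> S" "z \<in> cball 0 R" for a z
    using that by (intro blaschke_denom_nonzero) (auto simp: S_def)
  have vh: "v holomorphic_on cball 0 R"
    by (rule analytic_imp_holomorphic, subst analytic_on_analytic_at) (use v_ok out in blast)
  show ?thesis
  proof (rule that[of u])
    show "u holomorphic_on cball 0 R"
      unfolding u_def using dn R0
      by (intro holomorphic_intros vh) (auto simp del: of_real_power)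
    show "u z \<noteq> 0" if "z \<in> cball 0 R" for z
      unfolding u_def using dn[OF _ that] R0 v_ok[OF out[OF that]] fin
      by (auto simp: power_int_eq_0_iff simp del: of_real_power)
    show "g z = u z * (\<Prod>a\<in>S. blaschke R a z powi zorder g a)" if z: "z \<in> cball 0 R - S" for z
    proof -
      have nb: "z \<notin> bad_points g" using out[of z] z by auto
      have "v0 analytic_on {z}"
        unfolding v0_def using z nb by (intro analytic_intros Pan) (auto simp: bad_points_def)
      then have "v z = g z * P z" unfolding v_def by (simp add: v0_def)
      then have "u z * (\<Prod>a\<in>S. blaschke R a z powi zorder g a) = g z * (\<Prod>a\<in>S. (z - a) powi (- zorder g a) *
          ((of_real (R\<^sup>2) - cnj a * z) / of_real R) powi zorder g a * blaschke R a z powi zorder g a)"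
        unfolding u_def P_def by (simp add: prod.distrib mult_ac)
      also have "(\<Prod>a\<in>S. (z - a) powi (- zorder g a) *
          ((of_real (R\<^sup>2) - cnj a * z) / of_real R) powi zorder g a * blaschke R a z powi zorder g a) = (\<Prod>a\<in>S. 1)"
      proof (rule prod.cong)
        fix a assume a: "a \<in> S"
        have "z \<noteq> a" using a z by auto
        have "((of_real (R\<^sup>2) - cnj a * z) / of_real R) * blaschke R a z = z - a"
          using dn[OF a, of z] z R0 by (simp add: blaschke_def del: of_real_power)
        then have "((of_real (R\<^sup>2) - cnj a * z) / of_real R) powi zorder g a * blaschke R a z powi zorder g a = (z - a) powi zorder g a"
          by (metis power_int_mult_distrib)
        then show "(z - a) powi (- zorder g a) *
          ((of_real (R\<^sup>2) - cnj a * z) / of_real R) powi zorder g a * blaschke R a z powi zorder g a = 1"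
          using \<open>z \<noteq> a\<close> by (simp add: power_int_minus mult.assoc)
      qed simp
      finally show ?thesis by simp
    qed
  qed
qed

lemma ln_norm_power_int: "x \<noteq> 0 \<Longrightarrow> ln (cmod (x powi n)) = of_int n * ln (cmod x)"
  by (cases n rule: int_cases2) (simp_all add: norm_power norm_inverse power_int_minus ln_realpow ln_inverse)

lemma ln_norm_prod_power_int:
  assumes "finite S" "\<And>a. a \<in> S \<Longrightarrow> b a \<noteq> 0"
  shows "ln (cmod (\<Prod>a\<in>S. b a powi n a)) = (\<Sum>a\<in>S. of_int (n a) * ln (cmod (b a)))"
  using assms
proof (induction rule: finite_induct)
  case (insert x F)
  have "b x powi n x \<noteq> 0" using insert by (auto simp: power_int_eq_0_iff)
  moreover have "(\<Prod>a\<in>F. b a powi n a) \<noteq> 0" using insert by (auto simp: power_int_eq_0_iff)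
  ultimately show ?case using insert by (simp add: norm_mult ln_mult ln_norm_power_int)
qed simp

text \<open>The zero-free factor u has a holomorphic logarithm on the disc, to which the Poisson
  formula applies. Blaschke factors have modulus 1 on the circle, so |u| may be replaced by |g| in
  the boundary integral.\<close>

theorem poisson_jensen:
  assumes g: "nonzero_meromorphic g" and R: "good_radius g R"
    and z: "cmod z < R" "z \<notin> bad_points g"
  shows "ln (cmod (g z)) = circle_mean (\<lambda>w. ln (cmod (g w)) * poisson_kernel R z w) R
    + (\<Sum>a\<in>bad_points g \<inter> ball 0 R. of_int (zorder g a) * ln (cmod (blaschke R a z)))"
proof -
  define S where "S = bad_points g \<inter> ball 0 R"
  have fin: "finite S" unfolding S_def by (rule finite_bad_points_ball[OF g])
  have R0: "R > 0" using R by (rule good_radius_pos)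
  obtain u where u: "u holomorphic_on cball 0 R" "\<And>z. z \<in> cball 0 R \<Longrightarrow> u z \<noteq> 0"
    "\<And>z. z \<in> cball 0 R - S \<Longrightarrow> g z = u z * (\<Prod>a\<in>S. blaschke R a z powi zorder g a)"
    using blaschke_factorization[OF g R] unfolding S_def by blast
  obtain L where L: "L holomorphic_on cball 0 R" "\<And>z. z \<in> cball 0 R \<Longrightarrow> u z = exp (L z)"
    using contractible_imp_holomorphic_log[OF u(1) _ u(2)] convex_imp_contractible convex_cball by metis
  have ReL: "Re (L w) = ln (cmod (u w))" if "w \<in> cball 0 R" for w
    using L(2)[OF that] by simp
  have ln_g: "ln (cmod (g w)) = ln (cmod (u w)) + (\<Sum>a\<in>S. of_int (zorder g a) * ln (cmod (blaschke R a w)))"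
    if w: "w \<in> cball 0 R - S" for w
  proof -
    have b: "blaschke R a w \<noteq> 0" if "a \<in> S" for a
      using that w by (intro blaschke_nonzero) (auto simp: S_def)
    then have "(\<Prod>a\<in>S. blaschke R a w powi zorder g a) \<noteq> 0" using fin by (auto simp: power_int_eq_0_iff)
    then show ?thesis using u(3)[OF w] u(2)[of w] w b fin
      by (simp add: norm_mult ln_mult ln_norm_prod_power_int)
  qed
  have circ: "ln (cmod (u w)) = ln (cmod (g w))" if "cmod w = R" for w
  proof -
    have "w \<in> cball 0 R - S" using that by (auto simp: S_def)
    from ln_g[OF this] show ?thesis
      using that by (simp add: norm_blaschke_circle S_def)
  qed
  have "ln (cmod (g z)) = Re (L z) + (\<Sum>a\<in>S. of_int (zorder g a) * ln (cmod (blaschke R a z)))"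
    using ln_g[of z] ReL[of z] z by (auto simp: S_def)
  also have "Re (L z) = circle_mean (\<lambda>w. Re (L w) * poisson_kernel R z w) R"
    by (rule poisson_formula[OF L(1) z(1)])
  also have "\<dots> = circle_mean (\<lambda>w. ln (cmod (g w)) * poisson_kernel R z w) R"
    by (rule circle_mean_cong) (use ReL circ R0 in auto)
  finally show ?thesis unfolding S_def .
qed

text \<open>The origin may itself be a zero or a pole, so Poisson-Jensen is applied at z near 0. The
  term k ln |z| is moved to the left, where it turns g into g(z) z^(-k), and then z tends to 0. By
  \<open>ln 0 = 0\<close> the term k ln R that remains is the summand for a = 0.\<close>

theorem jensen:
  assumes g: "nonzero_meromorphic g" and R: "good_radius g R"
  shows "circle_mean (\<lambda>w. ln (cmod (g w))) R = ln (cmod (zor_poly g 0 0))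
    + (\<Sum>a\<in>bad_points g \<inter> ball 0 R. of_int (zorder g a) * (ln R - ln (cmod a)))"
proof -
  define S where "S = bad_points g \<inter> ball 0 R"
  define S' where "S' = S - {0}"
  define T where "T = (\<lambda>z. \<Sum>a\<in>S'. of_int (zorder g a) * ln (cmod (blaschke R a z)))"
  define M where "M = (\<lambda>z. circle_mean (\<lambda>w. ln (cmod (g w)) * poisson_kernel R z w) R)"
  have fin: "finite S" "finite S'" unfolding S_def S'_def by (auto simp: finite_bad_points_ball[OF g])
  have R0: "R > 0" using R by (rule good_radius_pos)
  define k where "k = zorder g 0"
  have pj: "ln (cmod (g z * z powi (- k))) = M z + T z - of_int k * ln R"
    if z: "cmod z < R" "z \<notin> bad_points g" "z \<noteq> 0" for z
  proof -
    have b0: "ln (cmod (blaschke R 0 z)) = ln (cmod z) - ln R"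
      using R0 z by (simp add: blaschke_def norm_divide norm_mult norm_power ln_div power2_eq_square)
    have split: "(\<Sum>a\<in>S. of_int (zorder g a) * ln (cmod (blaschke R a z)))
      = T z + of_int k * ln (cmod (blaschke R 0 z))"
    proof (cases "0 \<in> S")
      case True
      then show ?thesis using fin unfolding T_def S'_def by (subst sum.remove[of _ 0]) (auto simp: k_def)
    next
      case False
      then have "k = 0" using R0 zorder_not_bad[of 0 g] by (auto simp: S_def k_def)
      then show ?thesis using False by (simp add: T_def S'_def)
    qed
    have "g z \<noteq> 0" using z by (auto simp: bad_points_def)
    then have "ln (cmod (g z * z powi (- k))) = ln (cmod (g z)) + of_int (-k) * ln (cmod z)"
      using z by (simp add: norm_mult ln_mult power_int_eq_0_iff ln_norm_power_int del: of_int_minus)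
    also have "\<dots> = M z + T z - of_int k * ln R"
      using poisson_jensen[OF g R z(1,2)] split b0 unfolding S_def[symmetric] M_def
      by (simp add: algebra_simps)
    finally show ?thesis .
  qed
  have "((\<lambda>z. ln (cmod (g z * z powi (- k)))) \<longlongrightarrow> ln (cmod (zor_poly g 0 0))) (at 0)"
    using zor_poly_limit[OF g, of 0] by (intro tendsto_intros) (auto simp: k_def)
  moreover have "((\<lambda>z. M z + T z - of_int k * ln R) \<longlongrightarrow> M 0 + T 0 - of_int k * ln R) (at 0)"
  proof -
    have "continuous_on (ball 0 R) M"
      unfolding M_def
    proof (rule continuous_on_circle_mean)
      have cl: "continuous_on (ball 0 R \<times> sphere 0 R) (\<lambda>p. ln (cmod (g (snd p))))"
        by (rule continuous_on_compose2[OF good_radius_continuous_ln[OF R]]) (auto intro!: continuous_intros)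
      show "continuous_on (ball 0 R \<times> sphere 0 R) (\<lambda>(z, w). ln (cmod (g w)) * poisson_kernel R z w)"
        unfolding poisson_kernel_def case_prod_unfold by (intro continuous_intros cl) auto
    qed (use R0 in auto)
    then have "isCont M 0" using R0 by (simp add: continuous_on_eq_continuous_at)
    moreover have "isCont T 0"
      unfolding T_def blaschke_def using R0 by (intro continuous_intros) (auto simp: S'_def)
    ultimately show ?thesis by (intro tendsto_intros) (simp_all add: isCont_def)
  qed
  moreover have "eventually (\<lambda>z. ln (cmod (g z * z powi (- k))) = M z + T z - of_int k * ln R) (at 0)"
  proof -
    have "eventually (\<lambda>z. z \<in> ball 0 R - {0}) (at 0)" using R0 by (intro eventually_at_in_open) auto
    with eventually_not_bad[OF g, of 0] show ?thesis
      by eventually_elim (use pj in auto)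
  qed
  ultimately have "ln (cmod (zor_poly g 0 0)) = M 0 + T 0 - of_int k * ln R"
    using tendsto_cong tendsto_unique[OF at_neq_bot] by fast
  moreover have "M 0 = circle_mean (\<lambda>w. ln (cmod (g w))) R"
    unfolding M_def by (rule circle_mean_cong) (use R0 in \<open>auto simp: poisson_kernel_def\<close>)
  moreover have "T 0 = - (\<Sum>a\<in>S'. of_int (zorder g a) * (ln R - ln (cmod a)))"
    unfolding T_def sum_negf[symmetric]
  proof (rule sum.cong)
    fix a assume "a \<in> S'"
    then have "a \<noteq> 0" by (auto simp: S'_def)
    moreover have "blaschke R a 0 = - a / of_real R" using R0 by (simp add: blaschke_def power2_eq_square)
    then have "cmod (blaschke R a 0) = cmod a / R" using R0 by (simp add: norm_divide)
    ultimately have "cmod (blaschke R a 0) = cmod a / R" "a \<noteq> 0" by auto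
    then have "ln (cmod (blaschke R a 0)) = - (ln R - ln (cmod a))" using R0 by (simp add: ln_div)
    then show "of_int (zorder g a) * ln (cmod (blaschke R a 0)) = - (of_int (zorder g a) * (ln R - ln (cmod a)))"
      by (simp only:)
  qed simp
  moreover have "(\<Sum>a\<in>S. of_int (zorder g a) * (ln R - ln (cmod a)))
      = (\<Sum>a\<in>S'. of_int (zorder g a) * (ln R - ln (cmod a))) + of_int k * ln R"
  proof (cases "0 \<in> S")
    case True
    then show ?thesis using fin unfolding S'_def by (subst sum.remove[of _ 0]) (auto simp: k_def)
  next
    case False
    then have "k = 0" using R0 zorder_not_bad[of 0 g] by (auto simp: S_def k_def)
    then show ?thesis using False by (simp add: S'_def)
  qed
  ultimately show ?thesis unfolding S_def by linarith
qed

section \<open>Characteristic function and first main theorem\<close>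

lemma log_plus_nonneg [simp]: "log_plus x \<ge> 0"
  by (simp add: log_plus_def)

lemma ln_le_log_plus: "x > 0 \<Longrightarrow> ln x \<le> log_plus x"
  by (simp add: log_plus_def)

lemma log_plus_mono: "x \<le> y \<Longrightarrow> log_plus x \<le> log_plus y"
  by (simp add: log_plus_def)

lemma log_plus_1 [simp]: "log_plus 1 = 0"
  by (simp add: log_plus_def)

lemma log_plus_mult:
  assumes "x \<ge> 0" "y \<ge> 0"
  shows "log_plus (x * y) \<le> log_plus x + log_plus y"
proof -
  have "max 1 (x * y) \<le> max 1 x * max 1 y"
    using mult_mono[of x "max 1 x" y "max 1 y"] mult_mono[of 1 "max 1 x" 1 "max 1 y"] assms by auto
  then have "ln (max 1 (x * y)) \<le> ln (max 1 x * max 1 y)" by (subst ln_le_cancel_iff) auto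
  moreover have "max 1 x \<noteq> 0" "max 1 y \<noteq> 0" by linarith+
  ultimately show ?thesis by (simp add: log_plus_def ln_mult)
qed

lemma log_plus_add:
  assumes "x \<ge> 0" "y \<ge> 0"
  shows "log_plus (x + y) \<le> log_plus x + log_plus y + ln 2"
proof -
  have "1 \<le> max 1 x * max 1 y" "x \<le> max 1 x * max 1 y" "y \<le> max 1 x * max 1 y"
    using mult_mono[of x "max 1 x" 1 "max 1 y"] mult_mono[of 1 "max 1 x" y "max 1 y"]
      mult_mono[of 1 "max 1 x" 1 "max 1 y"] assms by auto
  then have "max 1 (x + y) \<le> max 1 x * max 1 y * 2" by auto
  then have "ln (max 1 (x + y)) \<le> ln (max 1 x * max 1 y * 2)"
    by (subst ln_le_cancel_iff) auto
  also have "\<dots> = ln (max 1 x) + ln (max 1 y) + ln 2"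
  proof -
    have "max 1 x \<noteq> 0" "max 1 y \<noteq> 0" by linarith+
    then show ?thesis by (simp add: ln_mult)
  qed
  finally show ?thesis by (simp add: log_plus_def)
qed

lemma log_plus_power:
  assumes "x \<ge> 0"
  shows "log_plus (x ^ n) = of_nat n * log_plus x"
proof (cases "x \<ge> 1")
  case True
  then have "x ^ n \<ge> 1" by (rule one_le_power)
  then show ?thesis using True by (simp add: log_plus_def max_absorb2 ln_realpow)
next
  case False
  then have "x ^ n \<le> 1" using assms by (intro power_le_one) auto
  then show ?thesis using False by (simp add: log_plus_def max_absorb1)
qed

lemma log_plus_diff_inverse:
  assumes "x > 0"
  shows "log_plus x - log_plus (inverse x) = ln x"
proof (cases "x \<ge> 1")
  case True
  then show ?thesis by (simp add: log_plus_def max_absorb2 max_absorb1 inverse_le_1_iff)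
next
  case False
  then have "inverse x \<ge> 1" using assms by (simp add: one_le_inverse_iff)
  then show ?thesis using False assms by (simp add: log_plus_def max_absorb2 max_absorb1 ln_inverse)
qed

lemma log_plus_add_inverse:
  assumes "x > 0"
  shows "log_plus x + log_plus (inverse x) = \<bar>ln x\<bar>"
proof (cases "x \<ge> 1")
  case True
  then show ?thesis by (simp add: log_plus_def max_absorb2 max_absorb1 inverse_le_1_iff)
next
  case False
  then have "inverse x \<ge> 1" using assms by (simp add: one_le_inverse_iff)
  then show ?thesis using False assms by (simp add: log_plus_def max_absorb2 max_absorb1 ln_inverse)
qed

lemma continuous_on_log_plus [continuous_intros]:
  assumes "continuous_on A f"
  shows "continuous_on A (\<lambda>x. log_plus (f x))"
proof -
  have "max 1 (f x) \<noteq> 0" for x by linarith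
  then show ?thesis unfolding log_plus_def using assms by (intro continuous_intros) auto
qed

definition circle_prox :: "(complex \<Rightarrow> complex) \<Rightarrow> real \<Rightarrow> real" where
  "circle_prox g r = circle_mean (\<lambda>z. log_plus (cmod (g z))) r"

definition pole_mult :: "(complex \<Rightarrow> complex) \<Rightarrow> complex \<Rightarrow> real" where
  "pole_mult g a = max 0 (- of_int (zorder g a))"

text \<open>The convention \<open>ln 0 = 0\<close> gives a pole at the origin the weight \<open>ln r\<close>, as it should have.\<close>
definition pole_sum :: "(complex \<Rightarrow> complex) \<Rightarrow> real \<Rightarrow> real" where
  "pole_sum g r = (\<Sum>a\<in>bad_points g \<inter> ball 0 r. pole_mult g a * (ln r - ln (cmod a)))"

text \<open>On good radii this is \<open>nevanlinna_char\<close>, see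
  \<open>nevanlinna_char_eq_char_sum\<close>. A finite sum over poles replaces the integrated
  counting function, so that inequalities can be checked pole by pole.\<close>

definition char_sum :: "(complex \<Rightarrow> complex) \<Rightarrow> real \<Rightarrow> real" where
  "char_sum g r = circle_prox g r + pole_sum g r"

lemma pole_mult_nonneg [simp]: "pole_mult g a \<ge> 0"
  by (simp add: pole_mult_def)

lemma pole_mult_not_bad: "a \<notin> bad_points g \<Longrightarrow> pole_mult g a = 0"
  by (simp add: pole_mult_def zorder_not_bad)

lemma good_radius_continuous_log_plus:
  assumes "good_radius g r"
  shows "continuous_on (sphere 0 r) (\<lambda>z. log_plus (cmod (g z)))"
  by (intro continuous_intros good_radius_continuous assms)

lemma circle_prox_nonneg: "good_radius g r \<Longrightarrow> circle_prox g r \<ge> 0"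
  unfolding circle_prox_def
  by (rule circle_mean_nonneg) (auto simp: good_radius_continuous_log_plus good_radius_def)

lemma pole_sum_superset:
  assumes "finite S" "bad_points g \<inter> ball 0 r \<subseteq> S" "S \<subseteq> ball 0 r"
  shows "pole_sum g r = (\<Sum>a\<in>S. pole_mult g a * (ln r - ln (cmod a)))"
  unfolding pole_sum_def
proof (rule sum.mono_neutral_left)
  show "\<forall>a\<in>S - bad_points g \<inter> ball 0 r. pole_mult g a * (ln r - ln (cmod a)) = 0"
    using assms pole_mult_not_bad[of _ g] by (metis DiffE IntI mult_zero_left subsetD)
qed (use assms in auto)

text \<open>The condition r >= 1 serves a = 0, whose weight is ln r.\<close>

lemma ln_radius_diff_nonneg:
  assumes "r \<ge> 1" "a \<in> ball 0 r"
  shows "ln r - ln (cmod a) \<ge> 0"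
  using assms by (cases "a = 0") auto

lemma pole_sum_nonneg: "r \<ge> 1 \<Longrightarrow> pole_sum g r \<ge> 0"
  unfolding pole_sum_def by (intro sum_nonneg mult_nonneg_nonneg ln_radius_diff_nonneg) auto

lemma char_sum_ge:
  assumes "good_radius g r" "r \<ge> 1"
  shows "circle_prox g r \<le> char_sum g r" "pole_sum g r \<le> char_sum g r" "char_sum g r \<ge> 0"
  using circle_prox_nonneg[OF assms(1)] pole_sum_nonneg[OF assms(2)] by (auto simp: char_sum_def)

lemma nonzero_meromorphic_inverse:
  assumes "nonzero_meromorphic g"
  shows "nonzero_meromorphic (\<lambda>z. inverse (g z))"
  using assms unfolding nonzero_meromorphic_def by (auto intro!: meromorphic_intros)

lemma good_radius_inverse:
  assumes "good_radius g r"
  shows "good_radius (\<lambda>z. inverse (g z)) r"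
  using assms unfolding good_radius_def bad_points_def by (auto intro!: analytic_intros)

lemma zorder_inverse_meromorphic:
  assumes "nonzero_meromorphic g"
  shows "zorder (\<lambda>z. inverse (g z)) a = - zorder g a"
  using zorder_divide[OF meromorphic_on_const _ nonzero_meromorphic_at(1,3)[OF assms], of 1 a]
  by (simp add: inverse_eq_divide)

lemma pole_sum_inverse:
  assumes g: "nonzero_meromorphic g"
  shows "pole_sum (\<lambda>z. inverse (g z)) r
    = (\<Sum>a\<in>bad_points g \<inter> ball 0 r. max 0 (of_int (zorder g a)) * (ln r - ln (cmod a)))"
proof -
  have e: "pole_mult (\<lambda>z. inverse (g z)) a = max 0 (of_int (zorder g a))" for a
    by (simp add: pole_mult_def zorder_inverse_meromorphic[OF g])
  have "bad_points (\<lambda>z. inverse (g z)) \<subseteq> bad_points g"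
    unfolding bad_points_def by (auto intro: analytic_intros)
  then have "pole_sum (\<lambda>z. inverse (g z)) r
    = (\<Sum>a\<in>bad_points g \<inter> ball 0 r. pole_mult (\<lambda>z. inverse (g z)) a * (ln r - ln (cmod a)))"
    by (intro pole_sum_superset finite_bad_points_ball g) auto
  then show ?thesis by (simp add: e)
qed

lemma circle_mean_ln_prox:
  assumes "good_radius g r"
  shows "circle_mean (\<lambda>z. ln (cmod (g z))) r = circle_prox g r - circle_prox (\<lambda>z. inverse (g z)) r"
    and "circle_mean (\<lambda>z. \<bar>ln (cmod (g z))\<bar>) r = circle_prox g r + circle_prox (\<lambda>z. inverse (g z)) r"
proof -
  have r: "r \<ge> 0" using assms by (simp add: good_radius_def)
  have c: "continuous_on (sphere 0 r) (\<lambda>z. log_plus (cmod (g z)))"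
          "continuous_on (sphere 0 r) (\<lambda>z. log_plus (cmod (inverse (g z))))"
    using good_radius_continuous_log_plus[OF assms] good_radius_continuous_log_plus[OF good_radius_inverse[OF assms]] by auto
  have "circle_mean (\<lambda>z. ln (cmod (g z))) r = circle_mean (\<lambda>z. log_plus (cmod (g z)) - log_plus (cmod (inverse (g z)))) r"
    by (rule circle_mean_cong) (use good_radius_nonzero[OF assms] r in \<open>auto simp: norm_inverse log_plus_diff_inverse\<close>)
  then show "circle_mean (\<lambda>z. ln (cmod (g z))) r = circle_prox g r - circle_prox (\<lambda>z. inverse (g z)) r"
    by (simp add: circle_mean_diff c r circle_prox_def)
  have "circle_mean (\<lambda>z. \<bar>ln (cmod (g z))\<bar>) r = circle_mean (\<lambda>z. log_plus (cmod (g z)) + log_plus (cmod (inverse (g z)))) r"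
    by (rule circle_mean_cong) (use good_radius_nonzero[OF assms] r in \<open>auto simp: norm_inverse log_plus_add_inverse\<close>)
  then show "circle_mean (\<lambda>z. \<bar>ln (cmod (g z))\<bar>) r = circle_prox g r + circle_prox (\<lambda>z. inverse (g z)) r"
    by (simp add: circle_mean_add c r circle_prox_def)
qed

text \<open>Jensen's formula with the orders split into zeros and poles, and ln split into log^+ of
  the modulus and of its reciprocal.\<close>

theorem first_main_theorem:
  assumes g: "nonzero_meromorphic g" and r: "good_radius g r"
  shows "char_sum g r = char_sum (\<lambda>z. inverse (g z)) r + ln (cmod (zor_poly g 0 0))"
proof -
  have "(\<Sum>a\<in>bad_points g \<inter> ball 0 r. of_int (zorder g a) * (ln r - ln (cmod a)))
    = pole_sum (\<lambda>z. inverse (g z)) r - pole_sum g r"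
    unfolding pole_sum_inverse[OF g] unfolding pole_sum_def pole_mult_def sum_subtractf[symmetric]
    by (rule sum.cong) (auto simp: max_def algebra_simps)
  then show ?thesis
    using jensen[OF g r] circle_mean_ln_prox(1)[OF r] by (simp add: char_sum_def)
qed

section \<open>Monotonicity of the characteristic\<close>

lemma blaschke_norm_le_1:
  assumes "cmod a < R" "cmod z \<le> R"
  shows "cmod (blaschke R a z) \<le> 1"
proof -
  have R: "R > 0" using assms(1) norm_ge_zero[of a] by linarith
  have "(cmod (of_real (R\<^sup>2) - cnj a * z))\<^sup>2 - (cmod (of_real R * (z - a)))\<^sup>2
      = (R\<^sup>2 - (cmod a)\<^sup>2) * (R\<^sup>2 - (cmod z)\<^sup>2)"
    unfolding cmod_power2 by (simp add: power2_eq_square algebra_simps)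
  moreover have "(cmod a)\<^sup>2 \<le> R\<^sup>2" "(cmod z)\<^sup>2 \<le> R\<^sup>2"
    using assms R by (auto intro!: power_mono)
  ultimately have "(cmod (of_real R * (z - a)))\<^sup>2 \<le> (cmod (of_real (R\<^sup>2) - cnj a * z))\<^sup>2"
    by (smt (verit) mult_nonneg_nonneg)
  then have "cmod (of_real R * (z - a)) \<le> cmod (of_real (R\<^sup>2) - cnj a * z)"
    by (rule power2_le_imp_le) simp
  moreover have "of_real (R\<^sup>2) - cnj a * z \<noteq> 0" by (rule blaschke_denom_nonzero[OF assms])
  ultimately show ?thesis unfolding blaschke_def norm_divide by (simp del: of_real_power)
qed

lemma continuous_on_ln_blaschke:
  assumes "cmod a < R" "r \<le> R" "cmod a \<noteq> r"
  shows "continuous_on (sphere 0 r) (\<lambda>z. ln (cmod (blaschke R a z)))"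
proof -
  have "continuous_on (sphere 0 r) (blaschke R a)"
    unfolding blaschke_def using blaschke_denom_nonzero[OF assms(1)] assms
    by (intro continuous_intros) (auto simp del: of_real_power)
  moreover have "blaschke R a z \<noteq> 0" if "z \<in> sphere 0 r" for z
    using blaschke_nonzero[OF assms(1), of z] assms that by auto
  ultimately show ?thesis by (intro continuous_intros) auto
qed

text \<open>The mean of the Green potential of a. It is exactly what a simple pole at a adds to the
  pole sum between r and R: ln R - ln r if a lies inside the smaller circle, ln R - ln |a| if it
  lies in the annulus.\<close>

lemma circle_mean_ln_blaschke:
  assumes "cmod a < R" "0 < r" "r \<le> R" "cmod a \<noteq> r"
  shows "circle_mean (\<lambda>z. - ln (cmod (blaschke R a z))) r = ln R - ln (max r (cmod a))"
proof -
  have R: "R > 0" using assms by linarith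
  define c where "c = cnj a / of_real (R\<^sup>2)"
  have c: "cmod c * r < 1"
  proof -
    have "cmod a * r < R * R"
      by (rule le_less_trans[OF mult_left_mono mult_strict_right_mono[OF assms(1) R]]) (use assms in auto)
    then show ?thesis using R by (simp add: c_def norm_divide norm_power power2_eq_square norm_mult)
  qed
  have nz: "1 - c * z \<noteq> 0" if "cmod z = r" for z
  proof
    assume "1 - c * z = 0"
    then have "cmod (c * z) = 1" by (metis eq_iff_diff_eq_0 norm_one)
    then show False using c that by (simp add: norm_mult)
  qed
  have "circle_mean (\<lambda>z. - ln (cmod (blaschke R a z))) r = circle_mean (\<lambda>z. ln R + ln (cmod (1 - c * z)) - ln (cmod (z - a))) r"
  proof (rule circle_mean_cong)
    fix z assume z: "cmod z = r"
    have "z \<noteq> a" using z assms by auto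
    have "of_real (R\<^sup>2) - cnj a * z = of_real (R\<^sup>2) * (1 - c * z)"
      using R by (simp add: c_def field_simps)
    then have "cmod (blaschke R a z) = cmod (z - a) / (R * cmod (1 - c * z))"
      using R by (simp add: blaschke_def norm_mult norm_divide power2_eq_square)
    then show "- ln (cmod (blaschke R a z)) = ln R + ln (cmod (1 - c * z)) - ln (cmod (z - a))"
      using R nz[OF z] \<open>z \<noteq> a\<close> by (simp add: ln_div ln_mult)
  qed (use assms in auto)
  also have "\<dots> = ln R - ln (max r (cmod a))"
  proof -
    have c1: "continuous_on (sphere 0 r) (\<lambda>z. ln R + ln (cmod (1 - c * z)))"
      using nz by (intro continuous_intros) auto
    have c2: "continuous_on (sphere 0 r) (\<lambda>z. ln (cmod (1 - c * z)))"
      using nz by (intro continuous_intros) auto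
    have c3: "continuous_on (sphere 0 r) (\<lambda>z. ln (cmod (z - a)))"
      using assms by (intro continuous_intros) auto
    show ?thesis
      using circle_mean_diff[OF c1 c3] circle_mean_add[OF _ c2, of "\<lambda>_. ln R"]
        circle_mean_ln_one_minus[OF assms(2) c] circle_mean_ln_dist[OF assms(2,4)] assms
      by (simp add: continuous_on_const)
  qed
  finally show ?thesis .
qed

lemma continuous_on_poisson_kernel:
  assumes "U \<subseteq> ball 0 R"
  shows "continuous_on (U \<times> sphere 0 R) (\<lambda>(z, w). poisson_kernel R z w)"
  unfolding poisson_kernel_def case_prod_unfold using assms by (intro continuous_intros) auto

lemma poisson_kernel_nonneg: "cmod z \<le> R \<Longrightarrow> poisson_kernel R z w \<ge> 0"
  unfolding poisson_kernel_def by (auto intro!: divide_nonneg_nonneg power_mono)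

lemma continuous_on_snd_circle:
  assumes "continuous_on (sphere 0 R) u"
  shows "continuous_on (U \<times> sphere 0 R) (\<lambda>p. u (snd p))"
  by (rule continuous_on_compose2[OF assms]) (auto intro!: continuous_intros)

text \<open>After the two means are interchanged, the kernel is averaged in z over the smaller
  circle, and that average is one by \<open>circle_mean_inverse_dist_square\<close>.\<close>

lemma circle_mean_poisson_integral:
  assumes "continuous_on (sphere 0 R) u" "0 \<le> r" "r < R"
  shows "continuous_on (sphere 0 r) (\<lambda>z. circle_mean (\<lambda>w. u w * poisson_kernel R z w) R)"
    and "circle_mean (\<lambda>z. circle_mean (\<lambda>w. u w * poisson_kernel R z w) R) r = circle_mean u R"
proof -
  have c: "continuous_on (sphere 0 r \<times> sphere 0 R) (\<lambda>(z, w). u w * poisson_kernel R z w)"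
  proof -
    have "sphere 0 r \<subseteq> ball 0 R" using assms by auto
    from continuous_on_mult[OF continuous_on_snd_circle[OF assms(1)] continuous_on_poisson_kernel[OF this, unfolded case_prod_unfold]]
    show ?thesis by (simp add: case_prod_unfold)
  qed
  show "continuous_on (sphere 0 r) (\<lambda>z. circle_mean (\<lambda>w. u w * poisson_kernel R z w) R)"
    by (rule continuous_on_circle_mean[OF c]) (use assms in auto)
  have "circle_mean (\<lambda>z. circle_mean (\<lambda>w. u w * poisson_kernel R z w) R) r
    = circle_mean (\<lambda>w. circle_mean (\<lambda>z. u w * poisson_kernel R z w) r) R"
    by (rule circle_mean_swap[OF c]) (use assms in auto)
  also have "\<dots> = circle_mean u R"
  proof (rule circle_mean_cong)
    fix w assume w: "cmod w = R"
    have "circle_mean (\<lambda>z. poisson_kernel R z w) r = circle_mean (\<lambda>z. (R\<^sup>2 - r\<^sup>2) * (1 / (cmod (w - z))\<^sup>2)) r"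
      by (rule circle_mean_cong) (use assms in \<open>auto simp: poisson_kernel_def\<close>)
    also have "\<dots> = (R\<^sup>2 - r\<^sup>2) * (1 / (R\<^sup>2 - r\<^sup>2))"
      unfolding circle_mean_cmult using circle_mean_inverse_dist_square[of r w] assms w by simp
    also have "\<dots> = 1" using assms by (simp add: power2_eq_iff_nonneg)
    finally show "circle_mean (\<lambda>z. u w * poisson_kernel R z w) r = u w" by (simp add: circle_mean_cmult)
  qed (use assms in auto)
  finally show "circle_mean (\<lambda>z. circle_mean (\<lambda>w. u w * poisson_kernel R z w) R) r = circle_mean u R" .
qed

text \<open>The logarithm of \<open>\<bar>g\<bar>\<close> is majorised by the Poisson integral of \<open>log\<^sup>+ \<bar>g\<bar>\<close> plus the Green
  potentials of the poles; averaging this over the smaller circle gives exactly the difference.\<close>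
theorem char_sum_mono:
  assumes g: "nonzero_meromorphic g" and r: "good_radius g r" and R: "good_radius g R" and "r \<le> R"
  shows "char_sum g r \<le> char_sum g R"
proof (cases "r = R")
  case False
  then have rR: "r < R" using \<open>r \<le> R\<close> by simp
  have r0: "r > 0" using r by (rule good_radius_pos)
  define S where "S = bad_points g \<inter> ball 0 R"
  have fin: "finite S" unfolding S_def by (rule finite_bad_points_ball[OF g])
  have Sr: "cmod a \<noteq> r" "cmod a < R" if "a \<in> S" for a
    using that r by (auto simp: S_def good_radius_def)
  define M where "M = (\<lambda>z. circle_mean (\<lambda>w. log_plus (cmod (g w)) * poisson_kernel R z w) R)"
  define G where "G = (\<lambda>z. \<Sum>a\<in>S. pole_mult g a * (- ln (cmod (blaschke R a z))))"
  have cl: "continuous_on (sphere 0 R) (\<lambda>w. log_plus (cmod (g w)))"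
    by (rule good_radius_continuous_log_plus[OF R])
  have cM: "continuous_on (sphere 0 r) M" and mM: "circle_mean M r = circle_prox g R"
    unfolding M_def circle_prox_def using circle_mean_poisson_integral[OF cl _ rR] r0 by auto
  have cB: "continuous_on (sphere 0 r) (\<lambda>z. - ln (cmod (blaschke R a z)))" if "a \<in> S" for a
    using Sr[OF that] rR by (intro continuous_intros continuous_on_ln_blaschke) auto
  have cG: "continuous_on (sphere 0 r) G"
    unfolding G_def by (intro continuous_on_sum continuous_on_mult continuous_on_const cB)
  have ckern: "continuous_on (sphere 0 R) (poisson_kernel R z)" if "cmod z < R" for z
    unfolding poisson_kernel_def using that by (intro continuous_intros) auto
  have le: "log_plus (cmod (g z)) \<le> M z + G z" if z: "cmod z = r" for z
  proof -
    have zb: "z \<notin> bad_points g" using r z by (auto simp: good_radius_def)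
    have zR: "cmod z < R" using z rR by simp
    have M0: "M z \<ge> 0"
      unfolding M_def using zR R
      by (intro circle_mean_nonneg continuous_on_mult cl ckern mult_nonneg_nonneg poisson_kernel_nonneg)
         (auto simp: good_radius_def)
    have B: "ln (cmod (blaschke R a z)) \<le> 0" if a: "a \<in> S" for a
    proof -
      have "blaschke R a z \<noteq> 0" using a Sr[OF a] z rR by (intro blaschke_nonzero) auto
      moreover have "cmod (blaschke R a z) \<le> 1" using Sr[OF a] z rR by (intro blaschke_norm_le_1) auto
      ultimately show ?thesis by simp
    qed
    have G0: "G z \<ge> 0" unfolding G_def using B by (intro sum_nonneg mult_nonneg_nonneg) auto
    have "ln (cmod (g z)) = circle_mean (\<lambda>w. ln (cmod (g w)) * poisson_kernel R z w) R
        + (\<Sum>a\<in>S. of_int (zorder g a) * ln (cmod (blaschke R a z)))"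
      unfolding S_def by (rule poisson_jensen[OF g R zR zb])
    also have "circle_mean (\<lambda>w. ln (cmod (g w)) * poisson_kernel R z w) R \<le> M z"
      unfolding M_def
    proof (rule circle_mean_mono)
      fix w assume w: "cmod w = R"
      show "ln (cmod (g w)) * poisson_kernel R z w \<le> log_plus (cmod (g w)) * poisson_kernel R z w"
        using zR good_radius_nonzero[OF R w] by (intro mult_right_mono ln_le_log_plus poisson_kernel_nonneg) auto
    qed (use R good_radius_continuous_ln[OF R] in \<open>auto intro!: continuous_on_mult cl ckern zR simp: good_radius_def\<close>)
    also have "(\<Sum>a\<in>S. of_int (zorder g a) * ln (cmod (blaschke R a z))) \<le> G z"
      unfolding G_def
    proof (rule sum_mono)
      fix a assume a: "a \<in> S"
      have "- of_int (zorder g a) * (- ln (cmod (blaschke R a z))) \<le> pole_mult g a * (- ln (cmod (blaschke R a z)))"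
        using B[OF a] by (intro mult_right_mono) (auto simp: pole_mult_def)
      then show "of_int (zorder g a) * ln (cmod (blaschke R a z)) \<le> pole_mult g a * (- ln (cmod (blaschke R a z)))" by simp
    qed
    finally have "ln (cmod (g z)) \<le> M z + G z" by simp
    moreover have "M z + G z \<ge> 0" using M0 G0 by simp
    ultimately show ?thesis using good_radius_nonzero[OF r z] by (simp add: log_plus_def max_def)
  qed
  have "circle_prox g r \<le> circle_mean (\<lambda>z. M z + G z) r"
    unfolding circle_prox_def
    by (rule circle_mean_mono) (use le r0 cM cG good_radius_continuous_log_plus[OF r] in \<open>auto intro!: continuous_on_add\<close>)
  also have "\<dots> = circle_prox g R + circle_mean G r"
    using cM cG r0 by (subst circle_mean_add) (auto simp: mM)
  also have "circle_mean G r = (\<Sum>a\<in>S. pole_mult g a * (ln R - ln (max r (cmod a))))"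
  proof -
    have "circle_mean G r = (\<Sum>a\<in>S. circle_mean (\<lambda>z. pole_mult g a * (- ln (cmod (blaschke R a z)))) r)"
      unfolding G_def
    proof (rule circle_mean_sum)
      show "continuous_on (sphere 0 r) (\<lambda>z. pole_mult g a * (- ln (cmod (blaschke R a z))))" if "a \<in> S" for a
        by (rule continuous_on_mult[OF continuous_on_const cB[OF that]])
    qed (use fin r0 in auto)
    also have "\<dots> = (\<Sum>a\<in>S. pole_mult g a * (ln R - ln (max r (cmod a))))"
      unfolding circle_mean_cmult using r0 rR Sr
      by (intro sum.cong arg_cong2[where f = "(*)"] refl circle_mean_ln_blaschke) auto
    finally show ?thesis .
  qed
  also have "\<dots> = pole_sum g R - pole_sum g r"
  proof -
    have sub: "bad_points g \<inter> ball 0 r = S \<inter> ball 0 r" using rR by (auto simp: S_def)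
    have "pole_sum g r = (\<Sum>a\<in>S. if a \<in> ball 0 r then pole_mult g a * (ln r - ln (cmod a)) else 0)"
      unfolding pole_sum_def sub using fin by (simp add: sum.inter_restrict)
    then show ?thesis
      unfolding pole_sum_def S_def[symmetric] using Sr
      by (simp add: sum_subtractf[symmetric], intro sum.cong) (auto simp: max_def algebra_simps)
  qed
  finally show ?thesis by (simp add: char_sum_def)
qed simp

definition zero_pole_count :: "(complex \<Rightarrow> complex) \<Rightarrow> real \<Rightarrow> real" where
  "zero_pole_count g r = (\<Sum>a\<in>bad_points g \<inter> ball 0 r. \<bar>of_int (zorder g a)\<bar>)"

lemma zero_pole_count_nonneg [simp]: "zero_pole_count g r \<ge> 0"
  unfolding zero_pole_count_def by (intro sum_nonneg) auto

text \<open>Every zero or pole in the disc of radius R has weight at least ln R' - ln R in the sums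
  taken at R'.\<close>

lemma zero_pole_count_le:
  assumes g: "nonzero_meromorphic g" and "1 \<le> R" "R < R'"
  shows "zero_pole_count g R * (ln R' - ln R) \<le> pole_sum g R' + pole_sum (\<lambda>z. inverse (g z)) R'"
proof -
  have "zero_pole_count g R * (ln R' - ln R)
      \<le> (\<Sum>a\<in>bad_points g \<inter> ball 0 R. \<bar>of_int (zorder g a)\<bar> * (ln R' - ln (cmod a)))"
    unfolding zero_pole_count_def sum_distrib_right
  proof (intro sum_mono mult_left_mono)
    fix a assume "a \<in> bad_points g \<inter> ball 0 R"
    then show "ln R' - ln R \<le> ln R' - ln (cmod a)"
      using ln_radius_diff_nonneg[of R a] assms by auto
  qed auto
  also have "\<dots> \<le> (\<Sum>a\<in>bad_points g \<inter> ball 0 R'. \<bar>of_int (zorder g a)\<bar> * (ln R' - ln (cmod a)))"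
    using assms by (intro sum_mono2 mult_nonneg_nonneg finite_bad_points_ball g ln_radius_diff_nonneg) auto
  also have "\<dots> = pole_sum g R' + pole_sum (\<lambda>z. inverse (g z)) R'"
    unfolding pole_sum_inverse[OF g] unfolding pole_sum_def pole_mult_def sum.distrib[symmetric]
    by (rule sum.cong) (auto simp: max_def algebra_simps)
  finally show ?thesis .
qed

section \<open>Differences and logarithmic derivatives\<close>

lemma not_bad_shift:
  assumes "z + \<eta> \<notin> bad_points g"
  shows "z \<notin> bad_points (\<lambda>z. g (z + \<eta>))"
proof -
  have "(g \<circ> (\<lambda>z. z + \<eta>)) analytic_on {z}"
    using assms by (intro analytic_on_compose analytic_intros) (auto simp: bad_points_def)
  then show ?thesis using assms by (simp add: bad_points_def o_def)
qed

lemma good_radius_shift: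
  assumes "r > 0" "\<And>z. cmod z = r \<Longrightarrow> z + \<eta> \<notin> bad_points g"
  shows "good_radius (\<lambda>z. g (z + \<eta>)) r"
  using assms not_bad_shift by (auto simp: good_radius_def)

lemma poisson_kernel_Re:
  assumes "cmod w = R" "w \<noteq> z"
  shows "poisson_kernel R z w = Re ((w + z) / (w - z))"
proof -
  have "(w + z) / (w - z) = ((w + z) * cnj (w - z)) / of_real ((cmod (w - z))\<^sup>2)"
    by (subst complex_div_cnj) simp
  then have "Re ((w + z) / (w - z)) = Re ((w + z) * cnj (w - z)) / (cmod (w - z))\<^sup>2"
    by (simp only: Re_divide_of_real)
  also have "Re ((w + z) * cnj (w - z)) = (cmod w)\<^sup>2 - (cmod z)\<^sup>2"
    unfolding cmod_power2 by (simp add: power2_eq_square algebra_simps)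
  finally show ?thesis using assms by (simp add: poisson_kernel_def)
qed

lemma poisson_kernel_diff:
  assumes "cmod w = R" "w \<noteq> z" "w \<noteq> z'"
  shows "\<bar>poisson_kernel R z' w - poisson_kernel R z w\<bar> \<le> 2 * R * cmod (z' - z) / (cmod (w - z') * cmod (w - z))"
proof -
  have "(w + z') / (w - z') - (w + z) / (w - z) = 2 * w * (z' - z) / ((w - z') * (w - z))"
    using assms by (simp add: diff_frac_eq) (simp add: algebra_simps)
  then have "poisson_kernel R z' w - poisson_kernel R z w = Re (2 * w * (z' - z) / ((w - z') * (w - z)))"
    using assms by (simp add: poisson_kernel_Re flip: minus_complex.simps)
  then have "\<bar>poisson_kernel R z' w - poisson_kernel R z w\<bar> \<le> cmod (2 * w * (z' - z) / ((w - z') * (w - z)))"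
    by (simp add: abs_Re_le_cmod)
  then show ?thesis using assms by (simp add: norm_mult norm_divide)
qed

lemma ln_diff_le_ln_one_plus:
  fixes x y d :: real
  assumes "x > 0" "y > 0" "x - y \<le> d"
  shows "ln x - ln y \<le> ln (1 + d / y)"
proof -
  have "x / y \<le> 1 + d / y" using assms by (simp add: field_simps)
  then have "ln (x / y) \<le> ln (1 + d / y)" using assms by (subst ln_le_cancel_iff) (auto intro: less_le_trans[of _ "x / y"])
  then show ?thesis using assms by (simp add: ln_div)
qed

text \<open>For \<open>a = 0\<close> the reflected point \<open>b\<close> has the junk value 0, which is harmless as the denominator of the
  Blaschke factor is then constant.\<close>
lemma ln_blaschke_diff:
  assumes "cmod a < R" "cmod z < R" "cmod z' < R" "z \<noteq> a" "z' \<noteq> a"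
  defines "t \<equiv> cmod (z' - z)" and "b \<equiv> of_real (R\<^sup>2) / cnj a"
  shows "\<bar>ln (cmod (blaschke R a z')) - ln (cmod (blaschke R a z))\<bar>
    \<le> ln (1 + t / cmod (z - a)) + ln (1 + t / cmod (z' - a)) + (ln (1 + t / cmod (z - b)) + ln (1 + t / cmod (z' - b)))"
proof -
  have t0: "t \<ge> 0" by (simp add: t_def)
  have R: "R > 0" using assms(1) norm_ge_zero[of a] by linarith
  have *: "ln (cmod (blaschke R a y)) - ln (cmod (blaschke R a x)) \<le> ln (1 + t / cmod (x - a)) + ln (1 + t / cmod (y - b))"
    if xy: "cmod x < R" "cmod y < R" "x \<noteq> a" "y \<noteq> a" "cmod (y - x) = t" for x y
  proof -
    define D where "D = (\<lambda>z. of_real (R\<^sup>2) - cnj a * z)"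
    have D0: "cmod (D x) > 0" "cmod (D y) > 0"
      using blaschke_denom_nonzero[OF assms(1)] xy by (auto simp: D_def simp del: of_real_power)
    have e: "ln (cmod (blaschke R a u)) = ln R + ln (cmod (u - a)) - ln (cmod (D u))" if "cmod (D u) > 0" "u \<noteq> a" for u
      using that R by (simp add: blaschke_def D_def norm_divide norm_mult ln_div ln_mult del: of_real_power)
    have "ln (cmod (y - a)) - ln (cmod (x - a)) \<le> ln (1 + t / cmod (x - a))"
      using xy norm_triangle_ineq[of "y - x" "x - a"] by (intro ln_diff_le_ln_one_plus) auto
    moreover have "ln (cmod (D x)) - ln (cmod (D y)) \<le> ln (1 + t / cmod (y - b))"
    proof (cases "a = 0")
      case False
      have "ln (cmod (D x)) - ln (cmod (D y)) \<le> ln (1 + (cmod a * t) / cmod (D y))"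
      proof (rule ln_diff_le_ln_one_plus[OF D0])
        have "cmod (D x) - cmod (D y) \<le> cmod (D x - D y)" by (rule norm_triangle_ineq2)
        also have "D x - D y = cnj a * (y - x)" by (simp add: D_def algebra_simps)
        also have "cmod \<dots> \<le> cmod a * t" using xy by (simp add: norm_mult)
        finally show "cmod (D x) - cmod (D y) \<le> cmod a * t" .
      qed
      moreover have "D y = - cnj a * (y - b)" using False by (simp add: D_def b_def algebra_simps)
      then have "cmod (D y) = cmod a * cmod (y - b)" by (simp add: norm_mult)
      ultimately show ?thesis using False by simp
    qed (use t0 in \<open>simp add: D_def\<close>)
    ultimately show ?thesis using e[OF D0(1)] e[OF D0(2)] xy by linarith
  qed
  have l0: "ln (1 + t / cmod u) \<ge> 0" for u using t0 by simp
  show ?thesis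
    using *[of z z'] *[of z' z] assms(2-5) l0[of "z - a"] l0[of "z' - a"] l0[of "z - b"] l0[of "z' - b"] norm_minus_commute[of z z']
    unfolding t_def[symmetric] by linarith
qed

text \<open>Subtraction of the Poisson-Jensen formulas at the two points; \<open>b a\<close> is the
  reflection of a in the circle and comes from the denominator of the Blaschke factor. No smallness
  of z' - z is assumed, so the estimate serves both the fixed shift by \<eta> and, in the limit, the
  derivative.\<close>

lemma log_norm_difference:
  assumes g: "nonzero_meromorphic g" and R: "good_radius g R"
    and z: "cmod z < R" "z \<notin> bad_points g" and z': "cmod z' < R" "z' \<notin> bad_points g"
  defines "t \<equiv> cmod (z' - z)" and "b \<equiv> \<lambda>a. of_real (R\<^sup>2) / cnj a"
  shows "\<bar>ln (cmod (g z')) - ln (cmod (g z))\<bar>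
    \<le> circle_mean (\<lambda>w. \<bar>ln (cmod (g w))\<bar> * (2 * R * t / (cmod (w - z') * cmod (w - z)))) R
     + (\<Sum>a\<in>bad_points g \<inter> ball 0 R. \<bar>of_int (zorder g a)\<bar> *
         (ln (1 + t / cmod (z - a)) + ln (1 + t / cmod (z' - a)) + (ln (1 + t / cmod (z - b a)) + ln (1 + t / cmod (z' - b a)))))"
proof -
  define S where "S = bad_points g \<inter> ball 0 R"
  have R0: "R > 0" using R by (rule good_radius_pos)
  note zR = z(1) z'(1)
  have cl: "continuous_on (sphere 0 R) (\<lambda>w. ln (cmod (g w)))" by (rule good_radius_continuous_ln[OF R])
  have ck: "continuous_on (sphere 0 R) (poisson_kernel R z)" if "cmod z < R" for z
    unfolding poisson_kernel_def using that by (intro continuous_intros) auto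
  have cp: "continuous_on (sphere 0 R) (\<lambda>w. ln (cmod (g w)) * poisson_kernel R z w)" if "cmod z < R" for z
    by (intro continuous_on_mult cl ck that)
  have cd: "continuous_on (sphere 0 R) (\<lambda>w. ln (cmod (g w)) * poisson_kernel R z' w - ln (cmod (g w)) * poisson_kernel R z w)"
    by (intro continuous_on_diff cp zR)
  have cm: "continuous_on (sphere 0 R) (\<lambda>w. \<bar>ln (cmod (g w))\<bar> * (2 * R * t / (cmod (w - z') * cmod (w - z))))"
    by (intro continuous_intros cl) (use zR in auto)
  have "\<bar>circle_mean (\<lambda>w. ln (cmod (g w)) * poisson_kernel R z' w) R - circle_mean (\<lambda>w. ln (cmod (g w)) * poisson_kernel R z w) R\<bar>
    = \<bar>circle_mean (\<lambda>w. ln (cmod (g w)) * poisson_kernel R z' w - ln (cmod (g w)) * poisson_kernel R z w) R\<bar>"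
    using R0 by (subst circle_mean_diff) (auto intro!: cp zR)
  also have "\<dots> \<le> circle_mean (\<lambda>w. \<bar>ln (cmod (g w)) * poisson_kernel R z' w - ln (cmod (g w)) * poisson_kernel R z w\<bar>) R"
    by (rule circle_mean_abs_le[OF cd]) (use R0 in simp)
  also have "\<dots> \<le> circle_mean (\<lambda>w. \<bar>ln (cmod (g w))\<bar> * (2 * R * t / (cmod (w - z') * cmod (w - z)))) R"
  proof (rule circle_mean_mono)
    fix w assume w: "cmod w = R"
    have "w \<noteq> z" "w \<noteq> z'" using w zR by auto
    then show "\<bar>ln (cmod (g w)) * poisson_kernel R z' w - ln (cmod (g w)) * poisson_kernel R z w\<bar>
        \<le> \<bar>ln (cmod (g w))\<bar> * (2 * R * t / (cmod (w - z') * cmod (w - z)))"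
      unfolding right_diff_distrib[symmetric] abs_mult t_def
      by (intro mult_left_mono poisson_kernel_diff w) auto
  qed (use R0 cm cd in \<open>auto intro!: continuous_on_rabs\<close>)
  finally have 1: "\<bar>circle_mean (\<lambda>w. ln (cmod (g w)) * poisson_kernel R z' w) R - circle_mean (\<lambda>w. ln (cmod (g w)) * poisson_kernel R z w) R\<bar>
    \<le> circle_mean (\<lambda>w. \<bar>ln (cmod (g w))\<bar> * (2 * R * t / (cmod (w - z') * cmod (w - z)))) R" .
  have "\<bar>(\<Sum>a\<in>S. of_int (zorder g a) * ln (cmod (blaschke R a z'))) - (\<Sum>a\<in>S. of_int (zorder g a) * ln (cmod (blaschke R a z)))\<bar>
    = \<bar>\<Sum>a\<in>S. of_int (zorder g a) * (ln (cmod (blaschke R a z')) - ln (cmod (blaschke R a z)))\<bar>"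
    by (simp add: sum_subtractf right_diff_distrib)
  also have "\<dots> \<le> (\<Sum>a\<in>S. \<bar>of_int (zorder g a) * (ln (cmod (blaschke R a z')) - ln (cmod (blaschke R a z)))\<bar>)"
    by (rule sum_abs)
  also have "\<dots> \<le> (\<Sum>a\<in>S. \<bar>of_int (zorder g a)\<bar> * (ln (1 + t / cmod (z - a)) + ln (1 + t / cmod (z' - a)) + (ln (1 + t / cmod (z - b a)) + ln (1 + t / cmod (z' - b a)))))"
    unfolding abs_mult t_def b_def
    by (intro sum_mono mult_left_mono ln_blaschke_diff) (use z z' in \<open>auto simp: S_def\<close>)
  finally have 2: "\<bar>(\<Sum>a\<in>S. of_int (zorder g a) * ln (cmod (blaschke R a z'))) - (\<Sum>a\<in>S. of_int (zorder g a) * ln (cmod (blaschke R a z)))\<bar>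
    \<le> (\<Sum>a\<in>S. \<bar>of_int (zorder g a)\<bar> * (ln (1 + t / cmod (z - a)) + ln (1 + t / cmod (z' - a)) + (ln (1 + t / cmod (z - b a)) + ln (1 + t / cmod (z' - b a)))))" .
  show ?thesis
    using 1 2 poisson_jensen[OF g R zR(1) z(2)] poisson_jensen[OF g R zR(2) z'(2)] unfolding S_def[symmetric] by linarith
qed

lemma circle_mean_ln_one_plus:
  assumes "0 < \<alpha>" "\<alpha> < 1"
  shows "\<exists>C>0. \<forall>r>0. \<forall>a t. t \<ge> 0 \<longrightarrow> cmod a \<noteq> r \<longrightarrow>
    circle_mean (\<lambda>z. ln (1 + t / cmod (z - a))) r \<le> C * t powr \<alpha> * r powr (-\<alpha>)"
proof -
  obtain C where C: "C > 0" "\<And>r a. r > 0 \<Longrightarrow> cmod a \<noteq> r \<Longrightarrow> circle_mean (\<lambda>z. cmod (z - a) powr (-\<alpha>)) r \<le> C * r powr (-\<alpha>)"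
    using circle_mean_dist_powr[OF assms] by blast
  have "circle_mean (\<lambda>z. ln (1 + t / cmod (z - a))) r \<le> (C / \<alpha>) * t powr \<alpha> * r powr (-\<alpha>)"
    if "r > 0" "t \<ge> 0" "cmod a \<noteq> r" for r a t
  proof -
    have nz: "z \<noteq> a" if "cmod z = r" for z using that \<open>cmod a \<noteq> r\<close> by auto
    have "circle_mean (\<lambda>z. ln (1 + t / cmod (z - a))) r \<le> circle_mean (\<lambda>z. (t powr \<alpha> / \<alpha>) * cmod (z - a) powr (-\<alpha>)) r"
    proof (rule circle_mean_mono)
      have "1 + t / cmod (z - a) \<noteq> 0" for z
        using that by (smt (verit) divide_nonneg_nonneg norm_ge_zero)
      then show "continuous_on (sphere 0 r) (\<lambda>z. ln (1 + t / cmod (z - a)))"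
        using nz by (intro continuous_intros) auto
      show "continuous_on (sphere 0 r) (\<lambda>z. (t powr \<alpha> / \<alpha>) * cmod (z - a) powr (-\<alpha>))"
        using nz by (intro continuous_intros) auto
      fix z assume z: "cmod z = r"
      have "ln (1 + t / cmod (z - a)) \<le> (t / cmod (z - a)) powr \<alpha> / \<alpha>"
        using assms that by (intro ln_one_plus_le_powr) auto
      also have "\<dots> = (t powr \<alpha> / \<alpha>) * cmod (z - a) powr (-\<alpha>)"
        using that nz[OF z] by (simp add: powr_divide powr_minus divide_simps)
      finally show "ln (1 + t / cmod (z - a)) \<le> (t powr \<alpha> / \<alpha>) * cmod (z - a) powr (-\<alpha>)" .
    qed (use that in auto)
    also have "\<dots> \<le> (t powr \<alpha> / \<alpha>) * (C * r powr (-\<alpha>))"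
      unfolding circle_mean_cmult using assms that C by (intro mult_left_mono) auto
    finally show ?thesis by (simp add: mult_ac)
  qed
  with C assms show ?thesis by (intro exI[of _ "C / \<alpha>"]) auto
qed

text \<open>The two kernels \<open>1 / (\<bar>w - z - \<eta>\<bar> \<bar>w - z\<bar>)\<close> must be averaged in \<open>z\<close>: a pointwise bound would cost
  \<open>R / (R - r)\<^sup>2\<close> instead of \<open>1 / (R - r)\<close>, which is too much when the hyper order exceeds \<open>1/2\<close>.\<close>
theorem difference_lemma:
  assumes "0 < \<alpha>" "\<alpha> < 1"
  shows "\<exists>C>0. \<forall>g r R. nonzero_meromorphic g \<longrightarrow> good_radius g r \<longrightarrow> cmod \<eta> < r \<longrightarrow>
    (\<forall>z. cmod z = r \<longrightarrow> z + \<eta> \<notin> bad_points g)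
    \<longrightarrow> good_radius g R \<longrightarrow> r + cmod \<eta> < R \<longrightarrow> 2 * cmod \<eta> \<le> R \<longrightarrow>
    circle_mean (\<lambda>z. \<bar>ln (cmod (g (z + \<eta>))) - ln (cmod (g z))\<bar>) r
      \<le> 4 * cmod \<eta> / (R - cmod \<eta> - r) * (circle_prox g R + circle_prox (\<lambda>z. inverse (g z)) R)
        + zero_pole_count g R * (C * r powr (-\<alpha>))"
proof -
  define e where "e = cmod \<eta>"
  have e0: "e \<ge> 0" by (simp add: e_def)
  obtain C where C: "C > 0" "\<And>r a t. r > 0 \<Longrightarrow> t \<ge> 0 \<Longrightarrow> cmod a \<noteq> r \<Longrightarrow>
      circle_mean (\<lambda>z. ln (1 + t / cmod (z - a))) r \<le> C * t powr \<alpha> * r powr (-\<alpha>)"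
    using circle_mean_ln_one_plus[OF assms] by blast
  \<comment> \<open>Each zero or pole contributes four logarithms; the summand 1 keeps the constant
    positive when \<eta> = 0.\<close>
  define C' where "C' = 4 * C * e powr \<alpha> + 1"
  have C': "C' > 0" unfolding C'_def using C(1) by (simp add: add_nonneg_pos)
  have "circle_mean (\<lambda>z. \<bar>ln (cmod (g (z + \<eta>))) - ln (cmod (g z))\<bar>) r
      \<le> 4 * e / (R - e - r) * (circle_prox g R + circle_prox (\<lambda>z. inverse (g z)) R)
        + zero_pole_count g R * (C' * r powr (-\<alpha>))"
    if g: "nonzero_meromorphic g" and r: "good_radius g r" and er: "e < r" and s: "\<And>z. cmod z = r \<Longrightarrow> z + \<eta> \<notin> bad_points g"
      and R: "good_radius g R" and rR: "r + e < R" "2 * e \<le> R" for g r R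
  proof -
    define S where "S = bad_points g \<inter> ball 0 R"
    have fin: "finite S" unfolding S_def by (rule finite_bad_points_ball[OF g])
    define \<delta> where "\<delta> = R - e - r"
    have \<delta>: "\<delta> > 0" using rR by (simp add: \<delta>_def)
    have r0: "r > 0" using r by (rule good_radius_pos)
    have R0: "R > 0" using R by (rule good_radius_pos)
    have rs: "good_radius (\<lambda>z. g (z + \<eta>)) r" by (rule good_radius_shift[OF r0 s])
    have cl: "continuous_on (sphere 0 R) (\<lambda>w. ln (cmod (g w)))" by (rule good_radius_continuous_ln[OF R])
    define b where "b = (\<lambda>a. of_real (R\<^sup>2) / cnj a)"
    \<comment> \<open>A majorant of the product of the two kernels: 2 x y <= x^2 + y^2 separates the
      factors, and each square has an explicit mean over the circle of z.\<close>
    define k where "k = (\<lambda>z w. \<bar>ln (cmod (g w))\<bar> * (R * e * (1 / (cmod (w - z))\<^sup>2 + 1 / (cmod (w - \<eta> - z))\<^sup>2)))"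
    define L where "L = (\<lambda>z. \<Sum>a\<in>S. \<bar>of_int (zorder g a)\<bar> * (ln (1 + e / cmod (z - a)) + ln (1 + e / cmod (z - (a - \<eta>))) +
        (ln (1 + e / cmod (z - b a)) + ln (1 + e / cmod (z - (b a - \<eta>))))))"
    have wz: "w \<noteq> z" "w - \<eta> \<noteq> z" "cmod (w - \<eta>) \<ge> R - e" if "cmod w = R" "cmod z = r" for w z
    proof -
      show *: "cmod (w - \<eta>) \<ge> R - e" using norm_triangle_ineq2[of w \<eta>] that by (simp add: e_def)
      show "w \<noteq> z" "w - \<eta> \<noteq> z" using that rR e0 * by auto
    qed
    have az: "cmod a \<noteq> r" "cmod (a - \<eta>) \<noteq> r" if "a \<in> S" for a
      using that r s[of "a - \<eta>"] by (auto simp: S_def good_radius_def)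
    have bz: "cmod (b a) \<noteq> r" "cmod (b a - \<eta>) \<noteq> r" if "a \<in> S" for a
    proof -
      have "cmod (b a) \<noteq> r \<and> cmod (b a - \<eta>) \<noteq> r"
      proof (cases "a = 0")
        case True
        \<comment> \<open>Here \<open>b a\<close> is the default value 0, so
          \<open>b a - \<eta>\<close> has modulus e; this is where |\<eta>| < r is used.\<close>
        then show ?thesis using r0 er by (simp add: b_def e_def)
      next
        case False
        have "cmod a < R" using that by (simp add: S_def)
        then have "R * cmod a < R * R" using R0 by simp
        then have "R < cmod (b a)"
          using False by (simp add: b_def norm_divide norm_power power2_eq_square norm_mult pos_less_divide_eq)
        moreover have "cmod (b a) \<le> cmod (b a - \<eta>) + e" unfolding e_def using norm_triangle_sub by (metis add.commute)
        ultimately show ?thesis using rR e0 by linarith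
      qed
      then show "cmod (b a) \<noteq> r" "cmod (b a - \<eta>) \<noteq> r" by auto
    qed
    have ck: "continuous_on (sphere 0 r \<times> sphere 0 R) (\<lambda>(z, w). k z w)"
    proof -
      have "continuous_on (sphere 0 r \<times> sphere 0 R) (\<lambda>p. \<bar>ln (cmod (g (snd p)))\<bar>)"
        by (rule continuous_on_snd_circle) (intro continuous_intros cl)
      moreover have "continuous_on (sphere 0 r \<times> sphere 0 R)
          (\<lambda>p. R * e * (1 / (cmod (snd p - fst p))\<^sup>2 + 1 / (cmod (snd p - \<eta> - fst p))\<^sup>2))"
        using wz by (intro continuous_intros) auto
      ultimately show ?thesis unfolding k_def case_prod_unfold by (rule continuous_on_mult)
    qed
    define K where "K = (\<lambda>z. circle_mean (k z) R)"
    have cK: "continuous_on (sphere 0 r) K"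
      unfolding K_def by (rule continuous_on_circle_mean[OF ck]) (use R0 in simp)
    have cln: "continuous_on (sphere 0 r) (\<lambda>z. ln (1 + e / cmod (z - a)))" if "cmod a \<noteq> r" for a
    proof -
      have "1 + e / cmod (z - a) \<noteq> 0" for z
        using e0 by (smt (verit) divide_nonneg_nonneg norm_ge_zero)
      then show ?thesis using that by (intro continuous_intros) auto
    qed
    have cterm: "continuous_on (sphere 0 r) (\<lambda>z. \<bar>of_int (zorder g a)\<bar> *
        (ln (1 + e / cmod (z - a)) + ln (1 + e / cmod (z - (a - \<eta>))) +
        (ln (1 + e / cmod (z - b a)) + ln (1 + e / cmod (z - (b a - \<eta>))))))" if "a \<in> S" for a
      by (intro continuous_on_mult continuous_on_add continuous_on_const cln az bz that)
    have cL: "continuous_on (sphere 0 r) L" unfolding L_def by (intro continuous_on_sum cterm)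
    have le: "\<bar>ln (cmod (g (z + \<eta>))) - ln (cmod (g z))\<bar> \<le> K z + L z" if z: "cmod z = r" for z
    proof -
      have zb: "z \<notin> bad_points g" using r z by (auto simp: good_radius_def)
      have z': "cmod (z + \<eta>) \<le> r + e" using norm_triangle_ineq[of z \<eta>] z by (simp add: e_def)
      have "\<bar>ln (cmod (g (z + \<eta>))) - ln (cmod (g z))\<bar>
        \<le> circle_mean (\<lambda>w. \<bar>ln (cmod (g w))\<bar> * (2 * R * e / (cmod (w - (z + \<eta>)) * cmod (w - z)))) R
         + (\<Sum>a\<in>S. \<bar>of_int (zorder g a)\<bar> * (ln (1 + e / cmod (z - a)) + ln (1 + e / cmod (z + \<eta> - a)) + (ln (1 + e / cmod (z - b a)) + ln (1 + e / cmod (z + \<eta> - b a)))))"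
        using log_norm_difference[OF g R _ zb _ s[OF z]] z z' e0 rR by (simp add: S_def e_def b_def)
      also have "(\<Sum>a\<in>S. \<bar>of_int (zorder g a)\<bar> * (ln (1 + e / cmod (z - a)) + ln (1 + e / cmod (z + \<eta> - a)) + (ln (1 + e / cmod (z - b a)) + ln (1 + e / cmod (z + \<eta> - b a))))) = L z"
        by (simp add: L_def algebra_simps)
      also have "circle_mean (\<lambda>w. \<bar>ln (cmod (g w))\<bar> * (2 * R * e / (cmod (w - (z + \<eta>)) * cmod (w - z)))) R \<le> K z"
        unfolding K_def
      proof (rule circle_mean_mono)
        show "continuous_on (sphere 0 R) (\<lambda>w. \<bar>ln (cmod (g w))\<bar> * (2 * R * e / (cmod (w - (z + \<eta>)) * cmod (w - z))))"
          using wz[OF _ z] by (intro continuous_intros cl) (auto simp: algebra_simps)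
        show "continuous_on (sphere 0 R) (k z)"
          unfolding k_def using wz[OF _ z] by (intro continuous_intros cl) (auto simp: algebra_simps)
        fix w assume w: "cmod w = R"
        define x y where "x = 1 / cmod (w - z)" and "y = 1 / cmod (w - \<eta> - z)"
        have eq: "w - (z + \<eta>) = w - \<eta> - z" by simp
        have "2 * R * e / (cmod (w - (z + \<eta>)) * cmod (w - z)) = R * e * (2 * x * y)"
          unfolding eq x_def y_def by (simp add: mult_ac)
        also have "\<dots> \<le> R * e * (x\<^sup>2 + y\<^sup>2)"
          using R0 e0 sum_squares_bound[of x y] by (intro mult_left_mono) auto
        also have "\<dots> = R * e * (1 / (cmod (w - z))\<^sup>2 + 1 / (cmod (w - \<eta> - z))\<^sup>2)"
          by (simp add: x_def y_def power_divide)
        finally show "\<bar>ln (cmod (g w))\<bar> * (2 * R * e / (cmod (w - (z + \<eta>)) * cmod (w - z))) \<le> k z w"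
          unfolding k_def by (intro mult_left_mono) auto
      qed (use R0 in auto)
      finally show ?thesis by simp
    qed
    have "circle_mean (\<lambda>z. \<bar>ln (cmod (g (z + \<eta>))) - ln (cmod (g z))\<bar>) r \<le> circle_mean (\<lambda>z. K z + L z) r"
      using r0 le cK cL
      by (intro circle_mean_mono)
         (auto intro!: continuous_on_add continuous_on_rabs continuous_on_diff good_radius_continuous_ln r rs)
    also have "\<dots> = circle_mean K r + circle_mean L r"
      using cK cL r0 by (intro circle_mean_add) auto
    also have "circle_mean K r \<le> 4 * e / \<delta> * circle_mean (\<lambda>w. \<bar>ln (cmod (g w))\<bar>) R"
    proof -
      have "circle_mean K r = circle_mean (\<lambda>w. circle_mean (\<lambda>z. k z w) r) R"
        unfolding K_def by (rule circle_mean_swap[OF ck]) (use r0 R0 in auto)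
      also have "\<dots> \<le> circle_mean (\<lambda>w. 4 * e / \<delta> * \<bar>ln (cmod (g w))\<bar>) R"
      proof (rule circle_mean_mono)
        have "(\<lambda>p. (snd p, fst p)) ` (sphere 0 R \<times> sphere 0 r) \<subseteq> sphere 0 r \<times> sphere (0::complex) R" by auto
        from continuous_on_compose2[OF ck _ this]
        have "continuous_on (sphere 0 R \<times> sphere 0 r) (\<lambda>(w, z). k z w)"
          by (simp add: case_prod_unfold continuous_intros)
        then show "continuous_on (sphere 0 R) (\<lambda>w. circle_mean (\<lambda>z. k z w) r)"
          by (rule continuous_on_circle_mean) (use r0 in simp)
        show "continuous_on (sphere 0 R) (\<lambda>w. 4 * e / \<delta> * \<bar>ln (cmod (g w))\<bar>)"
          by (intro continuous_on_mult continuous_on_const continuous_on_rabs cl)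
        fix w assume w: "cmod w = R"
        have w1: "cmod (w - \<eta>) \<ge> R - e" using norm_triangle_ineq2[of w \<eta>] w by (simp add: e_def)
        have w2: "r < cmod w" "r < cmod (w - \<eta>)" using w w1 rR e0 by auto
        have c: "continuous_on (sphere 0 r) (\<lambda>z. 1 / (cmod (w - z))\<^sup>2)" "continuous_on (sphere 0 r) (\<lambda>z. 1 / (cmod (w - \<eta> - z))\<^sup>2)"
          using w2 by (auto intro!: continuous_intros)
        \<comment> \<open>X - r is at least \<delta>, and 2 |\<eta>| <= R gives X + r >= R / 2.
          Together with the factor R of the kernel this costs only one power of 1 /
          \<delta>.\<close>
        have lb: "\<delta> * (R / 2) \<le> X\<^sup>2 - r\<^sup>2" if "X \<ge> R - e" for X
        proof -
          have "\<delta> * (R / 2) \<le> (X - r) * (X + r)"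
            using that \<delta> rR r0 R0 by (intro mult_mono) (auto simp: \<delta>_def)
          then show ?thesis by (simp add: power2_eq_square algebra_simps)
        qed
        have inv: "1 / (X\<^sup>2 - r\<^sup>2) \<le> 2 / (\<delta> * R)" if "X \<ge> R - e" for X
        proof -
          have "0 < \<delta> * (R / 2)" using \<delta> R0 by simp
          then have "1 / (X\<^sup>2 - r\<^sup>2) \<le> 1 / (\<delta> * (R / 2))" using lb[OF that] by (intro divide_left_mono) auto
          then show ?thesis by simp
        qed
        have "circle_mean (\<lambda>z. k z w) r = \<bar>ln (cmod (g w))\<bar> * (R * e * (1 / ((cmod w)\<^sup>2 - r\<^sup>2) + 1 / ((cmod (w - \<eta>))\<^sup>2 - r\<^sup>2)))"
          unfolding k_def circle_mean_cmult using r0 w2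
          by (subst circle_mean_add[OF c]) (auto simp: circle_mean_inverse_dist_square)
        also have "\<dots> \<le> \<bar>ln (cmod (g w))\<bar> * (R * e * (2 / (\<delta> * R) + 2 / (\<delta> * R)))"
          using R0 e0 w w1 by (intro mult_left_mono add_mono inv) auto
        also have "R * e * (2 / (\<delta> * R) + 2 / (\<delta> * R)) = 4 * e / \<delta>"
          using R0 \<delta> by (simp add: field_simps)
        finally show "circle_mean (\<lambda>z. k z w) r \<le> 4 * e / \<delta> * \<bar>ln (cmod (g w))\<bar>" by (simp add: mult.commute)
      qed (use R0 in auto)
      finally show ?thesis unfolding circle_mean_cmult .
    qed
    also have "circle_mean L r \<le> (\<Sum>a\<in>S. \<bar>of_int (zorder g a)\<bar> * (C' * r powr (-\<alpha>)))"
    proof -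
      have "circle_mean L r = (\<Sum>a\<in>S. circle_mean (\<lambda>z. \<bar>of_int (zorder g a)\<bar> *
        (ln (1 + e / cmod (z - a)) + ln (1 + e / cmod (z - (a - \<eta>))) +
        (ln (1 + e / cmod (z - b a)) + ln (1 + e / cmod (z - (b a - \<eta>)))))) r)"
        unfolding L_def by (rule circle_mean_sum) (use cterm r0 fin in auto)
      also have "\<dots> \<le> (\<Sum>a\<in>S. \<bar>of_int (zorder g a)\<bar> * (C' * r powr (-\<alpha>)))"
        unfolding circle_mean_cmult
      proof (intro sum_mono mult_left_mono)
        fix a assume a: "a \<in> S"
        define l where "l = (\<lambda>c z. ln (1 + e / cmod (z - c)))"
        have cl: "continuous_on (sphere 0 r) (l c)" if "cmod c \<noteq> r" for c
          unfolding l_def by (rule cln[OF that])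
        have add: "circle_mean (\<lambda>z. l a z + l (a - \<eta>) z + (l (b a) z + l (b a - \<eta>) z)) r
          = circle_mean (l a) r + circle_mean (l (a - \<eta>)) r + (circle_mean (l (b a)) r + circle_mean (l (b a - \<eta>)) r)"
          using cl[OF az(1)[OF a]] cl[OF az(2)[OF a]] cl[OF bz(1)[OF a]] cl[OF bz(2)[OF a]] r0
          by (simp add: circle_mean_add continuous_on_add)
        have "circle_mean (l c) r \<le> C * e powr \<alpha> * r powr (-\<alpha>)" if "cmod c \<noteq> r" for c
          unfolding l_def by (rule C(2)[OF r0 e0 that])
        from this[OF az(1)[OF a]] this[OF az(2)[OF a]] this[OF bz(1)[OF a]] this[OF bz(2)[OF a]]
        have "circle_mean (\<lambda>z. l a z + l (a - \<eta>) z + (l (b a) z + l (b a - \<eta>) z)) r \<le> 4 * (C * e powr \<alpha> * r powr (-\<alpha>))"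
          unfolding add by linarith
        also have "\<dots> \<le> C' * r powr (-\<alpha>)" by (simp add: C'_def algebra_simps)
        finally have "circle_mean (\<lambda>z. l a z + l (a - \<eta>) z + (l (b a) z + l (b a - \<eta>) z)) r \<le> C' * r powr (-\<alpha>)" .
        then show "circle_mean (\<lambda>z. ln (1 + e / cmod (z - a)) + ln (1 + e / cmod (z - (a - \<eta>))) +
        (ln (1 + e / cmod (z - b a)) + ln (1 + e / cmod (z - (b a - \<eta>))))) r
          \<le> C' * r powr (-\<alpha>)" unfolding l_def .
      qed auto
      finally show ?thesis .
    qed
    also have "\<dots> = zero_pole_count g R * (C' * r powr (-\<alpha>))"
      by (simp add: zero_pole_count_def S_def sum_distrib_right)
    finally show ?thesis using circle_mean_ln_prox(2)[OF R] by (simp add: \<delta>_def)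
  qed
  with C' show ?thesis unfolding e_def by blast
qed

text \<open>Obtained from the bound on differences of \<open>ln \<bar>g\<bar>\<close> by letting the increment tend to 0 in the
  direction in which \<open>ln \<bar>g\<bar>\<close> grows fastest.\<close>
lemma log_derivative_pointwise:
  assumes g: "nonzero_meromorphic g" and R: "good_radius g R"
    and z: "cmod z < R" "z \<notin> bad_points g"
  shows "cmod (deriv g z / g z) \<le> 8 * R / (R - cmod z)\<^sup>2 * (circle_prox g R + circle_prox (\<lambda>z. inverse (g z)) R)
     + (\<Sum>a\<in>bad_points g \<inter> ball 0 R. \<bar>of_int (zorder g a)\<bar> * (4 / cmod (z - a) + 4 / (R - cmod z)))"
proof (cases "deriv g z = 0")
  case True
  have "circle_prox g R \<ge> 0" "circle_prox (\<lambda>z. inverse (g z)) R \<ge> 0"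
    using R by (auto intro: circle_prox_nonneg good_radius_inverse)
  then show ?thesis
    using z R by (simp add: True) (intro add_nonneg_nonneg mult_nonneg_nonneg sum_nonneg; simp add: good_radius_def)
next
  case False
  define S where "S = bad_points g \<inter> ball 0 R"
  define A where "A = circle_prox g R + circle_prox (\<lambda>z. inverse (g z)) R"
  define \<delta> where "\<delta> = R - cmod z"
  \<comment> \<open>Halfway between |z| and R: while the moving point stays within radius \<rho>,
    all distances to the circle are at least \<delta> / 2.\<close>
  define \<rho> where "\<rho> = R - \<delta> / 2"
  have \<delta>: "\<delta> > 0" using z by (simp add: \<delta>_def)
  have R0: "R > 0" using R by (rule good_radius_pos)
  have fin: "finite S" unfolding S_def by (rule finite_bad_points_ball[OF g])
  have gz: "g z \<noteq> 0" "g analytic_on {z}" using z by (auto simp: bad_points_def)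
  define q where "q = deriv g z / g z"
  have q: "q \<noteq> 0" using False gz by (simp add: q_def)
  define u where "u = cnj q / cmod q"
  have u: "cmod u = 1" using q by (simp add: u_def norm_divide)
  have uq: "u * q = of_real (cmod q)"
    using q by (simp add: u_def complex_norm_square[symmetric] mult.commute power2_eq_square)
  define A0 where "A0 = circle_mean (\<lambda>w. \<bar>ln (cmod (g w))\<bar>) R"
  have A0: "A0 = A" unfolding A0_def A_def by (rule circle_mean_ln_prox(2)[OF R])
  define h where "h = (\<lambda>t::real. z + of_real t * u)"
  have h: "(h \<longlongrightarrow> z) (at_right 0)" unfolding h_def by (rule tendsto_eq_intros refl | simp)+
  have hne: "eventually (\<lambda>t. h t \<noteq> z) (at_right 0)"
    using eventually_at_right_less[of 0] by eventually_elim (use u in \<open>auto simp: h_def\<close>)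
  have hf: "filterlim h (at z) (at_right 0)"
    using h hne by (simp add: filterlim_at)
  have ev: "eventually (\<lambda>t. t > 0 \<and> h t \<notin> bad_points g \<and> cmod (h t) \<le> \<rho>) (at_right 0)"
  proof -
    have "eventually (\<lambda>t::real. t < \<delta> / 2) (at_right 0)"
      using \<delta> by (intro order_tendstoD(2)[OF tendsto_ident_at]) auto
    moreover have "eventually (\<lambda>t. h t \<notin> bad_points g) (at_right 0)"
      using eventually_compose_filterlim[OF eventually_not_bad[OF g] hf] .
    ultimately show ?thesis using eventually_at_right_less[of 0]
    proof eventually_elim
      case (elim t)
      have "cmod (h t) \<le> cmod z + cmod (of_real t * u)" unfolding h_def by (rule norm_triangle_ineq)
      then show ?case using elim u by (simp add: norm_mult \<rho>_def \<delta>_def field_simps)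
    qed
  qed
  define B where "B = (\<lambda>t. 8 * R / \<delta>\<^sup>2 * A + (\<Sum>a\<in>S. \<bar>of_int (zorder g a)\<bar> * (2 / cmod (z - a) + 2 / cmod (h t - a) + 4 / \<delta>)))"
  have main: "(ln (cmod (g (h t))) - ln (cmod (g z))) / t \<le> B t"
    if t: "t > 0" "h t \<notin> bad_points g" "cmod (h t) \<le> \<rho>" for t
  proof -
    define b where "b = (\<lambda>a. of_real (R\<^sup>2) / cnj a)"
    \<comment> \<open>A reflected point lies outside the circle of radius R, hence at distance at
      least R - \<rho> from y. For a = 0 it is the default value 0 = a, and the first summand covers
      that case.\<close>
    have lb: "ln (1 + t / cmod (y - b a)) \<le> t / cmod (y - a) + t / (R - \<rho>)" if y: "cmod y \<le> \<rho>" and a: "a \<in> S" for y a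
    proof -
      have "ln (1 + t / cmod (y - b a)) \<le> t / cmod (y - b a)" using t by (intro ln_add_one_self_le_self) auto
      also have "\<dots> \<le> t / cmod (y - a) + t / (R - \<rho>)"
      proof (cases "a = 0")
        case True
        then show ?thesis using t \<delta> by (simp add: b_def \<rho>_def)
      next
        case False
        have "cmod a < R" using a by (simp add: S_def)
        then have "R * cmod a < R * R" using R0 by simp
        then have "R < cmod (b a)"
          using False by (simp add: b_def norm_divide norm_power power2_eq_square norm_mult pos_less_divide_eq)
        then have "R - \<rho> \<le> cmod (y - b a)"
          using y norm_triangle_ineq2[of "b a" y] norm_minus_commute[of y "b a"] by linarith
        moreover have "R - \<rho> > 0" using \<delta> by (simp add: \<rho>_def)
        ultimately have "t / cmod (y - b a) \<le> t / (R - \<rho>)" using t by (intro divide_left_mono mult_pos_pos) auto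
        moreover have "0 \<le> t / cmod (y - a)" using t by simp
        ultimately show ?thesis by linarith
      qed
      finally show ?thesis .
    qed
    have ht: "cmod (h t - z) = t" using u t by (simp add: h_def norm_mult)
    have zr: "cmod z \<le> \<rho>" "\<rho> < R" using \<delta> by (auto simp: \<rho>_def \<delta>_def field_simps)
    have "ln (cmod (g (h t))) - ln (cmod (g z)) \<le>
        circle_mean (\<lambda>w. \<bar>ln (cmod (g w))\<bar> * (2 * R * t / (cmod (w - h t) * cmod (w - z)))) R
     + (\<Sum>a\<in>S. \<bar>of_int (zorder g a)\<bar> * (ln (1 + t / cmod (z - a)) + ln (1 + t / cmod (h t - a)) + (ln (1 + t / cmod (z - b a)) + ln (1 + t / cmod (h t - b a)))))"
      using log_norm_difference[OF g R z _ t(2)] t(3) zr unfolding ht S_def[symmetric] b_def by linarith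
    also have "circle_mean (\<lambda>w. \<bar>ln (cmod (g w))\<bar> * (2 * R * t / (cmod (w - h t) * cmod (w - z)))) R
      \<le> circle_mean (\<lambda>w. \<bar>ln (cmod (g w))\<bar> * (8 * R * t / \<delta>\<^sup>2)) R"
    proof (rule circle_mean_mono)
      show "continuous_on (sphere 0 R) (\<lambda>w. \<bar>ln (cmod (g w))\<bar> * (2 * R * t / (cmod (w - h t) * cmod (w - z))))"
        using zr t by (intro continuous_intros good_radius_continuous_ln R) auto
      show "continuous_on (sphere 0 R) (\<lambda>w. \<bar>ln (cmod (g w))\<bar> * (8 * R * t / \<delta>\<^sup>2))"
        by (intro continuous_intros good_radius_continuous_ln R)
      fix w assume w: "cmod w = R"
      have d: "cmod (w - h t) \<ge> \<delta> / 2" "cmod (w - z) \<ge> \<delta> / 2"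
        using norm_triangle_ineq2[of w "h t"] norm_triangle_ineq2[of w z] w t zr by (auto simp: \<rho>_def)
      have "(\<delta> / 2) * (\<delta> / 2) \<le> cmod (w - h t) * cmod (w - z)" using d \<delta> by (intro mult_mono) auto
      moreover have "0 < (\<delta> / 2) * (\<delta> / 2)" using \<delta> by simp
      ultimately have "2 * R * t / (cmod (w - h t) * cmod (w - z)) \<le> 2 * R * t / ((\<delta> / 2) * (\<delta> / 2))"
        using R0 t by (intro frac_le) auto
      also have "\<dots> = 8 * R * t / \<delta>\<^sup>2" by (simp add: power2_eq_square)
      finally show "\<bar>ln (cmod (g w))\<bar> * (2 * R * t / (cmod (w - h t) * cmod (w - z))) \<le> \<bar>ln (cmod (g w))\<bar> * (8 * R * t / \<delta>\<^sup>2)"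
        by (intro mult_left_mono) auto
    qed (use R0 in simp)
    also have "\<dots> = A * (8 * R * t / \<delta>\<^sup>2)" unfolding circle_mean_cmult_right A0_def[symmetric] A0 ..
    also have "(\<Sum>a\<in>S. \<bar>of_int (zorder g a)\<bar> * (ln (1 + t / cmod (z - a)) + ln (1 + t / cmod (h t - a)) + (ln (1 + t / cmod (z - b a)) + ln (1 + t / cmod (h t - b a)))))
      \<le> (\<Sum>a\<in>S. \<bar>of_int (zorder g a)\<bar> * (t / cmod (z - a) + t / cmod (h t - a) +
          ((t / cmod (z - a) + t / (R - \<rho>)) + (t / cmod (h t - a) + t / (R - \<rho>)))))"
      using t zr by (intro sum_mono mult_left_mono add_mono ln_add_one_self_le_self lb) auto
    also have "\<dots> = t * (\<Sum>a\<in>S. \<bar>of_int (zorder g a)\<bar> * (2 / cmod (z - a) + 2 / cmod (h t - a) + 4 / \<delta>))"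
      unfolding sum_distrib_left by (intro sum.cong refl) (simp add: \<rho>_def algebra_simps)
    finally have "ln (cmod (g (h t))) - ln (cmod (g z)) \<le> t * B t"
      by (simp add: B_def algebra_simps)
    then show ?thesis using t by (simp add: field_simps)
  qed
  have lim1: "((\<lambda>t. (ln (cmod (g (h t))) - ln (cmod (g z))) / t) \<longlongrightarrow> cmod q) (at_right 0)"
  proof -
    have dg: "(g has_field_derivative deriv g z) (at z)"
      using gz(2) analytic_on_imp_differentiable_at by (simp add: DERIV_deriv_iff_field_differentiable)
    have "((\<lambda>w. Ln (g w / g z)) has_field_derivative q) (at z)"
      unfolding q_def using gz by (auto intro!: derivative_eq_intros dg)
    then have "((\<lambda>w. (Ln (g w / g z) - Ln (g z / g z)) / (w - z)) \<longlongrightarrow> q) (at z)"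
      by (simp add: has_field_derivative_iff)
    then have "((\<lambda>w. Ln (g w / g z) / (w - z)) \<longlongrightarrow> q) (at z)" using gz by simp
    from filterlim_compose[OF this hf]
    have "((\<lambda>t. Re (u * (Ln (g (h t) / g z) / (h t - z)))) \<longlongrightarrow> Re (u * q)) (at_right 0)"
      by (intro tendsto_intros)
    then have "((\<lambda>t. Re (u * (Ln (g (h t) / g z) / (h t - z)))) \<longlongrightarrow> cmod q) (at_right 0)"
      by (simp add: uq)
    moreover have "eventually (\<lambda>t. Re (u * (Ln (g (h t) / g z) / (h t - z))) = (ln (cmod (g (h t))) - ln (cmod (g z))) / t) (at_right 0)"
      using ev
    proof eventually_elim
      case (elim t)
      have "u \<noteq> 0" using u by auto
      then have "u * (Ln (g (h t) / g z) / (h t - z)) = Ln (g (h t) / g z) / of_real t"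
        using elim by (simp add: h_def)
      moreover have "g (h t) \<noteq> 0" using elim by (auto simp: bad_points_def)
      ultimately show ?case using gz by (simp add: norm_divide ln_div)
    qed
    ultimately show ?thesis by (rule Lim_transform_eventually)
  qed
  have lim2: "(B \<longlongrightarrow> 8 * R / \<delta>\<^sup>2 * A + (\<Sum>a\<in>S. \<bar>of_int (zorder g a)\<bar> * (2 / cmod (z - a) + 2 / cmod (z - a) + 4 / \<delta>))) (at_right 0)"
    unfolding B_def using z by (intro tendsto_intros h) (auto simp: S_def)
  have "cmod q \<le> 8 * R / \<delta>\<^sup>2 * A + (\<Sum>a\<in>S. \<bar>of_int (zorder g a)\<bar> * (2 / cmod (z - a) + 2 / cmod (z - a) + 4 / \<delta>))"
    by (rule tendsto_le[OF _ lim2 lim1]) (use ev main in \<open>auto elim!: eventually_mono\<close>)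
  then show ?thesis by (simp add: q_def \<delta>_def S_def A_def)
qed

lemma ln_one_plus_sum_le:
  assumes "finite S" "\<And>a. a \<in> S \<Longrightarrow> f a \<ge> (0::real)"
  shows "ln (1 + (\<Sum>a\<in>S. f a)) \<le> (\<Sum>a\<in>S. ln (1 + f a))"
  using assms
proof (induction rule: finite_induct)
  case (insert x F)
  have s: "(\<Sum>a\<in>F. f a) \<ge> 0" "f x \<ge> 0" using insert by (auto intro: sum_nonneg)
  have "ln (1 + (f x + (\<Sum>a\<in>F. f a))) \<le> ln ((1 + f x) * (1 + (\<Sum>a\<in>F. f a)))"
  proof -
    have "0 < 1 + (f x + (\<Sum>a\<in>F. f a))" "0 \<le> f x * (\<Sum>a\<in>F. f a)" using s by auto
    moreover have "(1 + f x) * (1 + (\<Sum>a\<in>F. f a)) = 1 + (f x + (\<Sum>a\<in>F. f a)) + f x * (\<Sum>a\<in>F. f a)"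
      by (simp add: algebra_simps)
    ultimately show ?thesis by (intro ln_mono) auto
  qed
  also have "\<dots> = ln (1 + f x) + ln (1 + (\<Sum>a\<in>F. f a))" using s by (subst ln_mult) auto
  finally show ?case using insert by simp
qed simp

lemma ln_one_plus_int_mult_le:
  assumes "x \<ge> (0::real)"
  shows "ln (1 + \<bar>of_int m\<bar> * x) \<le> \<bar>of_int m\<bar> * ln (1 + x)"
proof -
  have "1 + real (nat \<bar>m\<bar>) * x \<le> (1 + x) ^ nat \<bar>m\<bar>"
    by (rule Bernoulli_inequality) (use assms in simp)
  then have "ln (1 + real (nat \<bar>m\<bar>) * x) \<le> ln ((1 + x) ^ nat \<bar>m\<bar>)"
    using assms by (subst ln_le_cancel_iff) (auto simp: add_pos_nonneg)
  also have "\<dots> = real (nat \<bar>m\<bar>) * ln (1 + x)" using assms by (simp add: ln_realpow)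
  finally show ?thesis by (simp add: of_nat_nat)
qed

lemma log_plus_le_ln_one_plus: "x \<ge> 0 \<Longrightarrow> log_plus x \<le> ln (1 + x)"
  unfolding log_plus_def by (subst ln_le_cancel_iff) auto

text \<open>The pointwise bound is put under log^+ and averaged. The reciprocal distances 1 / |z -
  a| have no mean bounded uniformly in a, so their sum is first turned into a sum of ln (1 + 4 / |z
  - a|), by expanding a product and by Bernoulli's inequality for the multiplicities. The gap r + 1
  <= R lets the powers of 1 / (R - r) be dropped.\<close>

theorem log_derivative_lemma:
  assumes "0 < \<alpha>" "\<alpha> < 1"
  shows "\<exists>C>0. \<forall>g r R. nonzero_meromorphic g \<longrightarrow> good_radius g r \<longrightarrow> good_radius g R \<longrightarrow> r + 1 \<le> R \<longrightarrow>
    circle_prox (\<lambda>z. deriv g z / g z) r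
      \<le> log_plus (8 * R * (circle_prox g R + circle_prox (\<lambda>z. inverse (g z)) R)) + log_plus (4 * zero_pole_count g R)
         + 2 * ln 2 + zero_pole_count g R * (C * r powr (-\<alpha>))"
proof -
  obtain C where C: "C > 0" "\<And>r a t. r > 0 \<Longrightarrow> t \<ge> 0 \<Longrightarrow> cmod a \<noteq> r \<Longrightarrow>
      circle_mean (\<lambda>z. ln (1 + t / cmod (z - a))) r \<le> C * t powr \<alpha> * r powr (-\<alpha>)"
    using circle_mean_ln_one_plus[OF assms] by blast
  define C' where "C' = C * 4 powr \<alpha>"
  have C': "C' > 0" using C(1) by (simp add: C'_def)
  have "circle_prox (\<lambda>z. deriv g z / g z) r
      \<le> log_plus (8 * R * (circle_prox g R + circle_prox (\<lambda>z. inverse (g z)) R)) + log_plus (4 * zero_pole_count g R)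
         + 2 * ln 2 + zero_pole_count g R * (C' * r powr (-\<alpha>))"
    if g: "nonzero_meromorphic g" and r: "good_radius g r" and R: "good_radius g R" and rR: "r + 1 \<le> R" for g r R
  proof -
    define S where "S = bad_points g \<inter> ball 0 R"
    define A where "A = circle_prox g R + circle_prox (\<lambda>z. inverse (g z)) R"
    define N where "N = zero_pole_count g R"
    have N0: "N \<ge> 0" by (simp add: N_def)
    have A0: "A \<ge> 0" unfolding A_def using circle_prox_nonneg[OF R] circle_prox_nonneg[OF good_radius_inverse[OF R]] by simp
    have fin: "finite S" unfolding S_def by (rule finite_bad_points_ball[OF g])
    have r0: "r > 0" using r by (rule good_radius_pos)
    have R0: "R > 0" using R by (rule good_radius_pos)
    have az: "cmod a \<noteq> r" if "a \<in> S" for a using that r by (auto simp: S_def good_radius_def)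
    have cln: "continuous_on (sphere 0 r) (\<lambda>z. ln (1 + 4 / cmod (z - a)))" if "cmod a \<noteq> r" for a
    proof -
      have "1 + 4 / cmod (z - a) \<noteq> 0" for z :: complex
        by (smt (verit) divide_nonneg_nonneg norm_ge_zero)
      then show ?thesis using that by (intro continuous_intros) auto
    qed
    define L where "L = (\<lambda>z. \<Sum>a\<in>S. \<bar>of_int (zorder g a)\<bar> * ln (1 + 4 / cmod (z - a)))"
    have cterm: "continuous_on (sphere 0 r) (\<lambda>z. \<bar>of_int (zorder g a)\<bar> * ln (1 + 4 / cmod (z - a)))" if "a \<in> S" for a
      by (intro continuous_on_mult continuous_on_const cln az that)
    have cL: "continuous_on (sphere 0 r) L" unfolding L_def by (intro continuous_on_sum cterm)
    define K where "K = log_plus (8 * R * A) + log_plus (4 * N) + 2 * ln 2"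
    have le: "log_plus (cmod (deriv g z / g z)) \<le> K + L z" if z: "cmod z = r" for z
    proof -
      have zb: "z \<notin> bad_points g" using r z by (auto simp: good_radius_def)
      define X where "X = (\<Sum>a\<in>S. \<bar>of_int (zorder g a)\<bar> * (4 / cmod (z - a)))"
      have X0: "X \<ge> 0" unfolding X_def by (intro sum_nonneg) auto
      have d: "R - cmod z \<ge> 1" using z rR by simp
      have "cmod (deriv g z / g z) \<le> 8 * R / (R - cmod z)\<^sup>2 * A
          + (\<Sum>a\<in>S. \<bar>of_int (zorder g a)\<bar> * (4 / cmod (z - a) + 4 / (R - cmod z)))"
        unfolding A_def S_def using z rR by (intro log_derivative_pointwise[OF g R _ zb]) auto
      also have "8 * R / (R - cmod z)\<^sup>2 * A \<le> 8 * R * A"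
      proof -
        have "8 * R / (R - cmod z)\<^sup>2 \<le> 8 * R / 1"
          using d R0 by (intro divide_left_mono) (auto intro: one_le_power)
        then show ?thesis using A0 by (intro mult_right_mono) auto
      qed
      also have "(\<Sum>a\<in>S. \<bar>of_int (zorder g a)\<bar> * (4 / cmod (z - a) + 4 / (R - cmod z)))
          \<le> (\<Sum>a\<in>S. \<bar>of_int (zorder g a)\<bar> * (4 / cmod (z - a) + 4))"
        using d by (intro sum_mono mult_left_mono add_left_mono) (auto simp: divide_le_eq)
      also have "\<dots> = X + 4 * N"
        by (simp add: X_def N_def zero_pole_count_def S_def distrib_left sum.distrib sum_distrib_left mult.commute)
      finally have "cmod (deriv g z / g z) \<le> (8 * R * A + 4 * N) + X" by simp
      then have "log_plus (cmod (deriv g z / g z)) \<le> log_plus ((8 * R * A + 4 * N) + X)" by (rule log_plus_mono)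
      also have "\<dots> \<le> log_plus (8 * R * A + 4 * N) + log_plus X + ln 2"
        using R0 A0 N0 X0 by (intro log_plus_add) auto
      also have "log_plus (8 * R * A + 4 * N) \<le> log_plus (8 * R * A) + log_plus (4 * N) + ln 2"
        using R0 A0 N0 by (intro log_plus_add) auto
      also have "log_plus X \<le> ln (1 + X)" by (rule log_plus_le_ln_one_plus[OF X0])
      also have "\<dots> \<le> (\<Sum>a\<in>S. ln (1 + \<bar>of_int (zorder g a)\<bar> * (4 / cmod (z - a))))"
        unfolding X_def by (rule ln_one_plus_sum_le[OF fin]) auto
      also have "\<dots> \<le> L z"
        unfolding L_def by (intro sum_mono ln_one_plus_int_mult_le) auto
      finally show ?thesis by (simp add: K_def)
    qed
    have cd: "continuous_on (sphere 0 r) (\<lambda>z. log_plus (cmod (deriv g z / g z)))"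
    proof -
      have "(\<lambda>z. deriv g z / g z) analytic_on sphere 0 r"
        using r by (subst analytic_on_analytic_at)
          (auto intro!: analytic_intros analytic_deriv simp: good_radius_def bad_points_def)
      then have "continuous_on (sphere 0 r) (\<lambda>z. deriv g z / g z)"
        by (meson analytic_imp_holomorphic holomorphic_on_imp_continuous_on)
      then show ?thesis by (intro continuous_on_log_plus continuous_on_norm)
    qed
    have "circle_prox (\<lambda>z. deriv g z / g z) r \<le> circle_mean (\<lambda>z. K + L z) r"
      unfolding circle_prox_def
      by (rule circle_mean_mono) (use cd cL le r0 in \<open>auto intro!: continuous_on_add continuous_on_const\<close>)
    also have "\<dots> = K + circle_mean L r"
      using cL r0 by (subst circle_mean_add) (auto simp: continuous_on_const)
    also have "circle_mean L r = (\<Sum>a\<in>S. circle_mean (\<lambda>z. \<bar>of_int (zorder g a)\<bar> * ln (1 + 4 / cmod (z - a))) r)"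
      unfolding L_def by (rule circle_mean_sum) (use cterm r0 fin in auto)
    also have "\<dots> \<le> (\<Sum>a\<in>S. \<bar>of_int (zorder g a)\<bar> * (C' * r powr (-\<alpha>)))"
      unfolding circle_mean_cmult C'_def using r0 az by (intro sum_mono mult_left_mono C) auto
    also have "\<dots> = N * (C' * r powr (-\<alpha>))"
      by (simp add: N_def zero_pole_count_def S_def sum_distrib_right)
    finally show ?thesis by (simp add: K_def A_def N_def)
  qed
  with C' show ?thesis by blast
qed

section \<open>Arithmetic of the characteristic\<close>

lemma nonzero_meromorphic_mult:
  assumes "nonzero_meromorphic f" "nonzero_meromorphic g"
  shows "nonzero_meromorphic (\<lambda>z. f z * g z)"
  using assms unfolding nonzero_meromorphic_def
  by (auto intro!: meromorphic_intros elim: eventually_elim2)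

lemma nonzero_meromorphic_divide:
  assumes "nonzero_meromorphic f" "nonzero_meromorphic g"
  shows "nonzero_meromorphic (\<lambda>z. f z / g z)"
  using assms unfolding nonzero_meromorphic_def
  by (auto intro!: meromorphic_intros elim: eventually_elim2)

lemma nonzero_meromorphic_power:
  assumes "nonzero_meromorphic f"
  shows "nonzero_meromorphic (\<lambda>z. f z ^ n)"
proof -
  have "eventually (\<lambda>z. f z \<noteq> 0) (cosparse UNIV)" "f meromorphic_on UNIV"
    using assms by (auto simp: nonzero_meromorphic_def)
  from eventually_mono[OF this(1), of "\<lambda>z. f z ^ n \<noteq> 0"] this(2) show ?thesis
    unfolding nonzero_meromorphic_def by (auto intro!: meromorphic_intros)
qed

lemma nonzero_meromorphic_shift:
  assumes "nonzero_meromorphic f"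
  shows "nonzero_meromorphic (\<lambda>z. f (z + \<eta>))"
proof (rule nonzero_meromorphicI[of _ 0])
  show "(\<lambda>z. f (z + \<eta>)) meromorphic_on UNIV"
  proof (rule meromorphic_on_compose[of f UNIV "\<lambda>z. z + \<eta>" UNIV])
    show "f meromorphic_on UNIV" using assms by (simp add: nonzero_meromorphic_def)
    show "(\<lambda>z. z + \<eta>) analytic_on UNIV" by (intro analytic_intros)
  qed auto
  have "eventually (\<lambda>w. f w \<noteq> 0) (at \<eta>)" by (rule nonzero_meromorphic_at(2)[OF assms])
  then have "eventually (\<lambda>w. f (w + \<eta>) \<noteq> 0) (at 0)"
    unfolding at_to_0[of \<eta>] eventually_filtermap by simp
  then show "\<exists>\<^sub>F w in at 0. f (w + \<eta>) \<noteq> 0" by (intro eventually_frequently) auto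
qed

lemma zorder_shift_meromorphic: "zorder (\<lambda>z. f (z + \<eta>)) a = zorder f (a + \<eta>)"
  by (subst (1 2) zorder_shift) (simp add: add_ac)

lemma good_radius_mult:
  assumes "good_radius f r" "good_radius g r"
  shows "good_radius (\<lambda>z. f z * g z) r"
  using assms unfolding good_radius_def bad_points_def by (auto intro!: analytic_intros)

lemma good_radius_power:
  assumes "good_radius f r"
  shows "good_radius (\<lambda>z. f z ^ n) r"
  using assms unfolding good_radius_def bad_points_def by (auto intro!: analytic_intros)

lemma circle_prox_mono:
  assumes "good_radius f r" "continuous_on (sphere 0 r) u"
    and "\<And>z. cmod z = r \<Longrightarrow> log_plus (cmod (f z)) \<le> u z"
  shows "circle_prox f r \<le> circle_mean u r"
  unfolding circle_prox_def
  by (rule circle_mean_mono) (use assms in \<open>auto simp: good_radius_continuous_log_plus good_radius_def\<close>)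

lemma circle_prox_mult:
  assumes "good_radius f r" "good_radius g r"
  shows "circle_prox (\<lambda>z. f z * g z) r \<le> circle_prox f r + circle_prox g r"
proof -
  have c: "continuous_on (sphere 0 r) (\<lambda>z. log_plus (cmod (f z)))" "continuous_on (sphere 0 r) (\<lambda>z. log_plus (cmod (g z)))"
    using assms by (auto intro: good_radius_continuous_log_plus)
  have "circle_prox (\<lambda>z. f z * g z) r \<le> circle_mean (\<lambda>z. log_plus (cmod (f z)) + log_plus (cmod (g z))) r"
    by (rule circle_prox_mono) (auto intro!: good_radius_mult assms continuous_on_add c log_plus_mult simp: norm_mult)
  also have "\<dots> = circle_prox f r + circle_prox g r"
    unfolding circle_prox_def using assms c by (subst circle_mean_add) (auto simp: good_radius_def)
  finally show ?thesis .
qed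

lemma circle_prox_power: "circle_prox (\<lambda>z. f z ^ n) r = of_nat n * circle_prox f r"
  unfolding circle_prox_def by (simp add: norm_power log_plus_power circle_mean_cmult)

lemma circle_prox_cong:
  assumes "\<And>z. cmod z = r \<Longrightarrow> f z = g z" "r \<ge> 0"
  shows "circle_prox f r = circle_prox g r"
  unfolding circle_prox_def by (rule circle_mean_cong) (use assms in auto)

lemma circle_prox_const: "circle_prox (\<lambda>z. c) r = log_plus (cmod c)"
  by (simp add: circle_prox_def)

lemma circle_prox_diff:
  assumes "good_radius f r" "good_radius g r" "good_radius (\<lambda>z. f z - g z) r"
  shows "circle_prox (\<lambda>z. f z - g z) r \<le> circle_prox f r + circle_prox g r + ln 2"
proof -
  have c: "continuous_on (sphere 0 r) (\<lambda>z. log_plus (cmod (f z)))" "continuous_on (sphere 0 r) (\<lambda>z. log_plus (cmod (g z)))"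
    using assms by (auto intro: good_radius_continuous_log_plus)
  have r0: "r \<ge> 0" using assms by (auto simp: good_radius_def)
  have "circle_prox (\<lambda>z. f z - g z) r \<le> circle_mean (\<lambda>z. log_plus (cmod (f z)) + log_plus (cmod (g z)) + ln 2) r"
  proof (rule circle_prox_mono[OF assms(3)])
    show "continuous_on (sphere 0 r) (\<lambda>z. log_plus (cmod (f z)) + log_plus (cmod (g z)) + ln 2)"
      by (intro continuous_on_add c continuous_on_const)
    show "log_plus (cmod (f z - g z)) \<le> log_plus (cmod (f z)) + log_plus (cmod (g z)) + ln 2" for z
      using log_plus_mono[OF norm_triangle_ineq4[of "f z" "g z"]] log_plus_add[of "cmod (f z)" "cmod (g z)"] by simp
  qed
  also have "\<dots> = circle_prox f r + circle_prox g r + ln 2"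
    unfolding circle_prox_def using r0 c by (simp add: circle_mean_add continuous_on_add continuous_on_const)
  finally show ?thesis .
qed

lemma pole_sum_le:
  assumes "\<And>a. a \<in> S \<Longrightarrow> pole_mult h a \<le> p a" "finite S" "bad_points h \<inter> ball 0 r \<subseteq> S" "S \<subseteq> ball 0 r" "r \<ge> 1"
  shows "pole_sum h r \<le> (\<Sum>a\<in>S. p a * (ln r - ln (cmod a)))"
  unfolding pole_sum_superset[OF assms(2-4)] using assms
  by (intro sum_mono mult_right_mono ln_radius_diff_nonneg) auto

lemma pole_sum_mult:
  assumes f: "nonzero_meromorphic f" and g: "nonzero_meromorphic g" and "r \<ge> 1"
  shows "pole_sum (\<lambda>z. f z * g z) r \<le> pole_sum f r + pole_sum g r"
proof -
  let ?h = "\<lambda>z. f z * g z"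
  define S where "S = (bad_points f \<union> bad_points g \<union> bad_points ?h) \<inter> ball 0 r"
  have S: "finite S" unfolding S_def
    using finite_bad_points_ball[OF f] finite_bad_points_ball[OF g]
      finite_bad_points_ball[OF nonzero_meromorphic_mult[OF f g]] by (simp add: Int_Un_distrib2)
  have z: "zorder ?h a = zorder f a + zorder g a" for a
    by (intro zorder_mult nonzero_meromorphic_at f g)
  have "pole_sum ?h r \<le> (\<Sum>a\<in>S. (pole_mult f a + pole_mult g a) * (ln r - ln (cmod a)))"
    by (rule pole_sum_le) (use S \<open>r \<ge> 1\<close> in \<open>auto simp: S_def pole_mult_def z\<close>)
  also have "\<dots> = pole_sum f r + pole_sum g r"
    using S by (subst (1 2) pole_sum_superset[of S]) (auto simp: S_def sum.distrib distrib_right)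
  finally show ?thesis .
qed

lemma pole_sum_power:
  assumes f: "nonzero_meromorphic f"
  shows "pole_sum (\<lambda>z. f z ^ n) r = of_nat n * pole_sum f r"
proof -
  let ?h = "\<lambda>z. f z ^ n"
  define S where "S = (bad_points f \<union> bad_points ?h) \<inter> ball 0 r"
  have S: "finite S" unfolding S_def
    using finite_bad_points_ball[OF f]
      finite_bad_points_ball[OF nonzero_meromorphic_power[OF f]] by (simp add: Int_Un_distrib2)
  have z: "pole_mult ?h a = of_nat n * pole_mult f a" for a
    unfolding pole_mult_def using zorder_power[OF nonzero_meromorphic_at(1,3)[OF f], of n a]
    by (simp add: max_def mult_le_0_iff)
  show ?thesis
    using S by (subst (1 2) pole_sum_superset[of S]) (auto simp: S_def z sum_distrib_left mult.assoc)
qed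

lemma char_sum_mult:
  assumes "nonzero_meromorphic f" "nonzero_meromorphic g" "good_radius f r" "good_radius g r" "r \<ge> 1"
  shows "char_sum (\<lambda>z. f z * g z) r \<le> char_sum f r + char_sum g r"
  using pole_sum_mult[OF assms(1,2,5)] circle_prox_mult[OF assms(3,4)] by (simp add: char_sum_def)

lemma char_sum_power:
  assumes "nonzero_meromorphic f"
  shows "char_sum (\<lambda>z. f z ^ n) r = of_nat n * char_sum f r"
  using pole_sum_power[OF assms] circle_prox_power by (simp add: char_sum_def distrib_left)

lemma pole_mult_minus_one:
  assumes g: "nonzero_meromorphic g" and h: "nonzero_meromorphic (\<lambda>z. g z - 1)"
  shows "pole_mult (\<lambda>z. g z - 1) a = pole_mult g a"
proof -
  have one: "(\<lambda>_. 1) meromorphic_on {a}" "\<exists>\<^sub>F w in at a. (1::complex) \<noteq> 0" "zorder (\<lambda>_. 1) a = 0" by auto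
  have "zorder (\<lambda>z. g z - 1) a = zorder g a" if "zorder g a < 0"
    using zorder_diff1[OF nonzero_meromorphic_at(1,3)[OF g] one(1,2)] that by simp
  moreover have "zorder (\<lambda>z. g z - 1) a \<ge> 0" if "zorder g a \<ge> 0"
    using zorder_diff_ge[OF nonzero_meromorphic_at(1,3)[OF g] one(1,2), of 0] nonzero_meromorphic_at(3)[OF h] that by simp
  ultimately show ?thesis by (cases "zorder g a < 0") (auto simp: pole_mult_def)
qed

lemma char_sum_minus_one:
  assumes g: "nonzero_meromorphic g" and h: "nonzero_meromorphic (\<lambda>z. g z - 1)"
    and r: "good_radius g r" "good_radius (\<lambda>z. g z - 1) r"
  shows "char_sum (\<lambda>z. g z - 1) r \<le> char_sum g r + ln 2"
proof -
  define S where "S = (bad_points g \<union> bad_points (\<lambda>z. g z - 1)) \<inter> ball 0 r"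
  have S: "finite S" unfolding S_def
    using finite_bad_points_ball[OF g] finite_bad_points_ball[OF h] by (simp add: Int_Un_distrib2)
  have "pole_sum (\<lambda>z. g z - 1) r = pole_sum g r"
    using S by (subst (1 2) pole_sum_superset[of S]) (auto simp: S_def pole_mult_minus_one[OF g h])
  moreover have "good_radius (\<lambda>_. 1) r" using r by (auto simp: good_radius_def bad_points_def)
  then have "circle_prox (\<lambda>z. g z - 1) r \<le> circle_prox g r + ln 2"
    using circle_prox_diff[OF r(1) _ r(2)] by (simp add: circle_prox_const)
  ultimately show ?thesis by (simp add: char_sum_def)
qed

section \<open>The pole sum of a shifted function\<close>

lemma ln_one_plus_mult_le:
  fixes p y :: real
  assumes "p \<ge> 1" "y \<ge> 0"
  shows "ln (1 + p * y) \<le> p * ln (1 + y)"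
proof -
  have pos: "1 + p * y > 0" using assms by (simp add: add_pos_nonneg)
  have e: "1 + y = (1 - 1 / p) *\<^sub>R 1 + (1 / p) *\<^sub>R (1 + p * y)" using assms by (simp add: field_simps)
  have "(1 - 1 / p) * ln 1 + (1 / p) * ln (1 + p * y) \<le> ln (1 + y)"
    unfolding e by (rule concave_onD[OF ln_concave]) (use assms pos in auto)
  then have "ln (1 + p * y) / p \<le> ln (1 + y)" by simp
  then show ?thesis using assms by (simp add: field_simps)
qed

text \<open>With p = t / (t - e) and x = (r + e) / t one has r / (t - e) = 1 + p (x - 1). Concavity
  of ln then costs only the factor p, which is at most A / (A - e) and so close to 1 for large
  A.\<close>

lemma ln_shift_ratio:
  fixes t r e A :: real
  assumes "0 \<le> e" "e < A" "A \<le> t" "t \<le> r + e"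
  shows "ln r - ln (t - e) \<le> A / (A - e) * (ln (r + e) - ln t)"
proof -
  define p where "p = t / (t - e)"
  define x where "x = (r + e) / t"
  have pos: "t > 0" "t - e > 0" "A > 0" "r > 0" using assms by linarith+
  have p1: "p \<ge> 1" using pos assms by (simp add: p_def field_simps)
  have x1: "x \<ge> 1" using pos assms by (simp add: x_def field_simps)
  have pA: "p \<le> A / (A - e)"
    using assms pos mult_left_mono[OF assms(3,1)] by (simp add: p_def frac_le_eq divide_le_0_iff field_simps)
  have "r / (t - e) = 1 + p * (x - 1)"
    using pos by (simp add: p_def x_def field_simps)
  then have "ln (r / (t - e)) = ln (1 + p * (x - 1))" by simp
  also have "\<dots> \<le> p * ln x" using ln_one_plus_mult_le[of p "x - 1"] p1 x1 by simp
  also have "\<dots> \<le> A / (A - e) * ln x" using pA x1 by (intro mult_right_mono) auto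
  also have "ln x = ln (r + e) - ln t" using pos assms by (simp add: x_def ln_div)
  finally show ?thesis using pos by (simp add: ln_div)
qed

text \<open>The weights are compared pole by pole. Far from the origin a shift changes them by a
  factor at most 1 + \<epsilon>, after the radius is enlarged by |\<eta>|; the finitely many poles
  of g near the origin cost a multiple of ln r. The factor has to be arbitrarily close to 1, since
  the final count has little room.\<close>

lemma pole_sum_shift_le:
  assumes g: "nonzero_meromorphic g" and "\<epsilon> > 0"
  shows "\<exists>C\<ge>0. \<forall>r\<ge>3. pole_sum (\<lambda>z. g (z + \<eta>)) r \<le> (1 + \<epsilon>) * pole_sum g (r + cmod \<eta>) + C * ln r"
proof -
  define e where "e = cmod \<eta>"
  \<comment> \<open>Chosen so that (1 + \<epsilon>) (A - e) = A + \<epsilon>, which bounds A / (A -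
    e) by 1 + \<epsilon>; the summand 1 keeps A above e.\<close>
  define A where "A = e + e / \<epsilon> + 1"
  have e0: "e \<ge> 0" by (simp add: e_def)
  have A: "A > e" "A \<ge> 1" "A / (A - e) \<le> 1 + \<epsilon>"
  proof -
    have "e / \<epsilon> \<ge> 0" using e0 assms by simp
    then show "A > e" "A \<ge> 1" using e0 by (auto simp: A_def)
    have "(1 + \<epsilon>) * (A - e) = A + \<epsilon>" using assms by (simp add: A_def field_simps)
    then show "A / (A - e) \<le> 1 + \<epsilon>" using \<open>A > e\<close> assms by (simp add: divide_le_eq)
  qed
  define C where "C = (\<Sum>b\<in>bad_points g \<inter> ball 0 A. pole_mult g b * (1 + \<bar>ln (cmod (b - \<eta>))\<bar>))"
  have C: "C \<ge> 0" unfolding C_def by (intro sum_nonneg) auto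
  have "pole_sum (\<lambda>z. g (z + \<eta>)) r \<le> (1 + \<epsilon>) * pole_sum g (r + e) + C * ln r" if r: "r \<ge> 3" for r
  proof -
    let ?h = "\<lambda>z. g (z + \<eta>)"
    \<comment> \<open>The reason for r >= 3: with ln r >= 1 the constants |ln |b - \<eta>|| are
      absorbed into multiples of ln r.\<close>
    have "exp 1 \<le> (3::real)" by (rule exp_le)
    then have lnr: "ln r \<ge> 1" using r by (subst ln_ge_iff) auto
    define S where "S = bad_points ?h \<inter> ball 0 r"
    define S' where "S' = (\<lambda>a. a + \<eta>) ` S \<inter> bad_points g"
    have fS: "finite S" unfolding S_def by (rule finite_bad_points_ball[OF nonzero_meromorphic_shift[OF g]])
    have S'r: "cmod b < r + e" "cmod (b - \<eta>) < r" if "b \<in> S'" for b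
    proof -
      show "cmod (b - \<eta>) < r" using that by (auto simp: S'_def S_def)
      then show "cmod b < r + e" using norm_triangle_sub[of b \<eta>] by (simp add: e_def)
    qed
    have "pole_sum ?h r = (\<Sum>a\<in>S. pole_mult g (a + \<eta>) * (ln r - ln (cmod ((a + \<eta>) - \<eta>))))"
      unfolding pole_sum_def S_def by (simp add: pole_mult_def zorder_shift_meromorphic)
    also have "\<dots> = (\<Sum>b\<in>(\<lambda>a. a + \<eta>) ` S. pole_mult g b * (ln r - ln (cmod (b - \<eta>))))"
      by (subst sum.reindex) (auto simp: inj_on_def)
    also have "\<dots> = (\<Sum>b\<in>S'. pole_mult g b * (ln r - ln (cmod (b - \<eta>))))"
      unfolding S'_def
    proof (rule sum.mono_neutral_right)
      show "\<forall>b\<in>(\<lambda>a. a + \<eta>) ` S - (\<lambda>a. a + \<eta>) ` S \<inter> bad_points g. pole_mult g b * (ln r - ln (cmod (b - \<eta>))) = 0"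
        using pole_mult_not_bad[of _ g] by (metis DiffE IntI mult_zero_left)
    qed (use fS in auto)
    also have "\<dots> \<le> (\<Sum>b\<in>S'. (1 + \<epsilon>) * (pole_mult g b * (ln (r + e) - ln (cmod b)))
        + (if b \<in> ball 0 A then pole_mult g b * (1 + \<bar>ln (cmod (b - \<eta>))\<bar>) * ln r else 0))"
    proof (rule sum_mono)
      fix b assume b: "b \<in> S'"
      have w: "ln (r + e) - ln (cmod b) \<ge> 0"
        using S'r[OF b] r e0 by (intro ln_radius_diff_nonneg) auto
      show "pole_mult g b * (ln r - ln (cmod (b - \<eta>))) \<le> (1 + \<epsilon>) * (pole_mult g b * (ln (r + e) - ln (cmod b)))
        + (if b \<in> ball 0 A then pole_mult g b * (1 + \<bar>ln (cmod (b - \<eta>))\<bar>) * ln r else 0)"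
      proof (cases "b \<in> ball 0 A")
        case True
        have "\<bar>ln (cmod (b - \<eta>))\<bar> * 1 \<le> \<bar>ln (cmod (b - \<eta>))\<bar> * ln r" using lnr by (intro mult_left_mono) auto
        then have "ln r - ln (cmod (b - \<eta>)) \<le> (1 + \<bar>ln (cmod (b - \<eta>))\<bar>) * ln r" by (simp add: algebra_simps)
        from mult_left_mono[OF this pole_mult_nonneg[of g b]]
        have "pole_mult g b * (ln r - ln (cmod (b - \<eta>))) \<le> pole_mult g b * (1 + \<bar>ln (cmod (b - \<eta>))\<bar>) * ln r"
          by (simp add: mult.assoc)
        moreover have "(1 + \<epsilon>) * (pole_mult g b * (ln (r + e) - ln (cmod b))) \<ge> 0"
          using w assms by simp
        ultimately show ?thesis using True by simp
      next
        case False
        then have bA: "A \<le> cmod b" by simp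
        have "cmod b - e \<le> cmod (b - \<eta>)" unfolding e_def by (rule norm_triangle_ineq2)
        moreover have "cmod b - e > 0" using bA A by simp
        ultimately have "ln r - ln (cmod (b - \<eta>)) \<le> ln r - ln (cmod b - e)"
          by (intro diff_left_mono ln_mono)
        also have "\<dots> \<le> A / (A - e) * (ln (r + e) - ln (cmod b))"
          using S'r[OF b] bA A e0 by (intro ln_shift_ratio) auto
        also have "\<dots> \<le> (1 + \<epsilon>) * (ln (r + e) - ln (cmod b))"
          using A w by (intro mult_right_mono) auto
        finally have "ln r - ln (cmod (b - \<eta>)) \<le> (1 + \<epsilon>) * (ln (r + e) - ln (cmod b))" .
        from mult_left_mono[OF this pole_mult_nonneg[of g b]] show ?thesis using False by (simp add: mult_ac)
      qed
    qed
    also have "\<dots> = (1 + \<epsilon>) * (\<Sum>b\<in>S'. pole_mult g b * (ln (r + e) - ln (cmod b)))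
        + (\<Sum>b\<in>S' \<inter> ball 0 A. pole_mult g b * (1 + \<bar>ln (cmod (b - \<eta>))\<bar>)) * ln r"
    proof -
      have "finite S'" using fS by (simp add: S'_def)
      note restrict = sum.inter_restrict[OF this]
      show ?thesis
        unfolding sum.distrib sum_distrib_left[symmetric] sum_distrib_right restrict
        by (intro arg_cong2[where f = "(+)"] refl sum.cong) simp
    qed
    also have "\<dots> \<le> (1 + \<epsilon>) * pole_sum g (r + e) + C * ln r"
    proof (intro add_mono mult_left_mono mult_right_mono)
      show "(\<Sum>b\<in>S'. pole_mult g b * (ln (r + e) - ln (cmod b))) \<le> pole_sum g (r + e)"
        unfolding pole_sum_def
      proof (rule sum_mono2)
        show "S' \<subseteq> bad_points g \<inter> ball 0 (r + e)" using S'r by (auto simp: S'_def)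
        show "0 \<le> pole_mult g b * (ln (r + e) - ln (cmod b))" if "b \<in> bad_points g \<inter> ball 0 (r + e) - S'" for b
          using that r e0 by (intro mult_nonneg_nonneg ln_radius_diff_nonneg) auto
      qed (rule finite_bad_points_ball[OF g])
      show "(\<Sum>b\<in>S' \<inter> ball 0 A. pole_mult g b * (1 + \<bar>ln (cmod (b - \<eta>))\<bar>)) \<le> C"
        unfolding C_def by (rule sum_mono2) (auto simp: S'_def finite_bad_points_ball[OF g])
    qed (use assms lnr in auto)
    finally show ?thesis .
  qed
  with C show ?thesis unfolding e_def by blast
qed

section \<open>Agreement with the definitions of the statement\<close>

lemma is_pole_iff_zorder_neg:
  assumes "nonzero_meromorphic g"
  shows "is_pole g z \<longleftrightarrow> zorder g z < 0"
proof -
  have "isolated_singularity_at g z"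
    using nonzero_meromorphic_at(1)[OF assms] by (simp add: meromorphic_at_iff)
  then show ?thesis
    using isolated_pole_imp_neg_zorder zorder_neg_imp_is_pole[OF nonzero_meromorphic_at(1,2)[OF assms]] by blast
qed

lemma pole_count_eq:
  assumes g: "nonzero_meromorphic g" and S: "finite S" "bad_points g \<inter> cball 0 t \<subseteq> S"
  shows "pole_count g t = (\<Sum>a\<in>S. if cmod a \<le> t then pole_mult g a else 0)"
proof -
  have sub: "{z. is_pole g z \<and> cmod z \<le> t} \<subseteq> S"
    using S(2) zorder_not_bad[of _ g] by (force simp: is_pole_iff_zorder_neg[OF g])
  have "pole_count g t = (\<Sum>z\<in>{z. is_pole g z \<and> cmod z \<le> t}. if cmod z \<le> t then pole_mult g z else 0)"
    unfolding pole_count_def by (rule sum.cong) (auto simp: pole_mult_def is_pole_iff_zorder_neg[OF g])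
  also have "\<dots> = (\<Sum>a\<in>S. if cmod a \<le> t then pole_mult g a else 0)"
    by (rule sum.mono_neutral_left[OF S(1) sub]) (auto simp: pole_mult_def is_pole_iff_zorder_neg[OF g])
  finally show ?thesis .
qed

text \<open>A pole a other than 0 enters the counting function at t = |a| and contributes the
  integral of 1 / t over [|a|, r], which is its weight. The pole at the origin is exactly the part
  that the definition treats separately.\<close>

theorem integrated_pole_count_eq_pole_sum:
  assumes g: "nonzero_meromorphic g" and r: "good_radius g r"
  shows "integrated_pole_count g r = pole_sum g r"
proof -
  have r0: "r > 0" using r by (rule good_radius_pos)
  define S where "S = bad_points g \<inter> ball 0 r"
  have fin: "finite S" unfolding S_def by (rule finite_bad_points_ball[OF g])
  define S' where "S' = S - {0}"
  have sub: "bad_points g \<inter> cball 0 t \<subseteq> S" if "t \<le> r" for t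
    using that r by (force simp: S_def good_radius_def)
  have pc: "pole_count g t = (\<Sum>a\<in>S. if cmod a \<le> t then pole_mult g a else 0)" if "t \<le> r" for t
    by (rule pole_count_eq[OF g fin sub[OF that]])
  have p0: "pole_count g 0 = (if 0 \<in> S then pole_mult g 0 else 0)"
    using fin r0 by (simp add: pc)
  have diff: "pole_count g t - pole_count g 0 = (\<Sum>a\<in>S'. if cmod a \<le> t then pole_mult g a else 0)" if "0 \<le> t" "t \<le> r" for t
  proof (cases "0 \<in> S")
    case True
    then show ?thesis using fin that unfolding S'_def pc[OF that(2)] p0 by (subst sum.remove[of _ 0]) auto
  next
    case False
    then show ?thesis using fin that unfolding S'_def pc[OF that(2)] p0 by auto
  qed
  have "has_bochner_integral lborel (\<lambda>t. \<Sum>a\<in>S'. pole_mult g a * ((1 / t) * indicator {cmod a..r} t))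
      (\<Sum>a\<in>S'. pole_mult g a * (ln r - ln (cmod a)))"
  proof (intro has_bochner_integral_sum has_bochner_integral_mult_right)
    fix a assume a: "a \<in> S'"
    have a0: "0 < cmod a" "cmod a \<le> r" using a by (auto simp: S'_def S_def)
    show "has_bochner_integral lborel (\<lambda>t. (1 / t) * indicator {cmod a..r} t) (ln r - ln (cmod a))"
    proof (rule has_bochner_integral_FTC_Icc_real)
      fix t assume "cmod a \<le> t"
      then have "0 < t" using a0 by linarith
      then show "(ln has_real_derivative 1 / t) (at t)" "isCont (\<lambda>t. 1 / t) t"
        by (auto intro!: derivative_eq_intros continuous_intros)
    qed (use a0 in auto)
  qed
  also have "?this \<longleftrightarrow> has_bochner_integral lborel (\<lambda>t. indicator {0..r} t *\<^sub>R ((pole_count g t - pole_count g 0) / t))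
      (\<Sum>a\<in>S'. pole_mult g a * (ln r - ln (cmod a)))"
  proof (rule has_bochner_integral_cong)
    fix t :: real
    show "(\<Sum>a\<in>S'. pole_mult g a * ((1 / t) * indicator {cmod a..r} t)) = indicator {0..r} t *\<^sub>R ((pole_count g t - pole_count g 0) / t)"
    proof (cases "t \<in> {0..r}")
      case True
      then show ?thesis by (simp add: diff sum_divide_distrib) (rule sum.cong, auto simp: indicator_def)
    next
      case False
      then have "t \<notin> {cmod a..r}" for a using norm_ge_zero[of a] by (auto simp del: norm_ge_zero)
      then show ?thesis using False by simp
    qed
  qed simp_all
  finally have "(LINT t:{0..r}|lborel. (pole_count g t - pole_count g 0) / t) = (\<Sum>a\<in>S'. pole_mult g a * (ln r - ln (cmod a)))"
    unfolding set_lebesgue_integral_def by (rule has_bochner_integral_integral_eq)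
  moreover have "(\<Sum>a\<in>S. pole_mult g a * (ln r - ln (cmod a))) = (\<Sum>a\<in>S'. pole_mult g a * (ln r - ln (cmod a))) + pole_count g 0 * ln r"
  proof (cases "0 \<in> S")
    case True
    then show ?thesis using fin unfolding S'_def p0 by (subst sum.remove[of _ 0]) auto
  next
    case False
    then show ?thesis unfolding S'_def p0 by simp
  qed
  ultimately show ?thesis by (simp add: integrated_pole_count_def pole_sum_def S_def)
qed

text \<open>The Lebesgue integral of the statement and the gauge integral of
  \<open>circle_mean\<close> agree because the integrand is continuous on a good circle.\<close>

lemma proximity_eq_circle_prox:
  assumes "good_radius g r"
  shows "proximity g r = circle_prox g r"
proof -
  have "continuous_on {0..2 * pi} (\<lambda>\<theta>. log_plus (cmod (g (rcis r \<theta>))))"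
    using continuous_on_circle[OF good_radius_continuous_log_plus[OF assms]] assms by (simp add: good_radius_def)
  from set_borel_integral_eq_integral(2)[OF borel_integrable_atLeastAtMost'[OF this]]
  show ?thesis by (simp add: proximity_def circle_prox_def circle_mean_def)
qed

lemma nevanlinna_char_eq_char_sum:
  assumes "nonzero_meromorphic g" "good_radius g r"
  shows "nevanlinna_char g r = char_sum g r"
  using integrated_pole_count_eq_pole_sum[OF assms] proximity_eq_circle_prox[OF assms(2)]
  by (simp add: nevanlinna_char_def char_sum_def)

text \<open>The tails of a convergent integral of dr / r tend to zero, and on this interval the
  density 1 / r is at least 1 / (4 * 2^k). So E fills a vanishing fraction of it. The interval
  reaches up to 4 * 2^k to leave room for the translates of radii from [2^k, 2 * 2^k].\<close>

lemma finite_log_measure_imp_tail: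
  assumes "finite_log_measure E" "\<epsilon> > 0"
  shows "eventually (\<lambda>k::nat. E \<inter> {2 ^ k..4 * 2 ^ k} \<in> lmeasurable \<and>
    measure lebesgue (E \<inter> {2 ^ k..4 * 2 ^ k}) \<le> \<epsilon> * 2 ^ k) sequentially"
proof -
  have E: "E \<in> sets lebesgue" and fin: "(\<integral>\<^sup>+ r\<in>E \<inter> {1..}. ennreal (1 / r) \<partial>lebesgue) < \<infinity>"
    using assms by (auto simp: finite_log_measure_def)
  define M where "M = density lebesgue (\<lambda>r. ennreal (1 / r))"
  have meas: "(\<lambda>r. ennreal (1 / r)) \<in> borel_measurable lebesgue" by (intro measurable_completion) measurable
  define A where "A = (\<lambda>k::nat. E \<inter> {2 ^ k..} :: real set)"
  have Al: "A k \<in> sets lebesgue" for k unfolding A_def using E by auto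
  have eA: "emeasure M (A k) = (\<integral>\<^sup>+ r\<in>A k. ennreal (1 / r) \<partial>lebesgue)" for k
    unfolding M_def by (rule emeasure_density[OF meas Al])
  have "(\<lambda>k. emeasure M (A k)) \<longlonglongrightarrow> emeasure M (\<Inter>k. A k)"
  proof (rule Lim_emeasure_decseq)
    show "range A \<subseteq> sets M" using Al by (auto simp: M_def)
    have "(2::real) ^ m \<le> 2 ^ n" if "m \<le> n" for m n using that by (rule power_increasing) simp
    then show "decseq A" unfolding A_def decseq_def by (intro allI impI Int_mono order_refl) simp
    fix k
    have "emeasure M (A k) \<le> (\<integral>\<^sup>+ r\<in>E \<inter> {1..}. ennreal (1 / r) \<partial>lebesgue)"
      unfolding eA
    proof (rule nn_integral_mono)
      fix r :: real
      have "1 \<le> r" if "2 ^ k \<le> r" for r :: real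
        using order_trans[OF one_le_power[of "2::real" k] that] by simp
      then have "A k \<subseteq> E \<inter> {1..}" by (auto simp: A_def)
      then show "ennreal (1 / r) * indicator (A k) r \<le> ennreal (1 / r) * indicator (E \<inter> {1..}) r"
        by (auto simp: indicator_def)
    qed
    with fin show "emeasure M (A k) \<noteq> \<infinity>" by (auto simp: top_unique)
  qed
  also have "(\<Inter>k. A k) = {}"
  proof -
    have "\<not> (\<forall>k::nat. 2 ^ k \<le> x)" for x :: real using real_arch_pow[of 2 x] by (auto simp: not_le)
    then show ?thesis unfolding A_def by auto
  qed
  finally have "(\<lambda>k. emeasure M (A k)) \<longlonglongrightarrow> 0" by simp
  then have "eventually (\<lambda>k. emeasure M (A k) < ennreal (\<epsilon> / 4)) sequentially"
    using assms(2) by (intro order_tendstoD(2)) auto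
  then show ?thesis
  proof eventually_elim
    case (elim k)
    define B where "B = E \<inter> {2 ^ k..4 * 2 ^ k :: real}"
    have Bl: "B \<in> lmeasurable"
      unfolding B_def using E by (intro fmeasurable_Int_fmeasurable bounded_set_imp_lmeasurable) auto
    have "emeasure lebesgue B * ennreal (1 / (4 * 2 ^ k)) = (\<integral>\<^sup>+ r. ennreal (1 / (4 * 2 ^ k)) * indicator B r \<partial>lebesgue)"
      using Bl by (subst nn_integral_cmult_indicator) (auto simp: mult.commute)
    also have "\<dots> \<le> (\<integral>\<^sup>+ r\<in>A k. ennreal (1 / r) \<partial>lebesgue)"
    proof (rule nn_integral_mono)
      fix r :: real
      show "ennreal (1 / (4 * 2 ^ k)) * indicator B r \<le> ennreal (1 / r) * indicator (A k) r"
      proof (cases "r \<in> B")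
        case True
        then have "r \<in> A k" "0 < r" "r \<le> 4 * 2 ^ k"
          using zero_less_power[of "2::real" k] by (auto simp: A_def B_def simp del: zero_less_power intro: less_le_trans)
        then show ?thesis using True by (auto intro!: ennreal_leI divide_left_mono)
      qed simp
    qed
    also have "\<dots> < ennreal (\<epsilon> / 4)" using elim by (simp add: eA)
    finally have "ennreal (measure lebesgue B) * ennreal (1 / (4 * 2 ^ k)) \<le> ennreal (\<epsilon> / 4)"
      using Bl by (simp add: emeasure_eq_measure2)
    then have "ennreal (measure lebesgue B * (1 / (4 * 2 ^ k))) \<le> ennreal (\<epsilon> / 4)" by (subst ennreal_mult) auto
    then have "measure lebesgue B * (1 / (4 * 2 ^ k)) \<le> \<epsilon> / 4" using assms(2) by (subst (asm) ennreal_le_iff) auto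
    then have "measure lebesgue B \<le> \<epsilon> * 2 ^ k" by (simp add: field_simps)
    with Bl show ?case unfolding B_def by simp
  qed
qed

lemma finite_log_measure_Un_countable:
  assumes "finite_log_measure E" "countable B"
  shows "finite_log_measure (E \<union> B)"
proof -
  have E: "E \<in> sets lebesgue" and fin: "(\<integral>\<^sup>+ r\<in>E \<inter> {1..}. ennreal (1 / r) \<partial>lebesgue) < \<infinity>"
    using assms by (auto simp: finite_log_measure_def)
  have B: "B \<in> null_sets lebesgue" using assms(2) by (rule countable_imp_null_set_lborel[THEN null_sets_completionI])
  then have Bs: "B \<in> sets lebesgue" by auto
  have "(\<integral>\<^sup>+ r\<in>(E \<union> B) \<inter> {1..}. ennreal (1 / r) \<partial>lebesgue) = (\<integral>\<^sup>+ r\<in>E \<inter> {1..}. ennreal (1 / r) \<partial>lebesgue)"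
    by (rule nn_integral_cong_AE) (use AE_not_in[OF B] in \<open>auto simp: indicator_def elim!: eventually_mono\<close>)
  with E Bs fin show ?thesis by (simp add: finite_log_measure_def)
qed

section \<open>Radii of regular growth\<close>

lemma eventually_powr_le:
  fixes a C :: real
  assumes "a < 1"
  shows "eventually (\<lambda>x. C * x powr a \<le> x) at_top"
proof -
  have "((\<lambda>x. C * x powr (a - 1)) \<longlongrightarrow> C * 0) at_top"
    using assms by (intro tendsto_intros tendsto_neg_powr filterlim_ident) auto
  then have "eventually (\<lambda>x. C * x powr (a - 1) < 1) at_top"
    by (rule order_tendstoD(2)) simp
  then show ?thesis using eventually_gt_at_top[of 0]
  proof eventually_elim
    case (elim x)
    then have "C * x powr (a - 1) * x \<le> 1 * x" by (intro mult_right_mono) auto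
    moreover have "x powr (a - 1) * x = x powr a" using elim by (simp add: powr_diff)
    ultimately show ?case by (simp add: mult.assoc)
  qed
qed

lemma filterlim_power2: "filterlim (\<lambda>k. (2::real) ^ k) at_top sequentially"
  by (rule filterlim_at_infinity_imp_filterlim_at_top[OF filterlim_realpow_sequentially_gt1]) auto

lemma sum_two_step_telescope:
  fixes u :: "nat \<Rightarrow> real"
  shows "(\<Sum>i\<le>m. u (i + 2) - u i) = u (m + 2) + u (m + 1) - u 1 - u 0"
  by (induction m) (auto simp: numeral_2_eq_2)

text \<open>If no admissible \<open>r\<close> existed in \<open>[x, 2x]\<close>, then that interval would be covered by the translates of the
  exceptional set and by the grid cells across which \<open>\<phi>\<close> increases by at least \<open>c\<close>; there are at most
  \<open>O(x powr \<sigma>)\<close> such cells, of length \<open>O(x powr \<beta>)\<close>.\<close>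
lemma regular_growth_radius:
  fixes \<phi> :: "real \<Rightarrow> real"
  assumes mono: "\<And>x y. x \<le> y \<Longrightarrow> \<phi> x \<le> \<phi> y" and nonneg: "\<And>x. \<phi> x \<ge> 0"
    and bound: "\<And>x. x \<ge> x0 \<Longrightarrow> \<phi> x \<le> (x + 1) powr \<sigma>"
    and \<sigma>: "0 < \<sigma>" and \<beta>: "0 < \<beta>" and \<sigma>\<beta>: "\<sigma> + \<beta> < 1" and E: "finite_log_measure E" and c: "c > 0" and J: "J \<ge> 1"
  shows "eventually (\<lambda>k::nat. \<exists>r. 2 ^ k \<le> r \<and> r \<le> 2 * 2 ^ k \<and>
    (\<forall>j\<le>J. r + real j * (2 ^ k) powr \<beta> \<notin> E) \<and> \<phi> (r + real J * (2 ^ k) powr \<beta>) - \<phi> r < c) sequentially"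
proof -
  \<comment> \<open>With this value the J + 1 translates of E cover at most x / 4; C is chosen so
    that the cells of rapid growth cover at most another x / 4. Together they cannot fill
    [x, 2x].\<close>
  define \<epsilon> where "\<epsilon> = 1 / (4 * (real J + 1))"
  have \<epsilon>: "\<epsilon> > 0" by (simp add: \<epsilon>_def)
  define C where "C = 4 * (2 * real J / c) * 5 powr \<sigma>"
  have ev: "eventually (\<lambda>x::real. x \<ge> 1 \<and> x \<ge> x0 \<and> real J * x powr \<beta> \<le> x \<and> C * x powr (\<sigma> + \<beta>) \<le> x) at_top"
    using \<sigma> \<beta> \<sigma>\<beta> by (intro eventually_conj eventually_ge_at_top eventually_powr_le) auto
  have evk: "eventually (\<lambda>k::nat. (2::real) ^ k \<ge> 1 \<and> (2::real) ^ k \<ge> x0 \<and> real J * (2 ^ k) powr \<beta> \<le> 2 ^ k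
      \<and> C * (2 ^ k) powr (\<sigma> + \<beta>) \<le> 2 ^ k) sequentially"
    using eventually_compose_filterlim[OF ev filterlim_power2] .
  show ?thesis using evk finite_log_measure_imp_tail[OF E \<epsilon>]
  proof eventually_elim
    case (elim k)
    define x where "x = (2::real) ^ k"
    define d where "d = x powr \<beta>"
    define h where "h = real J * d"
    have x: "x \<ge> 1" "x \<ge> x0" "h \<le> x" "C * x powr (\<sigma> + \<beta>) \<le> x"
      using elim by (auto simp: x_def h_def d_def)
    have Em: "E \<inter> {x..4 * x} \<in> lmeasurable" "measure lebesgue (E \<inter> {x..4 * x}) \<le> \<epsilon> * x"
      using elim by (auto simp: x_def)
    have d: "d \<ge> 1" unfolding d_def using x(1) \<beta> by (intro ge_one_powr_ge_zero) auto
    have h: "h > 0" using d J by (simp add: h_def)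
    show ?case
    proof (rule ccontr)
      assume "\<nexists>r. 2 ^ k \<le> r \<and> r \<le> 2 * 2 ^ k \<and>
        (\<forall>j\<le>J. r + real j * (2 ^ k) powr \<beta> \<notin> E) \<and> \<phi> (r + real J * (2 ^ k) powr \<beta>) - \<phi> r < c"
      then have none: "(\<exists>j\<le>J. r + real j * d \<in> E) \<or> \<phi> (r + h) - \<phi> r \<ge> c" if "x \<le> r" "r \<le> 2 * x" for r
        using that unfolding x_def d_def h_def by (meson not_le)
      define m where "m = nat \<lfloor>x / h\<rfloor>"
      define p where "p = (\<lambda>i::nat. x + real i * h)"
      \<comment> \<open>If r lies in cell i, then r + h is at most p (i + 2), so growth is measured
        across two cells. The sum of two-step increments still telescopes and is at most 2 *
        \<phi>(4 x).\<close>
      define I where "I = {i. i \<le> m \<and> \<phi> (p (i + 2)) - \<phi> (p i) \<ge> c}"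
      define B where "B = (\<lambda>j. (\<lambda>y. y - real j * d) ` (E \<inter> {x..4 * x}))"
      have fI: "finite I" unfolding I_def by (rule finite_subset[of _ "{..m}"]) auto
      have mh: "real m * h \<le> x"
      proof -
        have "real m \<le> x / h" unfolding m_def using x h by simp
        then show ?thesis using h by (simp add: field_simps)
      qed
      have "real (card I) * c = (\<Sum>i\<in>I. c)" by simp
      also have "\<dots> \<le> (\<Sum>i\<in>I. \<phi> (p (i + 2)) - \<phi> (p i))" by (rule sum_mono) (simp add: I_def)
      also have "\<dots> \<le> (\<Sum>i\<le>m. \<phi> (p (i + 2)) - \<phi> (p i))"
        by (rule sum_mono2) (use h in \<open>auto simp: I_def p_def intro!: mono mult_right_mono\<close>)
      also have "\<dots> = \<phi> (p (m + 2)) + \<phi> (p (m + 1)) - \<phi> (p 1) - \<phi> (p 0)"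
        by (rule sum_two_step_telescope[of "\<lambda>i. \<phi> (p i)"])
      also have "\<dots> \<le> 2 * \<phi> (4 * x)"
      proof -
        have "p (m + 2) \<le> 4 * x" "p (m + 1) \<le> 4 * x" using mh x(3) h by (auto simp: p_def algebra_simps)
        from this[THEN mono] show ?thesis using nonneg[of "p 1"] nonneg[of "p 0"] by linarith
      qed
      also have "\<phi> (4 * x) \<le> (4 * x + 1) powr \<sigma>" using x by (intro bound) auto
      also have "\<dots> \<le> (5 * x) powr \<sigma>" using x \<sigma> by (intro powr_mono2) auto
      also have "\<dots> = 5 powr \<sigma> * x powr \<sigma>" using x by (simp add: powr_mult)
      finally have "real (card I) * c \<le> 2 * (5 powr \<sigma> * x powr \<sigma>)" by simp
      then have "real (card I) \<le> 2 * (5 powr \<sigma> * x powr \<sigma>) / c" using c by (simp add: field_simps)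
      then have "real (card I) * h \<le> 2 * (5 powr \<sigma> * x powr \<sigma>) / c * h" using h by (intro mult_right_mono) auto
      also have "\<dots> = C * x powr (\<sigma> + \<beta>) / 4" by (simp add: C_def h_def d_def powr_add)
      also have "\<dots> \<le> x / 4" using x by simp
      finally have cardI: "real (card I) * h \<le> x / 4" .
      have Bm: "B j \<in> lmeasurable" "measure lebesgue (B j) \<le> \<epsilon> * x" for j
        unfolding B_def using measurable_translation_subtract[OF Em(1)] measure_translation_subtract[of "real j * d" "E \<inter> {x..4 * x}"] Em(2) by auto
      have Pm: "{p i..p (i + 1)} \<in> lmeasurable" "measure lebesgue {p i..p (i + 1)} = h" for i
        using h by (auto simp: p_def algebra_simps)
      have cover: "{x..2 * x} \<subseteq> (\<Union>j\<in>{..J}. B j) \<union> (\<Union>i\<in>I. {p i..p (i + 1)})"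
      proof
        fix r assume "r \<in> {x..2 * x}"
        then have r: "x \<le> r" "r \<le> 2 * x" by auto
        from none[OF r] show "r \<in> (\<Union>j\<in>{..J}. B j) \<union> (\<Union>i\<in>I. {p i..p (i + 1)})"
        proof
          assume "\<exists>j\<le>J. r + real j * d \<in> E"
          then obtain j where j: "j \<le> J" "r + real j * d \<in> E" by blast
          have "real j * d \<le> h" unfolding h_def using j d by (intro mult_right_mono) auto
          moreover have "0 \<le> real j * d" using d by simp
          ultimately have "r + real j * d \<in> E \<inter> {x..4 * x}" using j r x(1,3) by auto
          moreover have "r = (r + real j * d) - real j * d" by simp
          ultimately have "r \<in> B j" unfolding B_def by (metis imageI)
          then show ?thesis using j by auto
        next
          assume inc: "\<phi> (r + h) - \<phi> r \<ge> c"
          define i where "i = nat \<lfloor>(r - x) / h\<rfloor>"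
          have q0: "(r - x) / h \<ge> 0" using r h by simp
          then have i: "real i \<le> (r - x) / h" "(r - x) / h < real i + 1"
            unfolding i_def using of_nat_floor[OF q0] floor_correct[of "(r - x) / h"] by (auto simp: of_nat_nat)
          then have pi: "p i \<le> r" "r \<le> p (i + 1)" using h by (auto simp: p_def field_simps)
          have "(r - x) / h \<le> x / h" using r h by (intro divide_right_mono) auto
          then have "i \<le> m" unfolding i_def m_def by (intro nat_mono floor_mono)
          moreover have "\<phi> (r + h) \<le> \<phi> (p (i + 2))" using pi by (intro mono) (auto simp: p_def algebra_simps)
          moreover have "\<phi> (p i) \<le> \<phi> r" using pi by (intro mono)
          ultimately have "i \<in> I" using inc by (simp add: I_def)
          then show ?thesis using pi by auto
        qed
      qed
      define U V where "U = (\<Union>j\<in>{..J}. B j)" and "V = (\<Union>i\<in>I. {p i..p (i + 1)})"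
      have UVm: "U \<in> lmeasurable" "V \<in> lmeasurable"
        unfolding U_def V_def using Bm Pm fI by (auto intro!: fmeasurable.finite_UN)
      have "x = measure lebesgue {x..2 * x}" using x by simp
      also have "\<dots> \<le> measure lebesgue (U \<union> V)"
        using cover UVm unfolding U_def V_def by (intro measure_mono_fmeasurable fmeasurable.Un) auto
      also have "\<dots> \<le> measure lebesgue U + measure lebesgue V"
        using UVm by (intro measure_Un_le) auto
      also have "measure lebesgue U \<le> (\<Sum>j\<in>{..J}. measure lebesgue (B j))"
        unfolding U_def using Bm by (intro measure_UNION_le) auto
      also have "\<dots> \<le> (\<Sum>j\<in>{..J}. \<epsilon> * x)" by (rule sum_mono) (rule Bm)
      also have "\<dots> = x / 4" by (simp add: \<epsilon>_def field_simps)
      also have "measure lebesgue V \<le> (\<Sum>i\<in>I. measure lebesgue {p i..p (i + 1)})"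
        unfolding V_def using Pm fI by (intro measure_UNION_le) auto
      also have "\<dots> = real (card I) * h" by (simp only: Pm(2)) simp
      also have "\<dots> \<le> x / 4" by (rule cardI)
      finally show False using x(1) by simp
    qed
  qed
qed

section \<open>Functions of logarithmic growth are rational\<close>

lemma poly_norm_le_power:
  fixes p :: "complex poly"
  shows "\<exists>C\<ge>1. \<exists>N. \<forall>z. cmod z \<ge> 1 \<longrightarrow> cmod (poly p z) \<le> C * cmod z ^ N"
proof (induction p)
  case 0
  then show ?case by (intro exI[of _ 1] conjI exI[of _ 0]) auto
next
  case (pCons a p)
  then obtain C N where C: "C \<ge> 1" "\<And>z. cmod z \<ge> 1 \<Longrightarrow> cmod (poly p z) \<le> C * cmod z ^ N" by blast
  have "cmod (poly (pCons a p) z) \<le> (cmod a + C) * cmod z ^ Suc N" if z: "cmod z \<ge> 1" for z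
  proof -
    have "cmod (poly (pCons a p) z) \<le> cmod a + cmod z * cmod (poly p z)"
      using norm_triangle_ineq[of a "z * poly p z"] by (simp add: norm_mult)
    also have "\<dots> \<le> cmod a * cmod z ^ Suc N + cmod z * (C * cmod z ^ N)"
    proof (intro add_mono mult_left_mono C z)
      have "cmod a * 1 \<le> cmod a * cmod z ^ Suc N" using z one_le_power[OF z, of "Suc N"] by (intro mult_left_mono) auto
      then show "cmod a \<le> cmod a * cmod z ^ Suc N" by simp
    qed auto
    finally show ?thesis by (simp add: algebra_simps)
  qed
  moreover have "cmod a + C \<ge> 1" using C(1) norm_ge_zero[of a] by linarith
  ultimately show ?case by blast
qed

text \<open>Cauchy's estimates on an unbounded sequence of circles kill all high Taylor coefficients.\<close>
lemma entire_polynomial_growth_imp_poly: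
  assumes g: "g holomorphic_on UNIV"
    and growth: "\<And>r0. \<exists>r\<ge>r0. \<forall>z. cmod z \<le> r \<longrightarrow> cmod (g z) \<le> B * r ^ N"
  shows "\<exists>p. \<forall>z. g z = poly p z"
proof -
  have zero: "(deriv ^^ n) g 0 = 0" if n: "n > N" for n
  proof (rule ccontr)
    assume ne: "(deriv ^^ n) g 0 \<noteq> 0"
    define a where "a = cmod ((deriv ^^ n) g 0)"
    have a: "a > 0" using ne by (simp add: a_def)
    \<comment> \<open>The Cauchy bound amounts to a * r^(n - N) <= n! * B, which fails for r > n! *
      B / a because n - N >= 1.\<close>
    obtain r where r: "r \<ge> max 1 (fact n * B / a + 1)" "\<And>z. cmod z \<le> r \<Longrightarrow> cmod (g z) \<le> B * r ^ N"
      using growth by blast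
    have r1: "r \<ge> 1" using r by simp
    have "a \<le> fact n * (B * r ^ N) / r ^ n"
      unfolding a_def
      by (rule Cauchy_inequality) (use r r1 g in \<open>auto intro: holomorphic_on_subset holomorphic_on_imp_continuous_on\<close>)
    then have "a * r ^ n \<le> fact n * B * r ^ N" using r1 by (simp add: field_simps)
    moreover have "r ^ n = r ^ (n - N) * r ^ N" using n by (simp flip: power_add)
    moreover have "r ^ N > 0" using r1 by simp
    ultimately have "a * r ^ (n - N) \<le> fact n * B" by simp
    moreover have "r ^ 1 \<le> r ^ (n - N)" using n r1 by (intro power_increasing) auto
    then have "a * r \<le> a * r ^ (n - N)" using a by (intro mult_left_mono) auto
    moreover have "fact n * B / a < r" using r by linarith
    then have "fact n * B < a * r" using a by (simp add: field_simps)
    ultimately show False by linarith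
  qed
  define p where "p = (\<Sum>n\<le>N. monom ((deriv ^^ n) g 0 / fact n) n)"
  have "g z = poly p z" for z
  proof -
    have "(\<lambda>n. (deriv ^^ n) g 0 / fact n * (z - 0) ^ n) sums g z"
      by (rule holomorphic_power_series[of g 0 "cmod z + 1"]) (use g in \<open>auto intro: holomorphic_on_subset\<close>)
    moreover have "(\<lambda>n. (deriv ^^ n) g 0 / fact n * (z - 0) ^ n) sums (\<Sum>n\<in>{..N}. (deriv ^^ n) g 0 / fact n * (z - 0) ^ n)"
      by (rule sums_finite) (use zero in auto)
    ultimately have "g z = (\<Sum>n\<in>{..N}. (deriv ^^ n) g 0 / fact n * (z - 0) ^ n)" by (rule sums_unique2)
    then show ?thesis by (simp add: p_def poly_sum poly_monom)
  qed
  then show ?thesis by blast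
qed

text \<open>Without poles the Blaschke terms of Poisson-Jensen are nonpositive, and for |z| <= R / 2
  the kernel is at most R^2 / (R / 2)^2 = 4.\<close>

lemma entire_norm_le_circle_prox:
  assumes g: "nonzero_meromorphic g" and an: "g holomorphic_on UNIV" and R: "good_radius g R" and z: "cmod z \<le> R / 2"
  shows "cmod (g z) \<le> exp (4 * circle_prox g R)"
proof (cases "g z = 0")
  case False
  have R0: "R > 0" using R by (rule good_radius_pos)
  have an1: "g analytic_on {w}" for w
    using an by (metis analytic_on_open analytic_on_subset open_UNIV subset_UNIV)
  have zb: "z \<notin> bad_points g" using False an1 by (simp add: bad_points_def)
  have zR: "cmod z < R" using z R0 by simp
  have "ln (cmod (g z)) = circle_mean (\<lambda>w. ln (cmod (g w)) * poisson_kernel R z w) R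
    + (\<Sum>a\<in>bad_points g \<inter> ball 0 R. of_int (zorder g a) * ln (cmod (blaschke R a z)))"
    by (rule poisson_jensen[OF g R zR zb])
  also have "(\<Sum>a\<in>bad_points g \<inter> ball 0 R. of_int (zorder g a) * ln (cmod (blaschke R a z))) \<le> 0"
  proof (intro sum_nonpos mult_nonneg_nonpos)
    fix a assume a: "a \<in> bad_points g \<inter> ball 0 R"
    have "zorder g a \<ge> 0" by (rule zorder_ge_0[OF an1 nonzero_meromorphic_at(3)[OF g]])
    then show "0 \<le> real_of_int (zorder g a)" by simp
    have "blaschke R a z \<noteq> 0" using a zb zR by (intro blaschke_nonzero) auto
    moreover have "cmod (blaschke R a z) \<le> 1" using a zR by (intro blaschke_norm_le_1) auto
    ultimately show "ln (cmod (blaschke R a z)) \<le> 0" by simp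
  qed
  also have "circle_mean (\<lambda>w. ln (cmod (g w)) * poisson_kernel R z w) R \<le> circle_mean (\<lambda>w. log_plus (cmod (g w)) * 4) R"
  proof (rule circle_mean_mono)
    show "continuous_on (sphere 0 R) (\<lambda>w. ln (cmod (g w)) * poisson_kernel R z w)"
      unfolding poisson_kernel_def using zR by (intro continuous_intros good_radius_continuous_ln R) auto
    show "continuous_on (sphere 0 R) (\<lambda>w. log_plus (cmod (g w)) * 4)"
      by (intro continuous_intros good_radius_continuous R)
    fix w assume w: "cmod w = R"
    have "cmod (w - z) \<ge> R / 2" using norm_triangle_ineq2[of w z] w z by simp
    then have d: "(cmod (w - z))\<^sup>2 \<ge> (R / 2)\<^sup>2" using R0 by (intro power_mono) auto
    have "poisson_kernel R z w \<le> R\<^sup>2 / (R / 2)\<^sup>2"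
      unfolding poisson_kernel_def using d R0 by (intro frac_le) auto
    then have P: "poisson_kernel R z w \<le> 4" using R0 by (simp add: power_divide)
    have "ln (cmod (g w)) * poisson_kernel R z w \<le> log_plus (cmod (g w)) * poisson_kernel R z w"
      using good_radius_nonzero[OF R w] zR by (intro mult_right_mono ln_le_log_plus poisson_kernel_nonneg) auto
    also have "\<dots> \<le> log_plus (cmod (g w)) * 4" by (rule mult_left_mono[OF P]) simp
    finally show "ln (cmod (g w)) * poisson_kernel R z w \<le> log_plus (cmod (g w)) * 4" .
  qed (use R0 in simp)
  also have "\<dots> = circle_prox g R * 4" by (simp add: circle_mean_cmult_right circle_prox_def)
  finally have "ln (cmod (g z)) \<le> 4 * circle_prox g R" by simp
  then have "exp (ln (cmod (g z))) \<le> exp (4 * circle_prox g R)" by simp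
  then show ?thesis using False by simp
qed simp

text \<open>For large r every fixed pole contributes at least ln r up to a bounded term, so more
  than K poles would outgrow K * ln r.\<close>

lemma slow_pole_sum_imp_finite_poles:
  assumes g: "nonzero_meromorphic g" and slow: "\<And>r0. \<exists>r\<ge>r0. pole_sum g r \<le> K * ln r"
  shows "finite {z. is_pole g z}"
proof -
  have "card S \<le> nat \<lceil>K\<rceil>" if S: "S \<subseteq> {z. is_pole g z}" "finite S" for S
  proof (rule ccontr)
    assume "\<not> card S \<le> nat \<lceil>K\<rceil>"
    then have cK: "real (card S) > K" by linarith
    define D where "D = (\<Sum>a\<in>S. pole_mult g a * \<bar>ln (cmod a)\<bar>)"
    define r0 where "r0 = Max (insert 1 (cmod ` S))"
    \<comment> \<open>The first bound puts all of S inside the disc; the second makes (card S - K) *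
      ln r exceed the bounded term D.\<close>
    obtain r where r: "r \<ge> max (r0 + 1) (exp (D / (real (card S) - K) + 1))" "pole_sum g r \<le> K * ln r"
      using slow by blast
    have r1: "r \<ge> 1" "\<And>a. a \<in> S \<Longrightarrow> cmod a < r"
    proof -
      have "1 \<le> r0" "\<And>a. a \<in> S \<Longrightarrow> cmod a \<le> r0" unfolding r0_def using S(2) by (auto intro!: Max_ge)
      then show "r \<ge> 1" "\<And>a. a \<in> S \<Longrightarrow> cmod a < r" using r by fastforce+
    qed
    have pm: "pole_mult g a \<ge> 1" if "a \<in> S" for a
      using that S(1) by (auto simp: pole_mult_def is_pole_iff_zorder_neg[OF g])
    have Sb: "S \<subseteq> bad_points g \<inter> ball 0 r"
      using S(1) r1 zorder_not_bad[of _ g] by (force simp: is_pole_iff_zorder_neg[OF g])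
    have "real (card S) * ln r - D = (\<Sum>a\<in>S. ln r - pole_mult g a * \<bar>ln (cmod a)\<bar>)"
      by (simp add: D_def sum_subtractf)
    also have "\<dots> \<le> (\<Sum>a\<in>S. pole_mult g a * (ln r - ln (cmod a)))"
    proof (rule sum_mono)
      fix a assume a: "a \<in> S"
      have "1 * ln r \<le> pole_mult g a * ln r" using pm[OF a] r1 by (intro mult_right_mono) auto
      moreover have "pole_mult g a * ln (cmod a) \<le> pole_mult g a * \<bar>ln (cmod a)\<bar>" by (intro mult_left_mono) auto
      ultimately show "ln r - pole_mult g a * \<bar>ln (cmod a)\<bar> \<le> pole_mult g a * (ln r - ln (cmod a))"
        by (simp add: right_diff_distrib)
    qed
    also have "\<dots> \<le> pole_sum g r"
      unfolding pole_sum_def using r1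
      by (intro sum_mono2 finite_bad_points_ball g Sb mult_nonneg_nonneg ln_radius_diff_nonneg) auto
    finally have "(real (card S) - K) * ln r \<le> D" using r by (simp add: left_diff_distrib)
    then have "ln r \<le> D / (real (card S) - K)" using cK by (simp add: field_simps)
    moreover have "ln (exp (D / (real (card S) - K) + 1)) \<le> ln r" using r by (intro ln_mono) auto
    ultimately show False by simp
  qed
  then show ?thesis using finite_if_finite_subsets_card_bdd[of "{z. is_pole g z}" "nat \<lceil>K\<rceil>"] by blast
qed

text \<open>A pole sum of order ln r leaves finitely many poles; clearing them with a polynomial
  gives an entire function whose proximity function is still O(ln r), hence a polynomial. The bound
  is assumed only on an unbounded set of radii, so the contrapositive gives a lower bound on all
  large good radii: ln r = o(T(r, f)) there for transcendental f. That absorbs the finitely many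
  zeros and every term C * ln r.\<close>

theorem slow_characteristic_imp_rational:
  assumes nice: "f nicely_meromorphic_on UNIV" and f: "nonzero_meromorphic f"
    and slow: "\<And>r0. \<exists>r\<ge>r0. good_radius f r \<and> char_sum f r \<le> K * ln r"
  shows "rational_function f"
proof -
  define P where "P = {z. is_pole f z}"
  have finP: "finite P"
    unfolding P_def
  proof (rule slow_pole_sum_imp_finite_poles[OF f, of K])
    fix r0
    obtain r where r: "r \<ge> max r0 1" "good_radius f r" "char_sum f r \<le> K * ln r" using slow by blast
    then show "\<exists>r\<ge>r0. pole_sum f r \<le> K * ln r" using char_sum_ge(2)[OF r(2)] by force
  qed
  define m where "m = (\<lambda>a. nat (- zorder f a))"
  define q where "q = (\<Prod>a\<in>P. [:-a, 1:] ^ m a)"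
  have mpos: "m a > 0" "int (m a) = - zorder f a" if "a \<in> P" for a
    using that by (auto simp: P_def m_def is_pole_iff_zorder_neg[OF f])
  have q0: "q \<noteq> 0" unfolding q_def using finP by simp
  have pq: "poly q z = (\<Prod>a\<in>P. (z - a) ^ m a)" for z by (simp add: q_def poly_prod poly_power)
  have qP: "poly q z = 0 \<longleftrightarrow> z \<in> P" for z
    unfolding pq using finP mpos by auto
  define g0 where "g0 = (\<lambda>z. f z * poly q z)"
  define g where "g = remove_sings g0"
  have q_an: "poly q analytic_on A" for A
  proof -
    have "poly q holomorphic_on UNIV"
      unfolding holomorphic_on_def field_differentiable_def by (blast intro: poly_DERIV)
    then have "poly q analytic_on UNIV" by (simp add: analytic_on_open)
    then show ?thesis by (rule analytic_on_subset) simp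
  qed
  have qmer: "nonzero_meromorphic (poly q)"
  proof -
    have "poly q meromorphic_on UNIV" by (rule analytic_on_imp_meromorphic_on[OF q_an])
    moreover have "finite {z. \<not> poly q z \<noteq> 0}" using poly_roots_finite[OF q0] by simp
    ultimately show ?thesis
      unfolding nonzero_meromorphic_def eventually_cosparse using finite_imp_sparse by blast
  qed
  have f_an: "f analytic_on {z}" if "z \<notin> P" for z
    using nicely_meromorphic_on_imp_analytic_at[OF nice] that by (auto simp: P_def)
  have g_eq: "g z = f z * poly q z" if "z \<notin> P" for z
    unfolding g_def using f_an[OF that] by (subst remove_sings_at_analytic) (auto intro!: analytic_on_mult q_an simp: g0_def)
  have g_an: "g analytic_on {z}" for z
  proof (cases "z \<in> P")
    case False
    then have "g0 analytic_on {z}" unfolding g0_def using f_an by (auto intro!: analytic_on_mult q_an)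
    then show ?thesis unfolding g_def by (rule remove_sings_analytic_on)
  next
    case True
    have "zorder (poly q) z = (\<Sum>a\<in>P. zorder (\<lambda>w. (w - a) ^ m a) z)"
      unfolding pq[abs_def]
      by (rule zorder_prod) (use nonzero_meromorphic_at(2)[OF qmer, of z] in \<open>auto intro!: meromorphic_intros simp: pq[abs_def]\<close>)
    also have "\<dots> = (\<Sum>a\<in>P. if a = z then int (m z) else 0)"
    proof (rule sum.cong)
      fix a assume "a \<in> P"
      show "zorder (\<lambda>w. (w - a) ^ m a) z = (if a = z then int (m z) else 0)"
      proof (cases "a = z")
        case True
        have "zorder (\<lambda>w. (w - a) ^ m a) z = int (m a)"
          by (rule zorder_eqI[of UNIV _ "\<lambda>_. 1"]) (use True in auto)
        then show ?thesis using True by simp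
      next
        case False
        then show ?thesis by (simp, intro zorder_eq_0I) (auto intro!: analytic_intros)
      qed
    qed simp
    also have "\<dots> = - zorder f z" using True finP mpos by simp
    finally have zq: "zorder (poly q) z = - zorder f z" .
    have "zorder g0 z = zorder f z + zorder (poly q) z"
      unfolding g0_def by (intro zorder_mult nonzero_meromorphic_at f qmer)
    then have "zorder g0 z = 0" using zq by simp
    moreover have "nonzero_meromorphic g0" unfolding g0_def by (rule nonzero_meromorphic_mult[OF f qmer])
    ultimately show ?thesis unfolding g_def using zorder_0_remove_sings(1) nonzero_meromorphic_at by blast
  qed
  have g_hol: "g holomorphic_on UNIV"
    by (rule analytic_imp_holomorphic, subst analytic_on_analytic_at) (use g_an in auto)
  have g_good: "good_radius g r" if "good_radius f r" for r
    unfolding good_radius_def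
  proof (intro conjI allI impI)
    show "r > 0" using that by (rule good_radius_pos)
    fix z assume z: "cmod z = r"
    then have zb: "z \<notin> bad_points f" using that by (auto simp: good_radius_def)
    then have "z \<notin> P" using zorder_not_bad[of z f] by (auto simp: P_def is_pole_iff_zorder_neg[OF f])
    then have "g z \<noteq> 0" using zb qP by (simp add: g_eq bad_points_def)
    then show "z \<notin> bad_points g" using g_an by (simp add: bad_points_def)
  qed
  have g_nz: "nonzero_meromorphic g"
  proof -
    have "eventually (\<lambda>z. g0 z \<noteq> 0 \<and> g z = g0 z) (at 0)"
      using nonzero_meromorphic_at(2)[OF nonzero_meromorphic_mult[OF f qmer], of 0]
        eventually_remove_sings_eq_at[of g0 0] nonzero_meromorphic_at(1)[OF nonzero_meromorphic_mult[OF f qmer], of 0]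
      unfolding g_def g0_def meromorphic_at_iff by (simp add: eventually_conj_iff)
    then have "eventually (\<lambda>z. g z \<noteq> 0) (at 0)" by eventually_elim auto
    moreover have "g meromorphic_on UNIV" using g_hol by (simp add: analytic_on_imp_meromorphic_on analytic_on_open)
    ultimately show ?thesis by (intro nonzero_meromorphicI[of _ 0] eventually_frequently) auto
  qed
  obtain C N where C: "C \<ge> 1" "\<And>z. cmod z \<ge> 1 \<Longrightarrow> cmod (poly q z) \<le> C * cmod z ^ N"
    using poly_norm_le_power[of q] by blast
  \<comment> \<open>exp (4 * m(r, g)) is at most C^4 r^(4 (|K| + N)), and N' rounds this exponent
    up. The bound holds for |z| <= r / 2 and is restated in powers of r / 2, hence the factor 2^N'
    below.\<close>
  define N' where "N' = nat \<lceil>4 * (\<bar>K\<bar> + real N)\<rceil>"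
  have "\<exists>p. \<forall>z. g z = poly p z"
  proof (rule entire_polynomial_growth_imp_poly[OF g_hol, where N = N' and B = "exp (4 * ln C) * 2 ^ N'"])
    fix r0 :: real
    obtain r where r: "r \<ge> max (2 * r0) 1" "good_radius f r" "char_sum f r \<le> K * ln r" using slow by blast
    have r1: "r \<ge> 1" "ln r \<ge> 0" "r > 0" using r by auto
    have "circle_prox g r \<le> circle_mean (\<lambda>z. log_plus (cmod (f z)) + (ln C + real N * ln r)) r"
    proof (rule circle_prox_mono[OF g_good[OF r(2)]])
      show "continuous_on (sphere 0 r) (\<lambda>z. log_plus (cmod (f z)) + (ln C + real N * ln r))"
        by (intro continuous_intros good_radius_continuous r)
      fix z assume z: "cmod z = r"
      then have zb: "z \<notin> bad_points f" using r(2) by (auto simp: good_radius_def)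
      then have "z \<notin> P" using zorder_not_bad[of z f] by (auto simp: P_def is_pole_iff_zorder_neg[OF f])
      then have "log_plus (cmod (g z)) \<le> log_plus (cmod (f z)) + log_plus (cmod (poly q z))"
        by (simp add: g_eq norm_mult log_plus_mult)
      also have "log_plus (cmod (poly q z)) \<le> log_plus (C * r ^ N)"
        using C(2)[of z] z r1 by (intro log_plus_mono) auto
      also have "\<dots> = ln C + real N * ln r"
      proof -
        have "C * r ^ N \<ge> 1 * 1" using C(1) r1 by (intro mult_mono one_le_power) auto
        then show ?thesis using C(1) r1 by (simp add: log_plus_def max_absorb2 ln_mult ln_realpow)
      qed
      finally show "log_plus (cmod (g z)) \<le> log_plus (cmod (f z)) + (ln C + real N * ln r)" by simp
    qed
    also have "\<dots> = circle_prox f r + (ln C + real N * ln r)"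
      unfolding circle_prox_def using r1 by (subst circle_mean_add) (auto intro!: continuous_intros good_radius_continuous r)
    also have "circle_prox f r \<le> K * ln r" using char_sum_ge(1)[OF r(2) r1(1)] r(3) by linarith
    also have "K * ln r \<le> \<bar>K\<bar> * ln r" using r1 by (intro mult_right_mono) auto
    finally have cg: "circle_prox g r \<le> ln C + (\<bar>K\<bar> + real N) * ln r" by (simp add: algebra_simps)
    have "cmod (g z) \<le> exp (4 * ln C) * 2 ^ N' * (r / 2) ^ N'" if z: "cmod z \<le> r / 2" for z
    proof -
      have "cmod (g z) \<le> exp (4 * circle_prox g r)"
        by (rule entire_norm_le_circle_prox[OF g_nz g_hol g_good[OF r(2)] z])
      also have "\<dots> \<le> exp (4 * ln C + real N' * ln r)"
      proof -
        have "4 * (\<bar>K\<bar> + real N) \<le> real N'" unfolding N'_def by linarith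
        then have "4 * (\<bar>K\<bar> + real N) * ln r \<le> real N' * ln r" using r1 by (intro mult_right_mono) auto
        then show ?thesis using cg by (simp add: algebra_simps)
      qed
      also have "\<dots> = exp (4 * ln C) * r ^ N'"
        using r1 by (simp add: exp_add exp_of_nat_mult)
      also have "r ^ N' = 2 ^ N' * (r / 2) ^ N'" by (simp add: power_divide)
      finally show ?thesis by simp
    qed
    then show "\<exists>r\<ge>r0. \<forall>z. cmod z \<le> r \<longrightarrow> cmod (g z) \<le> exp (4 * ln C) * 2 ^ N' * r ^ N'"
      using r by (intro exI[of _ "r / 2"]) auto
  qed
  then obtain p where p: "\<And>z. g z = poly p z" by blast
  have "f z = poly p z / poly q z" if "poly q z \<noteq> 0" for z
    using g_eq[of z] p[of z] qP[of z] that by (simp add: field_simps)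
  with q0 show ?thesis unfolding rational_function_def by blast
qed

section \<open>Estimates along a sequence of regular radii\<close>

definition leading_constant :: "(complex \<Rightarrow> complex) \<Rightarrow> real" where
  "leading_constant g = \<bar>ln (cmod (zor_poly g 0 0))\<bar>"

lemma leading_constant_nonneg [simp]: "leading_constant g \<ge> 0"
  by (simp add: leading_constant_def)

lemma char_sum_inverse_le:
  assumes "nonzero_meromorphic g" "good_radius g r"
  shows "char_sum (\<lambda>z. inverse (g z)) r \<le> char_sum g r + leading_constant g"
  using first_main_theorem[OF assms] by (simp add: leading_constant_def)

lemma prox_both_le:
  assumes "nonzero_meromorphic g" "good_radius g r" "r \<ge> 1"
  shows "circle_prox g r + circle_prox (\<lambda>z. inverse (g z)) r \<le> 2 * char_sum g r + leading_constant g"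
  using char_sum_inverse_le[OF assms(1,2)] char_sum_ge(1)[OF assms(2,3)]
    char_sum_ge(1)[OF good_radius_inverse[OF assms(2)] assms(3)] by linarith

text \<open>The source of the factor R / d in the error terms: ln R' - ln R is at least (R' - R) /
  R'.\<close>

lemma zero_pole_count_le_char:
  assumes "nonzero_meromorphic g" "good_radius g R'" "1 \<le> R" "R < R'"
  shows "zero_pole_count g R \<le> R' / (R' - R) * (2 * char_sum g R' + leading_constant g)"
proof -
  have "(R' - R) / R' \<le> ln R' - ln R"
  proof -
    have "ln (R / R') \<le> R / R' - 1" using assms by (intro ln_le_minus_one) auto
    then show ?thesis using assms by (simp add: ln_div diff_divide_distrib)
  qed
  then have "zero_pole_count g R * ((R' - R) / R') \<le> zero_pole_count g R * (ln R' - ln R)"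
    by (intro mult_left_mono) auto
  also have "\<dots> \<le> pole_sum g R' + pole_sum (\<lambda>z. inverse (g z)) R'"
    by (rule zero_pole_count_le[OF assms(1,3,4)])
  also have "\<dots> \<le> 2 * char_sum g R' + leading_constant g"
    using char_sum_inverse_le[OF assms(1,2)] char_sum_ge(2)[OF assms(2)]
      char_sum_ge(2)[OF good_radius_inverse[OF assms(2)]] assms(3,4) by fastforce
  finally show ?thesis using assms by (simp add: field_simps)
qed

text \<open>A non-integrable integrand has integral 0 by convention, so no good radius is required.
  This serves g' / g, which may vanish on the circle.\<close>

lemma circle_prox_nonneg_general: "circle_prox g r \<ge> 0"
proof (cases "(\<lambda>\<theta>. log_plus (cmod (g (rcis r \<theta>)))) integrable_on {0..2 * pi}")
  case True
  then show ?thesis unfolding circle_prox_def circle_mean_def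
    by (intro divide_nonneg_nonneg integral_nonneg) auto
qed (simp add: circle_prox_def circle_mean_def not_integrable_integral)

lemma pole_sum_mono:
  assumes "nonzero_meromorphic g" "1 \<le> r" "r \<le> R"
  shows "pole_sum g r \<le> pole_sum g R"
proof -
  have "pole_sum g r \<le> (\<Sum>a\<in>bad_points g \<inter> ball 0 r. pole_mult g a * (ln R - ln (cmod a)))"
    unfolding pole_sum_def using assms by (intro sum_mono mult_left_mono) auto
  also have "\<dots> \<le> pole_sum g R"
    unfolding pole_sum_def using assms
    by (intro sum_mono2 finite_bad_points_ball mult_nonneg_nonneg ln_radius_diff_nonneg) auto
  finally show ?thesis .
qed

lemma smallo_of_le:
  fixes u v :: "nat \<Rightarrow> real"
  assumes "v \<in> o(\<tau>)" "eventually (\<lambda>k. 0 \<le> u k \<and> u k \<le> v k) sequentially"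
  shows "u \<in> o(\<tau>)"
proof -
  have "u \<in> O(v)" by (rule bigoI[of _ 1]) (use assms(2) in \<open>auto elim!: eventually_mono\<close>)
  then show ?thesis using assms(1) by (rule landau_o.big_small_trans)
qed

lemma bigo_of_le:
  fixes u v :: "nat \<Rightarrow> real"
  assumes "v \<in> O(\<tau>)" "eventually (\<lambda>k. 0 \<le> u k \<and> u k \<le> v k) sequentially"
  shows "u \<in> O(\<tau>)"
proof -
  have "u \<in> O(v)" by (rule bigoI[of _ 1]) (use assms(2) in \<open>auto elim!: eventually_mono\<close>)
  then show ?thesis using assms(1) by (rule landau_o.big_trans)
qed

text \<open>Each estimate on a circle uses proximity functions one step d further out and, through
  the count of zeros and poles, the characteristic two steps further out. The logarithmic derivative
  of G on the first circle needs the characteristic of G on \<open>R 2\<close>, and that needs the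
  difference estimate on \<open>R 2\<close>; hence circles up to \<open>R 4\<close>.\<close>

locale regular_radii =
  fixes f :: "complex \<Rightarrow> complex" and \<eta> :: complex and x r d \<tau> :: "nat \<Rightarrow> real" and \<alpha> \<beta> K :: real
  assumes f: "nonzero_meromorphic f"
    and exponents: "0 < \<beta>" "\<beta> < 1" "1 - \<beta> < \<alpha>" "\<alpha> < 1"
    and x_lim: "filterlim x at_top sequentially"
    and d_def: "d = (\<lambda>k. x k powr \<beta>)"
    and r_range: "eventually (\<lambda>k. x k \<le> r k \<and> r k \<le> 2 * x k) sequentially"
    and \<tau>_def: "\<tau> = (\<lambda>k. char_sum f (r k))"
    and good_f: "eventually (\<lambda>k. \<forall>j\<le>4. good_radius f (r k + real j * d k) \<and>
      (\<forall>z. cmod z = r k + real j * d k \<longrightarrow> z + \<eta> \<notin> bad_points f)) sequentially"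
    and growth: "eventually (\<lambda>k. char_sum f (r k + 4 * d k) \<le> K * \<tau> k) sequentially"
    and ln_small: "(\<lambda>k. ln (x k)) \<in> o(\<tau>)"
begin

abbreviation R :: "nat \<Rightarrow> nat \<Rightarrow> real" where "R j k \<equiv> r k + real j * d k"

lemma d_lim: "filterlim d at_top sequentially"
proof -
  have "filterlim (\<lambda>k. \<beta> * ln (x k)) at_top sequentially"
    using exponents by (intro filterlim_tendsto_pos_mult_at_top[OF tendsto_const _ filterlim_compose[OF ln_at_top x_lim]]) auto
  then have "filterlim (\<lambda>k. exp (\<beta> * ln (x k))) at_top sequentially"
    by (rule filterlim_compose[OF exp_at_top])
  moreover have "eventually (\<lambda>k. exp (\<beta> * ln (x k)) = d k) sequentially"
    using x_lim unfolding filterlim_at_top d_def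
    by (auto simp: powr_def elim!: allE[of _ 1] eventually_mono)
  ultimately show ?thesis by (simp cong: filterlim_cong)
qed

text \<open>The constant 6 is 2 + 4: r is at most 2 x, and each of at most four steps d is at most
  x.\<close>

lemma ranges:
  "eventually (\<lambda>k. x k \<ge> 3 \<and> d k \<ge> 1 \<and> d k \<ge> 2 * cmod \<eta> + 1 \<and> d k \<le> x k \<and>
    (\<forall>j\<le>4. x k \<le> R j k \<and> R j k \<le> 6 * x k)) sequentially"
proof -
  have "eventually (\<lambda>k. x k \<ge> 3) sequentially" "eventually (\<lambda>k. d k \<ge> max 1 (2 * cmod \<eta> + 1)) sequentially"
    using x_lim d_lim by (auto simp: filterlim_at_top)
  with r_range show ?thesis
  proof eventually_elim
    case (elim k)
    have dx: "d k \<le> x k"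
      unfolding d_def using powr_mono[of \<beta> 1 "x k"] elim exponents by simp
    have "2 * cmod \<eta> + 1 \<le> d k" using elim by simp
    then have d1: "1 \<le> d k" using norm_ge_zero[of \<eta>] by linarith
    have "x k \<le> R j k \<and> R j k \<le> 6 * x k" if "j \<le> 4" for j
    proof -
      have "real j * d k \<le> 4 * x k" using that dx elim d1 by (intro mult_mono) auto
      moreover have "0 \<le> real j * d k" using d1 by simp
      ultimately show ?thesis using elim by linarith
    qed
    then show ?case using elim dx d1 by auto
  qed
qed

lemma \<tau>_at_top: "filterlim \<tau> at_top sequentially"
proof -
  have lx: "filterlim (\<lambda>k. ln (x k)) at_top sequentially"
    using filterlim_compose[OF ln_at_top x_lim] .
  have "eventually (\<lambda>k. norm (ln (x k)) \<le> 1 * norm (\<tau> k)) sequentially"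
    using landau_o.smallD[OF ln_small, of 1] by simp
  moreover have "eventually (\<lambda>k. \<tau> k \<ge> 0) sequentially"
    using good_f ranges
  proof eventually_elim
    case (elim k)
    then have "good_radius f (r k)" "r k \<ge> 1" by force+
    then show ?case unfolding \<tau>_def using char_sum_ge(3) by blast
  qed
  ultimately have "eventually (\<lambda>k. ln (x k) \<le> \<tau> k) sequentially"
    by eventually_elim auto
  then show ?thesis by (rule filterlim_at_top_mono[OF lx])
qed

lemma \<tau>_ge: "eventually (\<lambda>k. \<tau> k \<ge> c) sequentially"
  using \<tau>_at_top by (simp add: filterlim_at_top)

lemma const_small: "(\<lambda>k. c) \<in> o(\<tau>)"
proof (rule smalloI_tendsto)
  show "((\<lambda>k. c / \<tau> k) \<longlongrightarrow> 0) sequentially"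
    by (rule tendsto_divide_0[OF tendsto_const filterlim_at_top_imp_at_infinity[OF \<tau>_at_top]])
  show "eventually (\<lambda>k. \<tau> k \<noteq> 0) sequentially" using \<tau>_ge[of 1] by eventually_elim auto
qed

lemma ln_\<tau>_small: "(\<lambda>k. ln (\<tau> k)) \<in> o(\<tau>)"
proof (rule smalloI_tendsto)
  have "((\<lambda>t::real. ln t / t) \<longlongrightarrow> 0) at_top" by (rule ln_x_over_x_tendsto_0)
  from filterlim_compose[OF this \<tau>_at_top] show "((\<lambda>k. ln (\<tau> k) / \<tau> k) \<longlongrightarrow> 0) sequentially" .
  show "eventually (\<lambda>k. \<tau> k \<noteq> 0) sequentially" using \<tau>_ge[of 1] by eventually_elim auto
qed

lemma small_add: "u \<in> o(\<tau>) \<Longrightarrow> v \<in> o(\<tau>) \<Longrightarrow> (\<lambda>k. u k + v k) \<in> o(\<tau>)"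
  by (rule sum_in_smallo)

lemma small_cmult:
  fixes c :: real
  shows "u \<in> o(\<tau>) \<Longrightarrow> (\<lambda>k. c * u k) \<in> o(\<tau>)"
  by simp

lemma big_\<tau>:
  fixes a c :: real
  shows "(\<lambda>k. a * \<tau> k + c) \<in> O(\<tau>)"
proof -
  have "(\<lambda>k. a * \<tau> k) \<in> O(\<tau>)" by (rule bigoI[of _ "\<bar>a\<bar>"]) (auto simp: abs_mult)
  then show ?thesis by (rule sum_in_bigo(1)[OF _ landau_o.small_imp_big[OF const_small]])
qed

lemma null_mult_big:
  fixes c :: "nat \<Rightarrow> real"
  assumes "(c \<longlongrightarrow> 0) sequentially" "v \<in> O(\<tau>)"
  shows "(\<lambda>k. c k * v k) \<in> o(\<tau>)"
proof -
  have "c \<in> o(\<lambda>_. 1)" by (rule smalloI_tendsto) (use assms in auto)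
  from landau_o.small_big_mult[OF this assms(2)] show ?thesis by simp
qed

lemma good_f_at:
  assumes "j \<le> 4"
  shows "eventually (\<lambda>k. good_radius f (R j k)) sequentially"
  using good_f by eventually_elim (use assms in auto)

lemma char_f_le:
  assumes "j \<le> 4"
  shows "eventually (\<lambda>k. char_sum f (R j k) \<le> K * \<tau> k) sequentially"
  using good_f_at[OF assms] good_f_at[OF order_refl] growth ranges
proof eventually_elim
  case (elim k)
  have "real j * d k \<le> 4 * d k" using elim assms by (intro mult_right_mono) auto
  then have "char_sum f (R j k) \<le> char_sum f (r k + 4 * d k)" using elim by (intro char_sum_mono f) auto
  then show ?case using elim by linarith
qed

text \<open>Up to a constant this is x^(1 - \<beta> - \<alpha>), whose exponent is negative because
  1 - \<beta> < \<alpha>.\<close>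

lemma coefficient_null:
  assumes "i \<le> 4" "j \<le> 4"
  shows "((\<lambda>k. R j k / d k * R i k powr (-\<alpha>)) \<longlongrightarrow> 0) sequentially"
proof (rule tendsto_sandwich[where f = "\<lambda>_. 0" and h = "\<lambda>k. 6 * x k powr (1 - \<beta> - \<alpha>)"])
  have "((\<lambda>k. x k powr (1 - \<beta> - \<alpha>)) \<longlongrightarrow> 0) sequentially"
    using exponents by (intro tendsto_neg_powr x_lim) auto
  from tendsto_mult_left[OF this, of 6]
  show "((\<lambda>k. 6 * x k powr (1 - \<beta> - \<alpha>)) \<longlongrightarrow> 0) sequentially" by simp
  show "eventually (\<lambda>k. 0 \<le> R j k / d k * R i k powr (-\<alpha>)) sequentially"
    using ranges
  proof eventually_elim
    case (elim k)
    then have "R j k \<ge> x k" using assms by auto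
    then show ?case using elim by auto
  qed
  show "eventually (\<lambda>k. R j k / d k * R i k powr (-\<alpha>) \<le> 6 * x k powr (1 - \<beta> - \<alpha>)) sequentially"
    using ranges
  proof eventually_elim
    case (elim k)
    have "R j k / d k \<le> 6 * x k / d k" using elim assms by (intro divide_right_mono) auto
    moreover have "R i k powr (-\<alpha>) \<le> x k powr (-\<alpha>)" using elim assms exponents by (intro powr_mono2') auto
    ultimately have "R j k / d k * R i k powr (-\<alpha>) \<le> 6 * x k / d k * x k powr (-\<alpha>)"
      using elim by (intro mult_mono) auto
    also have "\<dots> = 6 * x k powr (1 - \<beta> - \<alpha>)"
    proof -
      have "6 * x k / d k * x k powr (-\<alpha>) = 6 * (x k powr 1 * x k powr (-\<beta>) * x k powr (-\<alpha>))"
        using elim by (simp add: d_def powr_minus[of _ \<beta>] divide_inverse)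
      also have "\<dots> = 6 * x k powr (1 - \<beta> - \<alpha>)"
        unfolding powr_add[symmetric] by simp
      finally show ?thesis .
    qed
    finally show ?case .
  qed
qed simp

text \<open>In \<open>difference_lemma\<close> the first coefficient is of order 1 / d. The second,
  once zeros and poles are counted by the characteristic one step further out, is of order (R / d)
  R^(-\<alpha>). Both tend to 0, and the characteristics they multiply are O(\<tau>).\<close>

lemma difference_small:
  assumes "i \<le> 2"
  shows "(\<lambda>k. circle_mean (\<lambda>z. \<bar>ln (cmod (f (z + \<eta>))) - ln (cmod (f z))\<bar>) (R i k)) \<in> o(\<tau>)"
proof -
  have i: "i \<le> 4" "i + 1 \<le> 4" "i + 2 \<le> 4" using assms by auto
  define e where "e = cmod \<eta>"
  define c where "c = leading_constant f"
  have \<alpha>: "0 < \<alpha>" "\<alpha> < 1" using exponents by auto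
  obtain C where C: "C > 0" "\<And>g r R. nonzero_meromorphic g \<Longrightarrow> good_radius g r \<Longrightarrow> cmod \<eta> < r \<Longrightarrow>
    (\<And>z. cmod z = r \<Longrightarrow> z + \<eta> \<notin> bad_points g) \<Longrightarrow> good_radius g R \<Longrightarrow> r + cmod \<eta> < R \<Longrightarrow> 2 * cmod \<eta> \<le> R \<Longrightarrow>
    circle_mean (\<lambda>z. \<bar>ln (cmod (g (z + \<eta>))) - ln (cmod (g z))\<bar>) r
      \<le> 4 * cmod \<eta> / (R - cmod \<eta> - r) * (circle_prox g R + circle_prox (\<lambda>z. inverse (g z)) R)
        + zero_pole_count g R * (C * r powr (-\<alpha>))"
    using difference_lemma[OF \<alpha>, of \<eta>] by blast
  define coef where "coef = (\<lambda>k. 4 * e / (d k - e) + C * (R (i + 2) k / d k * R i k powr (-\<alpha>)))"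
  have "(coef \<longlongrightarrow> 0 + C * 0) sequentially"
    unfolding coef_def
  proof (intro tendsto_add tendsto_mult tendsto_const coefficient_null)
    have "filterlim (\<lambda>k. d k + (- e)) at_top sequentially"
      using filterlim_tendsto_add_at_top[OF tendsto_const d_lim, of "- e"] by (simp add: add.commute)
    then show "((\<lambda>k. 4 * e / (d k - e)) \<longlongrightarrow> 0) sequentially"
      by (intro tendsto_divide_0[OF tendsto_const] filterlim_at_top_imp_at_infinity) simp
  qed (use i in auto)
  then have coef: "(coef \<longlongrightarrow> 0) sequentially" by simp
  have main: "(\<lambda>k. coef k * ((2 * K) * \<tau> k + c)) \<in> o(\<tau>)" by (rule null_mult_big[OF coef big_\<tau>])
  show ?thesis
  proof (rule smallo_of_le[OF main])
    show "eventually (\<lambda>k. 0 \<le> circle_mean (\<lambda>z. \<bar>ln (cmod (f (z + \<eta>))) - ln (cmod (f z))\<bar>) (R i k) \<and>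
      circle_mean (\<lambda>z. \<bar>ln (cmod (f (z + \<eta>))) - ln (cmod (f z))\<bar>) (R i k) \<le> coef k * (2 * K * \<tau> k + c)) sequentially"
      using good_f ranges char_f_le[OF i(2)] char_f_le[OF i(3)]
    proof eventually_elim
      case (elim k)
      define r0 r1 r2 where "r0 = R i k" and "r1 = R (i + 1) k" and "r2 = R (i + 2) k"
      have steps: "r1 = r0 + d k" "r2 = r1 + d k" by (simp_all add: r0_def r1_def r2_def algebra_simps)
      have good: "good_radius f r0" "good_radius f r1" "good_radius f r2"
        and shift: "\<And>z. cmod z = r0 \<Longrightarrow> z + \<eta> \<notin> bad_points f"
        using elim(1)[THEN spec, THEN mp, OF i(1)] elim(1)[THEN spec, THEN mp, OF i(2)]
          elim(1)[THEN spec, THEN mp, OF i(3)] unfolding r0_def r1_def r2_def by blast+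
      have rg: "3 \<le> x k" "x k \<le> r0" "2 * e + 1 \<le> d k" "d k \<le> x k" using elim(2) i unfolding r0_def e_def by auto
      have e0: "e \<ge> 0" by (simp add: e_def)
      have T: "char_sum f r1 \<le> K * \<tau> k" "char_sum f r2 \<le> K * \<tau> k"
        using elim(3,4) unfolding r1_def r2_def by auto
      define A where "A = circle_prox f r1 + circle_prox (\<lambda>z. inverse (f z)) r1"
      have A: "A \<le> 2 * K * \<tau> k + c"
        using prox_both_le[OF f good(2)] T rg steps e0 unfolding A_def c_def by linarith
      have n: "zero_pole_count f r1 \<le> r2 / d k * (2 * K * \<tau> k + c)"
      proof -
        have "zero_pole_count f r1 \<le> r2 / (r2 - r1) * (2 * char_sum f r2 + c)"
          unfolding c_def by (rule zero_pole_count_le_char[OF f good(3)]) (use rg steps e0 in auto)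
        also have "\<dots> \<le> r2 / (r2 - r1) * (2 * K * \<tau> k + c)"
          using T rg steps e0 by (intro mult_left_mono) auto
        finally show ?thesis by (simp add: steps)
      qed
      have "circle_mean (\<lambda>z. \<bar>ln (cmod (f (z + \<eta>))) - ln (cmod (f z))\<bar>) r0
        \<le> 4 * e / (r1 - e - r0) * A + zero_pole_count f r1 * (C * r0 powr (-\<alpha>))"
        unfolding A_def e_def
        by (rule C(2)[OF f good(1) _ shift good(2)]; (unfold e_def[symmetric])?; (use rg steps e0 in linarith)?)
      also have "\<dots> \<le> 4 * e / (r1 - e - r0) * (2 * K * \<tau> k + c) + r2 / d k * (2 * K * \<tau> k + c) * (C * r0 powr (-\<alpha>))"
        using A n C(1) e0 rg steps by (intro add_mono mult_left_mono mult_right_mono) auto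
      also have "\<dots> = coef k * (2 * K * \<tau> k + c)"
      proof -
        have "r1 - e - r0 = d k - e" by (simp add: steps)
        moreover have "a * X + b * X * (C * p) = (a + C * (b * p)) * X" for a b p X :: real
          by (simp add: algebra_simps)
        ultimately show ?thesis unfolding coef_def r0_def[symmetric] r2_def[symmetric] by (simp only:)
      qed
      finally have "circle_mean (\<lambda>z. \<bar>ln (cmod (f (z + \<eta>))) - ln (cmod (f z))\<bar>) r0 \<le> coef k * (2 * K * \<tau> k + c)" .
      moreover have "0 \<le> circle_mean (\<lambda>z. \<bar>ln (cmod (f (z + \<eta>))) - ln (cmod (f z))\<bar>) r0"
        using good(1) good_radius_shift[OF _ shift]
        by (intro circle_mean_nonneg continuous_on_rabs continuous_on_diff good_radius_continuous_ln)
           (auto simp: good_radius_def)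
      ultimately show ?case unfolding r0_def by simp
    qed
  qed
qed

text \<open>All terms except the one with r^(-\<alpha>) stand under log^+ and are only O(ln x + ln
  \<tau> + 1); the remaining one is handled by \<open>coefficient_null\<close>.\<close>

lemma log_derivative_small:
  assumes g: "nonzero_meromorphic g"
    and good: "eventually (\<lambda>k. good_radius g (R 0 k) \<and> good_radius g (R 1 k) \<and> good_radius g (R 2 k)) sequentially"
    and big: "(\<lambda>k. char_sum g (R 2 k)) \<in> O(\<tau>)"
  shows "(\<lambda>k. circle_prox (\<lambda>z. deriv g z / g z) (r k)) \<in> o(\<tau>)"
proof -
  have \<alpha>: "0 < \<alpha>" "\<alpha> < 1" using exponents by auto
  obtain C where C: "C > 0" "\<And>g r R. nonzero_meromorphic g \<Longrightarrow> good_radius g r \<Longrightarrow> good_radius g R \<Longrightarrow> r + 1 \<le> R \<Longrightarrow>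
    circle_prox (\<lambda>z. deriv g z / g z) r
      \<le> log_plus (8 * R * (circle_prox g R + circle_prox (\<lambda>z. inverse (g z)) R)) + log_plus (4 * zero_pole_count g R)
         + 2 * ln 2 + zero_pole_count g R * (C * r powr (-\<alpha>))"
    using log_derivative_lemma[OF \<alpha>] by blast
  define c where "c = leading_constant g"
  have c0: "c \<ge> 0" by (simp add: c_def)
  obtain B where B: "B > 0" "eventually (\<lambda>k. norm (char_sum g (R 2 k)) \<le> B * norm (\<tau> k)) sequentially"
    using landau_o.bigE[OF big] by blast
  define coef where "coef = (\<lambda>k. C * (R 2 k / d k * R 0 k powr (-\<alpha>)))"
  have "(coef \<longlongrightarrow> C * 0) sequentially"
    unfolding coef_def by (intro tendsto_mult tendsto_const coefficient_null) auto
  then have coef: "(coef \<longlongrightarrow> 0) sequentially" by simp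
  have s1: "(\<lambda>k. coef k * ((2 * B) * \<tau> k + c)) \<in> o(\<tau>)" by (rule null_mult_big[OF coef big_\<tau>])
  \<comment> \<open>For \<tau> >= 1 the bound 2 B \<tau> + c is at most D \<tau>. With radii at most
    6 x the arguments of log^+ become 48 D x \<tau> and 24 D x \<tau>.\<close>
  define D where "D = 2 * B + c + 1"
  have D: "D \<ge> 1" using B c0 by (simp add: D_def)
  define v where "v = (\<lambda>k. 2 * (ln (x k) + ln (\<tau> k)) + ln (48 * D) + ln (24 * D) + 2 * ln 2 + coef k * ((2 * B) * \<tau> k + c))"
  have "v \<in> o(\<tau>)"
    unfolding v_def by (intro small_add small_cmult ln_small ln_\<tau>_small const_small s1)
  then show ?thesis
  proof (rule smallo_of_le)
    show "eventually (\<lambda>k. 0 \<le> circle_prox (\<lambda>z. deriv g z / g z) (r k) \<and> circle_prox (\<lambda>z. deriv g z / g z) (r k) \<le> v k) sequentially"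
      using good ranges B(2) \<tau>_ge[of 1]
    proof eventually_elim
      case (elim k)
      define r0 r1 r2 where "r0 = R 0 k" and "r1 = R 1 k" and "r2 = R 2 k"
      have steps: "r1 = r0 + d k" "r2 = r1 + d k" "r0 = r k" by (simp_all add: r0_def r1_def r2_def)
      have gd: "good_radius g r0" "good_radius g r1" "good_radius g r2"
        using elim(1) unfolding r0_def r1_def r2_def by auto
      have rg: "3 \<le> x k" "x k \<le> r0" "1 \<le> d k"
        using elim(2) unfolding r0_def by auto
      have r12: "r1 \<le> 6 * x k" "r2 \<le> 6 * x k"
      proof -
        have "\<forall>j\<le>4. R j k \<le> 6 * x k" using elim(2) by blast
        from this[rule_format, of 1] this[rule_format, of 2]
        show "r1 \<le> 6 * x k" "r2 \<le> 6 * x k" unfolding r1_def r2_def by auto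
      qed
      have \<tau>1: "\<tau> k \<ge> 1" by fact
      have T2: "char_sum g r2 \<le> B * \<tau> k" using elim(3) \<tau>1 unfolding r2_def by simp
      have T1: "char_sum g r1 \<le> B * \<tau> k"
        using char_sum_mono[OF g gd(2,3)] T2 steps rg by simp
      define A where "A = circle_prox g r1 + circle_prox (\<lambda>z. inverse (g z)) r1"
      have A: "A \<le> 2 * B * \<tau> k + c"
        using prox_both_le[OF g gd(2)] T1 rg steps unfolding A_def c_def by linarith
      have A0: "A \<ge> 0" unfolding A_def using circle_prox_nonneg[OF gd(2)] circle_prox_nonneg[OF good_radius_inverse[OF gd(2)]] by simp
      define N where "N = zero_pole_count g r1"
      have N0: "N \<ge> 0" by (simp add: N_def)
      have N: "N \<le> r2 / d k * (2 * B * \<tau> k + c)"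
      proof -
        have "N \<le> r2 / (r2 - r1) * (2 * char_sum g r2 + c)"
          unfolding c_def N_def by (rule zero_pole_count_le_char[OF g gd(3)]) (use rg steps in auto)
        also have "\<dots> \<le> r2 / (r2 - r1) * (2 * B * \<tau> k + c)"
          using T2 rg steps by (intro mult_left_mono) auto
        finally show ?thesis by (simp add: steps)
      qed
      have X: "2 * B * \<tau> k + c \<le> D * \<tau> k"
        using \<tau>1 c0 mult_left_mono[of 1 "\<tau> k" c] by (simp add: D_def algebra_simps)
      have X0: "2 * B * \<tau> k + c \<ge> 0" using B(1) \<tau>1 c0 by simp
      have lp: "log_plus y \<le> ln (a * D) + (ln (x k) + ln (\<tau> k))" if "y \<le> a * D * (x k * \<tau> k)" "a * D * (x k * \<tau> k) \<ge> 1" "a > 0" for y a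
      proof -
        have "log_plus y \<le> ln (a * D * (x k * \<tau> k))"
          unfolding log_plus_def using that by (intro ln_mono) auto
        also have "\<dots> = ln (a * D) + (ln (x k) + ln (\<tau> k))"
          using that D rg \<tau>1 by (simp add: ln_mult)
        finally show ?thesis .
      qed
      have x\<tau>: "x k * \<tau> k \<ge> 1" using mult_mono[of 1 "x k" 1 "\<tau> k"] rg \<tau>1 by simp
      have ge1: "a * D * (x k * \<tau> k) \<ge> 1" if "a \<ge> 1" for a
        using mult_mono[of 1 "a * D" 1 "x k * \<tau> k"] mult_mono[of 1 a 1 D] that D x\<tau> by simp
      have "8 * r1 * A \<le> 8 * (6 * x k) * (D * \<tau> k)"
        using r12 A A0 X rg steps by (intro mult_mono) auto
      then have l1: "log_plus (8 * r1 * A) \<le> ln (48 * D) + (ln (x k) + ln (\<tau> k))"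
        by (intro lp ge1) (auto simp: mult_ac)
      have "r2 / d k \<le> 6 * x k / 1" using r12 rg by (intro frac_le) auto
      then have "r2 / d k * (2 * B * \<tau> k + c) \<le> 6 * x k * (D * \<tau> k)"
        using X X0 rg by (intro mult_mono) auto
      then have "4 * N \<le> 24 * D * (x k * \<tau> k)" using N by (simp add: mult_ac)
      then have l2: "log_plus (4 * N) \<le> ln (24 * D) + (ln (x k) + ln (\<tau> k))"
        by (intro lp ge1) auto
      have "N * (C * r0 powr (-\<alpha>)) \<le> r2 / d k * (2 * B * \<tau> k + c) * (C * r0 powr (-\<alpha>))"
        using N C(1) by (intro mult_right_mono) auto
      also have "\<dots> = coef k * (2 * B * \<tau> k + c)"
        unfolding coef_def r0_def[symmetric] r2_def[symmetric] by (simp add: mult_ac)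
      finally have l3: "N * (C * r0 powr (-\<alpha>)) \<le> coef k * (2 * B * \<tau> k + c)" .
      have "circle_prox (\<lambda>z. deriv g z / g z) r0
        \<le> log_plus (8 * r1 * A) + log_plus (4 * N) + 2 * ln 2 + N * (C * r0 powr (-\<alpha>))"
        unfolding A_def N_def by (rule C(2)[OF g gd(1,2)]) (use steps rg in auto)
      also have "\<dots> \<le> v k"
      proof -
        have "a + b + u + c \<le> 2 * q + p + s + u + t" if "a \<le> p + q" "b \<le> s + q" "c \<le> t" for a b c p q s t u :: real
          using that by simp
        from this[OF l1 l2 l3] show ?thesis unfolding v_def .
      qed
      finally show ?case using circle_prox_nonneg_general steps by simp
    qed
  qed
qed

text \<open>Needed only so that the logarithmic derivative estimate applies to G, so the order of
  magnitude is enough: poles are shifted with \<epsilon> = 1, and the proximity function changes by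
  at most the mean difference of logarithms.\<close>

lemma shifted_char_big: "(\<lambda>k. char_sum (\<lambda>z. f (z + \<eta>)) (R 2 k)) \<in> O(\<tau>)"
proof -
  define D where "D = (\<lambda>k. circle_mean (\<lambda>z. \<bar>ln (cmod (f (z + \<eta>))) - ln (cmod (f z))\<bar>) (R 2 k))"
  have D: "D \<in> o(\<tau>)" unfolding D_def by (rule difference_small) simp
  obtain C where C: "C \<ge> 0" "\<And>r. r \<ge> 3 \<Longrightarrow> pole_sum (\<lambda>z. f (z + \<eta>)) r \<le> (1 + 1) * pole_sum f (r + cmod \<eta>) + C * ln r"
    using pole_sum_shift_le[OF f, of 1 \<eta>] by auto
  have "(\<lambda>k. (3 * K) * \<tau> k + (D k + C * (ln 6 + ln (x k)))) \<in> O(\<tau>)"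
  proof (rule sum_in_bigo(1))
    show "(\<lambda>k. (3 * K) * \<tau> k) \<in> O(\<tau>)" using big_\<tau>[of "3 * K" 0] by simp
    show "(\<lambda>k. D k + C * (ln 6 + ln (x k))) \<in> O(\<tau>)"
      by (intro landau_o.small_imp_big small_add small_cmult D const_small ln_small)
  qed
  then show ?thesis
  proof (rule bigo_of_le)
    show "eventually (\<lambda>k. 0 \<le> char_sum (\<lambda>z. f (z + \<eta>)) (R 2 k) \<and>
      char_sum (\<lambda>z. f (z + \<eta>)) (R 2 k) \<le> (3 * K) * \<tau> k + (D k + C * (ln 6 + ln (x k)))) sequentially"
      using good_f ranges char_f_le[of 2, simplified] char_f_le[of 3, simplified]
    proof eventually_elim
      case (elim k)
      define r2 r3 where "r2 = R 2 k" and "r3 = R 3 k"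
      have steps: "r3 = r2 + d k" by (simp add: r2_def r3_def)
      have gd: "good_radius f r2" "good_radius f r3" "\<And>z. cmod z = r2 \<Longrightarrow> z + \<eta> \<notin> bad_points f"
      proof -
        have "(2::nat) \<le> 4" "(3::nat) \<le> 4" by auto
        from elim(1)[THEN spec, THEN mp, OF this(1)] elim(1)[THEN spec, THEN mp, OF this(2)]
        show "good_radius f r2" "good_radius f r3" "\<And>z. cmod z = r2 \<Longrightarrow> z + \<eta> \<notin> bad_points f"
          unfolding r2_def r3_def by blast+
      qed
      have r2: "3 \<le> x k" "x k \<le> r2" "r2 \<le> 6 * x k" "2 * cmod \<eta> + 1 \<le> d k"
      proof -
        have "\<forall>j\<le>4. x k \<le> R j k \<and> R j k \<le> 6 * x k" using elim(2) by blast
        from this[rule_format, of 2] elim(2) show "3 \<le> x k" "x k \<le> r2" "r2 \<le> 6 * x k" "2 * cmod \<eta> + 1 \<le> d k"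
          unfolding r2_def by auto
      qed
      have gs: "good_radius (\<lambda>z. f (z + \<eta>)) r2" using gd r2 by (intro good_radius_shift) auto
      have T: "char_sum f r2 \<le> K * \<tau> k" "char_sum f r3 \<le> K * \<tau> k" using elim(3,4) by (simp_all add: r2_def r3_def)
      have c: "continuous_on (sphere 0 r2) (\<lambda>z. log_plus (cmod (f z)))"
        "continuous_on (sphere 0 r2) (\<lambda>z. \<bar>ln (cmod (f (z + \<eta>))) - ln (cmod (f z))\<bar>)"
        using gd gs by (auto intro!: good_radius_continuous_log_plus continuous_on_rabs continuous_on_diff good_radius_continuous_ln)
      have "circle_prox (\<lambda>z. f (z + \<eta>)) r2 \<le> circle_mean (\<lambda>z. log_plus (cmod (f z)) + \<bar>ln (cmod (f (z + \<eta>))) - ln (cmod (f z))\<bar>) r2"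
      proof (rule circle_prox_mono[OF gs continuous_on_add[OF c]])
        fix z assume z: "cmod z = r2"
        have "f (z + \<eta>) \<noteq> 0" "f z \<noteq> 0" using good_radius_nonzero[OF gs z] good_radius_nonzero[OF gd(1) z] by auto
        then show "log_plus (cmod (f (z + \<eta>))) \<le> log_plus (cmod (f z)) + \<bar>ln (cmod (f (z + \<eta>))) - ln (cmod (f z))\<bar>"
          using ln_le_log_plus[of "cmod (f z)"] log_plus_nonneg[of "cmod (f z)"]
          by (auto simp: log_plus_def max_def)
      qed
      also have "\<dots> = circle_prox f r2 + D k"
        using r2 c by (subst circle_mean_add) (auto simp: circle_prox_def D_def r2_def)
      finally have p: "circle_prox (\<lambda>z. f (z + \<eta>)) r2 \<le> K * \<tau> k + D k"
        using char_sum_ge(1)[OF gd(1)] T r2 by simp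
      have "pole_sum f (r2 + cmod \<eta>) \<le> pole_sum f r3"
        using r2 steps norm_ge_zero[of \<eta>] by (intro pole_sum_mono f) linarith+
      moreover have "1 \<le> r3" using r2 steps norm_ge_zero[of \<eta>] by linarith
      ultimately have "pole_sum f (r2 + cmod \<eta>) \<le> K * \<tau> k" using char_sum_ge(2)[OF gd(2)] T(2) by linarith
      moreover have "C * ln r2 \<le> C * (ln 6 + ln (x k))"
      proof (rule mult_left_mono[OF _ C(1)])
        have "ln r2 \<le> ln (6 * x k)" using r2 by (intro ln_mono) auto
        then show "ln r2 \<le> ln 6 + ln (x k)" using r2 by (simp add: ln_mult)
      qed
      moreover have "pole_sum (\<lambda>z. f (z + \<eta>)) r2 \<le> (1 + 1) * pole_sum f (r2 + cmod \<eta>) + C * ln r2"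
        using r2 by (intro C) auto
      ultimately have "char_sum (\<lambda>z. f (z + \<eta>)) r2 \<le> 3 * K * \<tau> k + (D k + C * (ln 6 + ln (x k)))"
        using p by (simp add: char_sum_def)
      moreover have "0 \<le> char_sum (\<lambda>z. f (z + \<eta>)) r2" using char_sum_ge(3)[OF gs] r2 by simp
      ultimately show ?case unfolding r2_def by simp
    qed
  qed
qed

end

section \<open>Comparison of f with G, and the zeros of f and its shift\<close>

context regular_radii
begin

text \<open>f^(n + 1) = G * s * (f / f(z + \<eta>)), and log^+ of the last factor is at most the
  absolute difference of logarithms, whose mean is small.\<close>

lemma prox_f_le_prox_G:
  fixes s :: "complex \<Rightarrow> complex" and n :: nat
  assumes s: "eventually (\<lambda>k. good_radius s (r k)) sequentially" "(\<lambda>k. circle_prox s (r k)) \<in> o(\<tau>)"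
  defines "G \<equiv> \<lambda>z. f z ^ n * f (z + \<eta>) * inverse (s z)"
  shows "\<exists>err\<in>o(\<tau>). eventually (\<lambda>k. (real n + 1) * circle_prox f (r k) \<le> circle_prox G (r k) + err k) sequentially"
proof -
  define D where "D = (\<lambda>k. circle_mean (\<lambda>z. \<bar>ln (cmod (f (z + \<eta>))) - ln (cmod (f z))\<bar>) (r k))"
  have D: "D \<in> o(\<tau>)" unfolding D_def using difference_small[of 0] by simp
  show ?thesis
  proof (rule bexI[of _ "\<lambda>k. circle_prox s (r k) + D k"])
    show "(\<lambda>k. circle_prox s (r k) + D k) \<in> o(\<tau>)" by (rule small_add[OF s(2) D])
    show "eventually (\<lambda>k. (real n + 1) * circle_prox f (r k) \<le> circle_prox G (r k) + (circle_prox s (r k) + D k)) sequentially"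
      using good_f s(1)
    proof eventually_elim
      case (elim k)
      define \<rho> where "\<rho> = r k"
      have gd: "good_radius f \<rho>" "\<And>z. cmod z = \<rho> \<Longrightarrow> z + \<eta> \<notin> bad_points f" "good_radius s \<rho>"
        using elim(1)[THEN spec[of _ 0]] elim(2) unfolding \<rho>_def by auto
      have \<rho>: "\<rho> > 0" using gd(1) by (rule good_radius_pos)
      have gs: "good_radius (\<lambda>z. f (z + \<eta>)) \<rho>" by (rule good_radius_shift[OF \<rho> gd(2)])
      have gG: "good_radius G \<rho>"
        unfolding G_def by (intro good_radius_mult good_radius_power good_radius_inverse gd gs)
      have c: "continuous_on (sphere 0 \<rho>) (\<lambda>z. log_plus (cmod (G z)))" "continuous_on (sphere 0 \<rho>) (\<lambda>z. log_plus (cmod (s z)))"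
        "continuous_on (sphere 0 \<rho>) (\<lambda>z. \<bar>ln (cmod (f (z + \<eta>))) - ln (cmod (f z))\<bar>)"
        using gd gs gG by (auto intro!: good_radius_continuous_log_plus continuous_on_rabs continuous_on_diff good_radius_continuous_ln)
      have "(real n + 1) * circle_prox f \<rho> = circle_prox (\<lambda>z. f z ^ Suc n) \<rho>"
        unfolding circle_prox_power by simp
      also have "\<dots> \<le> circle_mean (\<lambda>z. log_plus (cmod (G z)) + (log_plus (cmod (s z)) + \<bar>ln (cmod (f (z + \<eta>))) - ln (cmod (f z))\<bar>)) \<rho>"
      proof (rule circle_prox_mono[OF good_radius_power[OF gd(1)] continuous_on_add[OF c(1) continuous_on_add[OF c(2,3)]]])
        fix z assume z: "cmod z = \<rho>"
        have nz: "f (z + \<eta>) \<noteq> 0" "f z \<noteq> 0" "s z \<noteq> 0"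
          using good_radius_nonzero[OF gs z] good_radius_nonzero[OF gd(1) z] good_radius_nonzero[OF gd(3) z] by auto
        have "f z ^ Suc n = G z * (s z * (f z / f (z + \<eta>)))" using nz by (simp add: G_def)
        then have "log_plus (cmod (f z ^ Suc n)) = log_plus (cmod (G z) * (cmod (s z) * cmod (f z / f (z + \<eta>))))"
          by (simp only: norm_mult)
        also have "\<dots> \<le> log_plus (cmod (G z)) + log_plus (cmod (s z) * cmod (f z / f (z + \<eta>)))"
          by (rule log_plus_mult) auto
        also have "log_plus (cmod (s z) * cmod (f z / f (z + \<eta>))) \<le> log_plus (cmod (s z)) + log_plus (cmod (f z / f (z + \<eta>)))"
          by (rule log_plus_mult) auto
        also have "log_plus (cmod (f z / f (z + \<eta>))) \<le> \<bar>ln (cmod (f z / f (z + \<eta>)))\<bar>"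
        proof -
          have "cmod (f z / f (z + \<eta>)) > 0" using nz by simp
          from log_plus_add_inverse[OF this] show ?thesis
            using log_plus_nonneg[of "inverse (cmod (f z / f (z + \<eta>)))"] by linarith
        qed
        also have "\<dots> = \<bar>ln (cmod (f (z + \<eta>))) - ln (cmod (f z))\<bar>" using nz by (simp add: norm_divide ln_div abs_minus_commute)
        finally show "log_plus (cmod (f z ^ Suc n)) \<le> log_plus (cmod (G z)) + (log_plus (cmod (s z)) + \<bar>ln (cmod (f (z + \<eta>))) - ln (cmod (f z))\<bar>)"
          by simp
      qed
      also have "\<dots> = circle_prox G \<rho> + (circle_prox s \<rho> + D k)"
        using \<rho> circle_mean_add[OF c(1) continuous_on_add[OF c(2,3)]] circle_mean_add[OF c(2,3)]
        by (simp add: circle_prox_def D_def \<rho>_def)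
      finally show ?case unfolding \<rho>_def .
    qed
  qed
qed

text \<open>By the first main theorem each zero count is at most T up to a constant. The shift moves
  the second count to a radius at most r + d, where T is at most K * \<tau>; for K and 1 +
  \<epsilon> near 1 the total is near 2 * \<tau>.\<close>

lemma zeros_f_le:
  assumes "\<epsilon> > 0"
  shows "\<exists>err\<in>o(\<tau>). eventually (\<lambda>k. pole_sum (\<lambda>z. inverse (f z)) (r k) + pole_sum (\<lambda>z. inverse (f (z + \<eta>))) (r k)
    \<le> (1 + (1 + \<epsilon>) * K) * \<tau> k + err k) sequentially"
proof -
  have fi: "nonzero_meromorphic (\<lambda>z. inverse (f z))" by (rule nonzero_meromorphic_inverse[OF f])
  define c where "c = leading_constant f"
  obtain C where C: "C \<ge> 0" "\<And>r. r \<ge> 3 \<Longrightarrow> pole_sum (\<lambda>z. inverse (f (z + \<eta>))) r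
      \<le> (1 + \<epsilon>) * pole_sum (\<lambda>z. inverse (f z)) (r + cmod \<eta>) + C * ln r"
    using pole_sum_shift_le[OF fi assms, of \<eta>] by auto
  define err where "err = (\<lambda>k. c + (1 + \<epsilon>) * c + C * (ln 6 + ln (x k)))"
  have "err \<in> o(\<tau>)" unfolding err_def by (intro small_add small_cmult const_small ln_small)
  moreover have "eventually (\<lambda>k. pole_sum (\<lambda>z. inverse (f z)) (r k) + pole_sum (\<lambda>z. inverse (f (z + \<eta>))) (r k)
    \<le> (1 + (1 + \<epsilon>) * K) * \<tau> k + err k) sequentially"
    using good_f_at[of 0, simplified] good_f_at[of 1, simplified] ranges char_f_le[of 1, simplified]
  proof eventually_elim
    case (elim k)
    define r0 r1 where "r0 = r k" and "r1 = r k + d k"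
    have "\<forall>j\<le>4. x k \<le> R j k \<and> R j k \<le> 6 * x k" using elim(3) by blast
    from this[THEN spec, of 0] have rg: "x k \<le> r0" "r0 \<le> 6 * x k" by (auto simp: r0_def)
    have rg': "3 \<le> x k" "r1 = r0 + d k" "cmod \<eta> \<le> d k" "0 \<le> cmod \<eta>"
    proof -
      have "2 * cmod \<eta> + 1 \<le> d k" "0 \<le> cmod \<eta>" using elim(3) by auto
      then show "cmod \<eta> \<le> d k" "0 \<le> cmod \<eta>" by linarith+
    qed (use elim(3) in \<open>auto simp: r0_def r1_def\<close>)
    have r3: "r0 \<ge> 3" "r1 \<ge> 3" using rg rg' by linarith+
    have gd: "good_radius f r0" "good_radius f r1" using elim(1,2) by (auto simp: r0_def r1_def)
    have N: "pole_sum (\<lambda>z. inverse (f z)) \<rho> \<le> char_sum f \<rho> + c" if "good_radius f \<rho>" "\<rho> \<ge> 3" for \<rho>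
      using char_sum_inverse_le[OF f that(1)] char_sum_ge(2)[OF good_radius_inverse[OF that(1)]] that(2) by (simp add: c_def)
    have "pole_sum (\<lambda>z. inverse (f (z + \<eta>))) r0 \<le> (1 + \<epsilon>) * pole_sum (\<lambda>z. inverse (f z)) (r0 + cmod \<eta>) + C * ln r0"
      by (rule C(2)[OF r3(1)])
    also have "pole_sum (\<lambda>z. inverse (f z)) (r0 + cmod \<eta>) \<le> pole_sum (\<lambda>z. inverse (f z)) r1"
      using r3 rg' by (intro pole_sum_mono fi) linarith+
    also have "pole_sum (\<lambda>z. inverse (f z)) r1 \<le> K * \<tau> k + c"
      using N[OF gd(2) r3(2)] elim(4) by (simp add: r1_def)
    also have "ln r0 \<le> ln 6 + ln (x k)"
    proof -
      have "ln r0 \<le> ln (6 * x k)" using r3 rg by (intro ln_mono) auto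
      then show ?thesis using rg' by (simp add: ln_mult)
    qed
    finally have "pole_sum (\<lambda>z. inverse (f (z + \<eta>))) r0 \<le> (1 + \<epsilon>) * (K * \<tau> k + c) + C * (ln 6 + ln (x k))"
      using assms C(1) by (simp add: mult_left_mono)
    moreover have "pole_sum (\<lambda>z. inverse (f z)) r0 \<le> \<tau> k + c"
      using N[OF gd(1) r3(1)] by (simp add: \<tau>_def r0_def)
    ultimately show ?case unfolding err_def r0_def by (simp add: algebra_simps)
  qed
  ultimately show ?thesis by blast
qed

end

section \<open>Poles of the auxiliary function h\<close>

lemma eventually_at_analytic:
  assumes "nonzero_meromorphic g"
  shows "eventually (\<lambda>z. g analytic_on {z}) (at a)"
  using eventually_not_bad[OF assms, of a] by eventually_elim (auto simp: bad_points_def)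

lemma deriv_minus_one:
  assumes "g analytic_on {z}"
  shows "deriv (\<lambda>z. g z - 1) z = deriv g z"
proof -
  have "(g has_field_derivative deriv g z) (at z)"
    using assms analytic_on_imp_differentiable_at by (simp add: DERIV_deriv_iff_field_differentiable)
  then have "((\<lambda>z. g z - 1) has_field_derivative deriv g z) (at z)"
    by (auto intro!: derivative_eq_intros)
  then show ?thesis by (rule DERIV_imp_deriv)
qed

lemma zorder_cong_meromorphic:
  assumes "eventually (\<lambda>z. g z = h z) (at a)"
  shows "zorder g a = zorder h a"
  using assms by (rule zorder_cong) simp

text \<open>At a zero of G or of G - 1 differentiation lowers the order by one, which leaves a
  simple pole. At a pole of G of order m the quotient has order 2 m - (m + 1) = m - 1 >= 0. This
  cancellation is the reason for the two factors in the denominator: poles of f are not counted at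
  all.\<close>

lemma pole_mult_auxiliary:
  assumes G: "nonzero_meromorphic G" and \<psi>: "nonzero_meromorphic (\<lambda>z. G z - 1)" and G': "nonzero_meromorphic (deriv G)"
  shows "pole_mult (\<lambda>z. deriv G z / (G z * (G z - 1))) a
    \<le> (if zorder G a > 0 \<or> zorder (\<lambda>z. G z - 1) a > 0 then 1 else 0)"
proof -
  define g p q where "g = zorder G a" and "p = zorder (\<lambda>z. G z - 1) a" and "q = zorder (deriv G) a"
  have one: "(\<lambda>_. 1) meromorphic_on {a}" "\<exists>\<^sub>F w in at a. (1::complex) \<noteq> 0" "zorder (\<lambda>_. 1) a = 0" by auto
  have h: "zorder (\<lambda>z. deriv G z / (G z * (G z - 1))) a = q - (g + p)"
    using zorder_divide[OF nonzero_meromorphic_at(1,3)[OF G'] nonzero_meromorphic_at(1,3)[OF nonzero_meromorphic_mult[OF G \<psi>]]]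
      zorder_mult[OF nonzero_meromorphic_at(1,3)[OF G] nonzero_meromorphic_at(1,3)[OF \<psi>]]
    by (simp add: g_def p_def q_def)
  have isoG: "isolated_singularity_at G a" "not_essential G a"
    using nonzero_meromorphic_at(1)[OF G] by (auto simp: meromorphic_at_iff)
  have iso\<psi>: "isolated_singularity_at (\<lambda>z. G z - 1) a" "not_essential (\<lambda>z. G z - 1) a"
    using nonzero_meromorphic_at(1)[OF \<psi>] by (auto simp: meromorphic_at_iff)
  have qg: "q = g - 1" if "g \<noteq> 0"
    unfolding q_def g_def by (rule zorder_deriv_minus_1[OF isoG nonzero_meromorphic_at(3)[OF G]]) (use that in \<open>simp add: g_def\<close>)
  have qp: "q = p - 1" if "p \<noteq> 0"
  proof -
    have "zorder (deriv (\<lambda>z. G z - 1)) a = p - 1"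
      unfolding p_def by (rule zorder_deriv_minus_1[OF iso\<psi> nonzero_meromorphic_at(3)[OF \<psi>]]) (use that in \<open>simp add: p_def\<close>)
    moreover have "zorder (deriv (\<lambda>z. G z - 1)) a = q"
      unfolding q_def by (rule zorder_cong_meromorphic)
        (use eventually_at_analytic[OF G, of a] in \<open>auto elim!: eventually_mono simp: deriv_minus_one\<close>)
    ultimately show ?thesis by simp
  qed
  have q0: "q \<ge> 0" if "g = 0"
  proof (rule ccontr)
    assume "\<not> q \<ge> 0"
    then have "is_pole (deriv G) a" using is_pole_iff_zorder_neg[OF G'] by (simp add: q_def)
    then have "is_pole G a" using is_pole_deriv_iff[OF nonzero_meromorphic_at(1)[OF G]] by simp
    then show False using is_pole_iff_zorder_neg[OF G] that by (simp add: g_def)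
  qed
  have neg: "max 0 (- real_of_int p) = max 0 (- real_of_int g)"
    using pole_mult_minus_one[OF G \<psi>, of a] by (simp add: pole_mult_def g_def p_def)
  have pos: "p = 0" if "g > 0"
    using zorder_diff2[OF nonzero_meromorphic_at(1,3)[OF G] one(1,2)] that by (simp add: g_def p_def)
  show ?thesis
    unfolding pole_mult_def h g_def[symmetric] p_def[symmetric]
    using qg qp q0 neg pos by (cases "g = 0"; cases "p = 0"; cases "g > 0"; auto simp: max_def split: if_splits)
qed

text \<open>Since the poles of h are simple, a zero of f is charged with at most its multiplicity in
  f and not n times that; otherwise the bound would grow with n and nothing would be gained. Poles
  of s are charged to the pole sum of s. Elsewhere a zero of G - 1 is a zero of s * (G - 1), which
  is the given expression.\<close>

lemma pole_sum_auxiliary: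
  fixes f s :: "complex \<Rightarrow> complex" and \<eta> :: complex and n :: nat
  defines "G \<equiv> \<lambda>z. f z ^ n * f (z + \<eta>) * inverse (s z)"
    and "Z \<equiv> {a. isolated_zero (\<lambda>z. f z ^ n * f (z + \<eta>) - s z) a}"
  assumes f: "nonzero_meromorphic f" and s: "nonzero_meromorphic s"
    and \<psi>: "nonzero_meromorphic (\<lambda>z. G z - 1)" and G': "nonzero_meromorphic (deriv G)"
    and Z: "finite Z" and r: "r \<ge> 1"
  shows "pole_sum (\<lambda>z. deriv G z / (G z * (G z - 1))) r \<le> pole_sum (\<lambda>z. inverse (f z)) r
    + pole_sum (\<lambda>z. inverse (f (z + \<eta>))) r + pole_sum s r + (\<Sum>a\<in>Z. ln r + \<bar>ln (cmod a)\<bar>)"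
proof -
  let ?fs = "\<lambda>z. f (z + \<eta>)" and ?fi = "\<lambda>z. inverse (f z)" and ?fsi = "\<lambda>z. inverse (f (z + \<eta>))"
  let ?h = "\<lambda>z. deriv G z / (G z * (G z - 1))"
  have fs: "nonzero_meromorphic ?fs" by (rule nonzero_meromorphic_shift[OF f])
  have fi: "nonzero_meromorphic ?fi" "nonzero_meromorphic ?fsi"
    by (intro nonzero_meromorphic_inverse f fs)+
  have G: "nonzero_meromorphic G"
    unfolding G_def by (intro nonzero_meromorphic_mult nonzero_meromorphic_power nonzero_meromorphic_inverse f fs s)
  have h: "nonzero_meromorphic ?h" by (intro nonzero_meromorphic_divide nonzero_meromorphic_mult G \<psi> G')
  have zG: "zorder G a = int n * zorder f a + zorder ?fs a - zorder s a" for a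
  proof -
    have "zorder G a = zorder (\<lambda>z. f z ^ n * f (z + \<eta>)) a + zorder (\<lambda>z. inverse (s z)) a"
      unfolding G_def
      by (intro zorder_mult nonzero_meromorphic_at nonzero_meromorphic_mult nonzero_meromorphic_power nonzero_meromorphic_inverse f fs s)
    also have "zorder (\<lambda>z. f z ^ n * f (z + \<eta>)) a = zorder (\<lambda>z. f z ^ n) a + zorder ?fs a"
      by (intro zorder_mult nonzero_meromorphic_at nonzero_meromorphic_power f fs)
    also have "zorder (\<lambda>z. f z ^ n) a = int n * zorder f a"
      by (intro zorder_power nonzero_meromorphic_at f)
    finally show ?thesis by (simp add: zorder_inverse_meromorphic[OF s])
  qed
  have zero: "a \<in> Z" if a: "zorder (\<lambda>z. G z - 1) a > 0" "zorder s a \<ge> 0" for a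
  proof -
    have "zorder (\<lambda>z. s z * (G z - 1)) a > 0"
      using zorder_mult[OF nonzero_meromorphic_at(1,3)[OF s] nonzero_meromorphic_at(1,3)[OF \<psi>], of a] a by simp
    then have iz: "isolated_zero (\<lambda>z. s z * (G z - 1)) a"
      using nonzero_meromorphic_at(1,2)[OF nonzero_meromorphic_mult[OF s \<psi>]] by (intro zorder_pos_imp_isolated_zero)
    \<comment> \<open>At zeros of s the two expressions may take different values, so they are
      compared only in a punctured neighbourhood.\<close>
    have "eventually (\<lambda>z. s z * (G z - 1) = f z ^ n * f (z + \<eta>) - s z) (at a)"
      using nonzero_meromorphic_at(2)[OF s, of a] by eventually_elim (simp add: G_def algebra_simps)
    then have "isolated_zero (\<lambda>z. s z * (G z - 1)) a \<longleftrightarrow> isolated_zero (\<lambda>z. f z ^ n * f (z + \<eta>) - s z) a"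
      unfolding isolated_zero_def by (intro conj_cong tendsto_cong) (auto elim: eventually_elim2)
    with iz show ?thesis by (simp add: Z_def)
  qed
  define P where "P = (\<lambda>a. pole_mult ?fi a + pole_mult ?fsi a + pole_mult s a + (if a \<in> Z then 1 else 0))"
  have le: "pole_mult ?h a \<le> P a" for a
  proof -
    have ge: "P a \<ge> 1" if "zorder f a > 0 \<or> zorder ?fs a > 0 \<or> zorder s a < 0 \<or> a \<in> Z"
    proof -
      have "pole_mult ?fi a \<ge> 1 \<or> pole_mult ?fsi a \<ge> 1 \<or> pole_mult s a \<ge> 1 \<or> a \<in> Z"
        using that by (auto simp: pole_mult_def zorder_inverse_meromorphic[OF f] zorder_inverse_meromorphic[OF fs])
      then show ?thesis
        using pole_mult_nonneg[of ?fi a] pole_mult_nonneg[of ?fsi a] pole_mult_nonneg[of s a]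
        unfolding P_def by (smt (verit))
    qed
    have P0: "P a \<ge> 0" unfolding P_def by simp
    have "zorder f a > 0 \<or> zorder ?fs a > 0 \<or> zorder s a < 0 \<or> a \<in> Z"
      if "zorder G a > 0 \<or> zorder (\<lambda>z. G z - 1) a > 0"
    proof (rule ccontr)
      assume n: "\<not> (zorder f a > 0 \<or> zorder ?fs a > 0 \<or> zorder s a < 0 \<or> a \<in> Z)"
      then have "int n * zorder f a \<le> 0" by (simp add: mult_nonneg_nonpos)
      then have "zorder G a \<le> 0" using n zG[of a] by linarith
      then show False using that zero[of a] n by auto
    qed
    then show ?thesis using pole_mult_auxiliary[OF G \<psi> G', of a] ge P0 by (auto split: if_splits)
  qed
  define S where "S = (bad_points ?h \<union> bad_points ?fi \<union> bad_points ?fsi \<union> bad_points s) \<inter> ball 0 r"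
  have S: "finite S" unfolding S_def
    using finite_bad_points_ball[OF h] finite_bad_points_ball[OF fi(1)] finite_bad_points_ball[OF fi(2)] finite_bad_points_ball[OF s]
    by (simp add: Int_Un_distrib2)
  define w where "w = (\<lambda>a. ln r - ln (cmod a))"
  have "pole_sum ?h r \<le> (\<Sum>a\<in>S. P a * w a)"
    unfolding w_def by (rule pole_sum_le) (use le S r in \<open>auto simp: S_def\<close>)
  also have "\<dots> = pole_sum ?fi r + pole_sum ?fsi r + pole_sum s r + (\<Sum>a\<in>S \<inter> Z. w a)"
  proof -
    have "pole_sum ?fi r = (\<Sum>a\<in>S. pole_mult ?fi a * w a)" "pole_sum ?fsi r = (\<Sum>a\<in>S. pole_mult ?fsi a * w a)"
      "pole_sum s r = (\<Sum>a\<in>S. pole_mult s a * w a)"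
      unfolding w_def by (intro pole_sum_superset S; auto simp: S_def)+
    moreover have "(\<Sum>a\<in>S \<inter> Z. w a) = (\<Sum>a\<in>S. (if a \<in> Z then 1 else 0) * w a)"
      unfolding sum.inter_restrict[OF S] by (intro sum.cong) auto
    ultimately show ?thesis by (simp only: P_def distrib_right sum.distrib)
  qed
  also have "(\<Sum>a\<in>S \<inter> Z. w a) \<le> (\<Sum>a\<in>S \<inter> Z. ln r + \<bar>ln (cmod a)\<bar>)"
    by (intro sum_mono) (auto simp: w_def)
  also have "\<dots> \<le> (\<Sum>a\<in>Z. ln r + \<bar>ln (cmod a)\<bar>)"
    using r Z by (intro sum_mono2) auto
  finally show ?thesis by simp
qed

section \<open>The proximity function of G\<close>

context regular_radii
begin

text \<open>h is the difference of the logarithmic derivatives of G - 1 and G, so m(r, h) is small.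
  Thus T(r, h), which bounds m(r, 1/h) up to a constant, reduces to the pole sum of h.\<close>

lemma prox_G_nonconstant:
  fixes s :: "complex \<Rightarrow> complex" and n :: nat
  defines "G \<equiv> \<lambda>z. f z ^ n * f (z + \<eta>) * inverse (s z)"
    and "Z \<equiv> {a. isolated_zero (\<lambda>z. f z ^ n * f (z + \<eta>) - s z) a}"
  assumes s: "nonzero_meromorphic s"
    and \<psi>: "nonzero_meromorphic (\<lambda>z. G z - 1)" and G': "nonzero_meromorphic (deriv G)"
    and good: "eventually (\<lambda>k. \<forall>j\<le>4. good_radius s (R j k) \<and> good_radius (\<lambda>z. G z - 1) (R j k) \<and> good_radius (deriv G) (R j k)) sequentially"
    and small: "(\<lambda>k. char_sum s (r k)) \<in> o(\<tau>)" "(\<lambda>k. char_sum s (R 2 k)) \<in> o(\<tau>)"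
    and Z: "finite Z"
  shows "\<exists>err\<in>o(\<tau>). eventually (\<lambda>k. circle_prox G (r k) \<le> pole_sum (\<lambda>z. inverse (f z)) (r k)
    + pole_sum (\<lambda>z. inverse (f (z + \<eta>))) (r k) + err k) sequentially"
proof -
  let ?fs = "\<lambda>z. f (z + \<eta>)" and ?\<psi> = "\<lambda>z. G z - 1" and ?h = "\<lambda>z. deriv G z / (G z * (G z - 1))"
  have fs: "nonzero_meromorphic ?fs" by (rule nonzero_meromorphic_shift[OF f])
  have F: "nonzero_meromorphic (\<lambda>z. f z ^ n * f (z + \<eta>))"
    by (intro nonzero_meromorphic_mult nonzero_meromorphic_power f fs)
  have G: "nonzero_meromorphic G"
    unfolding G_def by (intro nonzero_meromorphic_mult[OF F] nonzero_meromorphic_inverse s)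
  have h: "nonzero_meromorphic ?h" by (intro nonzero_meromorphic_divide nonzero_meromorphic_mult G \<psi> G')
  have goodG: "eventually (\<lambda>k. \<forall>j\<le>4. good_radius f (R j k) \<and> good_radius ?fs (R j k) \<and> good_radius s (R j k) \<and>
      good_radius G (R j k) \<and> good_radius ?\<psi> (R j k) \<and> good_radius (deriv G) (R j k)) sequentially"
    using good good_f
  proof eventually_elim
    case (elim k)
    show ?case
    proof (intro allI impI)
      fix j :: nat assume j: "j \<le> 4"
      have 1: "good_radius s (R j k)" "good_radius ?\<psi> (R j k)" "good_radius (deriv G) (R j k)" "good_radius f (R j k)"
        "\<And>z. cmod z = R j k \<Longrightarrow> z + \<eta> \<notin> bad_points f"
        using elim(1)[THEN spec, THEN mp, OF j] elim(2)[THEN spec, THEN mp, OF j] by blast+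
      have 2: "good_radius ?fs (R j k)" by (rule good_radius_shift[OF good_radius_pos[OF 1(4)] 1(5)])
      have "good_radius G (R j k)"
        unfolding G_def by (intro good_radius_mult good_radius_power good_radius_inverse 1 2)
      with 1 2 show "good_radius f (R j k) \<and> good_radius ?fs (R j k) \<and> good_radius s (R j k) \<and>
        good_radius G (R j k) \<and> good_radius ?\<psi> (R j k) \<and> good_radius (deriv G) (R j k)" by simp
    qed
  qed
  have j2: "(2::nat) \<le> 4" by simp
  have TG: "(\<lambda>k. char_sum G (R 2 k)) \<in> O(\<tau>)"
  proof (rule bigo_of_le)
    show "(\<lambda>k. (real n * K) * \<tau> k + leading_constant s + (char_sum ?fs (R 2 k) + char_sum s (R 2 k))) \<in> O(\<tau>)"
      by (intro sum_in_bigo(1) big_\<tau> shifted_char_big landau_o.small_imp_big[OF small(2)])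
    show "eventually (\<lambda>k. 0 \<le> char_sum G (R 2 k) \<and> char_sum G (R 2 k)
      \<le> (real n * K) * \<tau> k + leading_constant s + (char_sum ?fs (R 2 k) + char_sum s (R 2 k))) sequentially"
      using goodG ranges char_f_le[OF j2]
    proof eventually_elim
      case (elim k)
      define \<rho> where "\<rho> = R 2 k"
      have gd: "good_radius f \<rho>" "good_radius ?fs \<rho>" "good_radius s \<rho>" "good_radius G \<rho>"
        using elim(1)[THEN spec, THEN mp, OF j2] unfolding \<rho>_def by blast+
      have \<rho>: "\<rho> \<ge> 1"
      proof -
        have "\<forall>j\<le>4. x k \<le> R j k \<and> R j k \<le> 6 * x k" "3 \<le> x k" using elim(2) by blast+
        from this(1)[THEN spec, THEN mp, OF j2] this(2) show ?thesis unfolding \<rho>_def by linarith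
      qed
      have "char_sum G \<rho> \<le> char_sum (\<lambda>z. f z ^ n * f (z + \<eta>)) \<rho> + char_sum (\<lambda>z. inverse (s z)) \<rho>"
        unfolding G_def
        by (intro char_sum_mult F nonzero_meromorphic_inverse s good_radius_mult good_radius_power good_radius_inverse gd \<rho>)
      also have "char_sum (\<lambda>z. f z ^ n * f (z + \<eta>)) \<rho> \<le> char_sum (\<lambda>z. f z ^ n) \<rho> + char_sum ?fs \<rho>"
        by (intro char_sum_mult nonzero_meromorphic_power f fs good_radius_power gd \<rho>)
      also have "char_sum (\<lambda>z. f z ^ n) \<rho> = real n * char_sum f \<rho>" by (rule char_sum_power[OF f])
      also have "real n * char_sum f \<rho> \<le> real n * (K * \<tau> k)"
        using elim(3) unfolding \<rho>_def by (intro mult_left_mono) auto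
      also have "char_sum (\<lambda>z. inverse (s z)) \<rho> \<le> char_sum s \<rho> + leading_constant s"
        by (rule char_sum_inverse_le[OF s gd(3)])
      finally have "char_sum G \<rho> \<le> (real n * K) * \<tau> k + leading_constant s + (char_sum ?fs \<rho> + char_sum s \<rho>)" by simp
      then show ?case using char_sum_ge(3)[OF gd(4) \<rho>] unfolding \<rho>_def by simp
    qed
  qed
  have T\<psi>: "(\<lambda>k. char_sum ?\<psi> (R 2 k)) \<in> O(\<tau>)"
  proof (rule bigo_of_le)
    show "(\<lambda>k. char_sum G (R 2 k) + ln 2) \<in> O(\<tau>)"
      by (intro sum_in_bigo(1) TG landau_o.small_imp_big[OF const_small])
    show "eventually (\<lambda>k. 0 \<le> char_sum ?\<psi> (R 2 k) \<and> char_sum ?\<psi> (R 2 k) \<le> char_sum G (R 2 k) + ln 2) sequentially"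
      using goodG ranges
    proof eventually_elim
      case (elim k)
      have j2: "(2::nat) \<le> 4" by simp
      have gd: "good_radius G (R 2 k)" "good_radius ?\<psi> (R 2 k)"
        using elim(1)[THEN spec, THEN mp, OF j2] by blast+
      have "\<forall>j\<le>4. x k \<le> R j k \<and> R j k \<le> 6 * x k" "3 \<le> x k" using elim(2) by blast+
      from this(1)[THEN spec, THEN mp, OF j2] this(2) have "R 2 k \<ge> 1" by linarith
      then show ?case using char_sum_minus_one[OF G \<psi> gd] char_sum_ge(3)[OF gd(2)] by simp
    qed
  qed
  define u1 u2 where "u1 = (\<lambda>k. circle_prox (\<lambda>z. deriv G z / G z) (r k))"
    and "u2 = (\<lambda>k. circle_prox (\<lambda>z. deriv ?\<psi> z / ?\<psi> z) (r k))"
  have first: "Q 0 \<and> Q 1 \<and> Q 2" if "\<forall>j\<le>(4::nat). Q j" for Q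
    using that by auto
  have gd3: "eventually (\<lambda>k. good_radius G (R 0 k) \<and> good_radius G (R 1 k) \<and> good_radius G (R 2 k)) sequentially"
    by (rule eventually_mono[OF goodG]) (drule first, blast)
  have gd3': "eventually (\<lambda>k. good_radius ?\<psi> (R 0 k) \<and> good_radius ?\<psi> (R 1 k) \<and> good_radius ?\<psi> (R 2 k)) sequentially"
    by (rule eventually_mono[OF goodG]) (drule first, blast)
  have u1: "u1 \<in> o(\<tau>)" unfolding u1_def by (rule log_derivative_small[OF G gd3 TG])
  have u2: "u2 \<in> o(\<tau>)" unfolding u2_def by (rule log_derivative_small[OF \<psi> gd3' T\<psi>])
  define c where "c = (\<Sum>a\<in>Z. \<bar>ln (cmod a)\<bar>)"
  \<comment> \<open>\<open>u2\<close> occurs twice: once for the factor G' / (G - 1) of G, and once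
    inside m(r, h).\<close>
  define err where "err = (\<lambda>k. 2 * u2 k + u1 k + char_sum s (r k) + real (card Z) * (ln 2 + ln (x k)) + (c + leading_constant ?h + ln 2))"
  have "err \<in> o(\<tau>)" unfolding err_def
    by (intro small_add small_cmult u1 u2 small ln_small const_small)
  moreover have "eventually (\<lambda>k. circle_prox G (r k) \<le> pole_sum (\<lambda>z. inverse (f z)) (r k)
    + pole_sum (\<lambda>z. inverse (f (z + \<eta>))) (r k) + err k) sequentially"
    using goodG ranges r_range
  proof eventually_elim
    case (elim k)
    define \<rho> where "\<rho> = r k"
    have gd: "good_radius G \<rho>" "good_radius ?\<psi> \<rho>" "good_radius (deriv G) \<rho>" "good_radius s \<rho>"
      using elim(1)[THEN spec[of _ 0]] unfolding \<rho>_def by auto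
    have \<rho>: "\<rho> \<ge> 1" "\<rho> \<le> 2 * x k" "3 \<le> x k" using elim(2,3) unfolding \<rho>_def by auto
    have gh: "good_radius ?h \<rho>"
      unfolding divide_inverse by (intro good_radius_mult good_radius_inverse gd)
    have gq: "good_radius (\<lambda>z. deriv G z / ?\<psi> z) \<rho>" "good_radius (\<lambda>z. deriv G z / G z) \<rho>"
      unfolding divide_inverse by (intro good_radius_mult good_radius_inverse gd)+
    have nz: "G z \<noteq> 0" "G z - 1 \<noteq> 0" "deriv G z \<noteq> 0" if "cmod z = \<rho>" for z
      using good_radius_nonzero[OF gd(1) that] good_radius_nonzero[OF gd(2) that] good_radius_nonzero[OF gd(3) that] by auto
    have d\<psi>: "circle_prox (\<lambda>z. deriv G z / ?\<psi> z) \<rho> = u2 k"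
      unfolding u2_def \<rho>_def[symmetric]
      by (rule circle_prox_cong) (use gd(1) \<rho> in \<open>auto simp: deriv_minus_one good_radius_def bad_points_def\<close>)
    have heq: "?h z = deriv G z / ?\<psi> z - deriv G z / G z" if "cmod z = \<rho>" for z
      using nz[OF that] by (simp add: divide_simps) (simp add: algebra_simps)
    have gdiff: "good_radius (\<lambda>z. deriv G z / ?\<psi> z - deriv G z / G z) \<rho>"
      unfolding good_radius_def
    proof (intro conjI allI impI)
      fix z assume z: "cmod z = \<rho>"
      have "?h z \<noteq> 0" using good_radius_nonzero[OF gh z] .
      then show "z \<notin> bad_points (\<lambda>z. deriv G z / ?\<psi> z - deriv G z / G z)"
        using gq z heq[OF z] unfolding bad_points_def good_radius_def by (auto intro!: analytic_on_diff)
    qed (use \<rho> in simp)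
    have "circle_prox ?h \<rho> = circle_prox (\<lambda>z. deriv G z / ?\<psi> z - deriv G z / G z) \<rho>"
      by (rule circle_prox_cong) (use heq \<rho> in auto)
    also have "\<dots> \<le> u2 k + u1 k + ln 2"
      using circle_prox_diff[OF gq gdiff] unfolding d\<psi> by (simp add: u1_def \<rho>_def)
    finally have mh: "circle_prox ?h \<rho> \<le> u2 k + u1 k + ln 2" .
    have "circle_prox G \<rho> = circle_prox (\<lambda>z. deriv G z / ?\<psi> z * inverse (?h z)) \<rho>"
      by (rule circle_prox_cong) (use nz \<rho> in auto)
    also have "\<dots> \<le> circle_prox (\<lambda>z. deriv G z / ?\<psi> z) \<rho> + circle_prox (\<lambda>z. inverse (?h z)) \<rho>"
      by (rule circle_prox_mult[OF gq(1) good_radius_inverse[OF gh]])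
    also have "circle_prox (\<lambda>z. inverse (?h z)) \<rho> \<le> char_sum ?h \<rho> + leading_constant ?h"
      using char_sum_ge(1)[OF good_radius_inverse[OF gh] \<rho>(1)] char_sum_inverse_le[OF h gh] by linarith
    also have "char_sum ?h \<rho> = circle_prox ?h \<rho> + pole_sum ?h \<rho>" by (simp add: char_sum_def)
    also have "pole_sum ?h \<rho> \<le> pole_sum (\<lambda>z. inverse (f z)) \<rho>
      + pole_sum (\<lambda>z. inverse (f (z + \<eta>))) \<rho> + pole_sum s \<rho> + (\<Sum>a\<in>Z. ln \<rho> + \<bar>ln (cmod a)\<bar>)"
      unfolding G_def Z_def
      by (rule pole_sum_auxiliary[OF f s \<psi>[unfolded G_def] G'[unfolded G_def] Z[unfolded Z_def] \<rho>(1)])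
    also have "pole_sum s \<rho> \<le> char_sum s \<rho>" by (rule char_sum_ge(2)[OF gd(4) \<rho>(1)])
    also have "(\<Sum>a\<in>Z. ln \<rho> + \<bar>ln (cmod a)\<bar>) = real (card Z) * ln \<rho> + c" by (simp add: c_def sum.distrib)
    also have "real (card Z) * ln \<rho> \<le> real (card Z) * (ln 2 + ln (x k))"
    proof (rule mult_left_mono)
      have "ln \<rho> \<le> ln (2 * x k)" using \<rho> by (intro ln_mono) auto
      then show "ln \<rho> \<le> ln 2 + ln (x k)" using \<rho> by (simp add: ln_mult)
    qed simp
    finally show ?case using mh d\<psi> unfolding err_def \<rho>_def by linarith
  qed
  ultimately show ?thesis by blast
qed

end

section \<open>Existence of regular radii and the theorem\<close>

text \<open>The exceptional set is closed and countable, so some disc avoids it and G equals a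
  constant c there. A meromorphic function that does not equal c off a sparse set would have to
  avoid c near the centre.\<close>

lemma deriv_zero_imp_constant:
  assumes G: "G meromorphic_on UNIV" and zero: "eventually (\<lambda>z. deriv G z = 0) (cosparse UNIV)"
  shows "\<exists>c. eventually (\<lambda>z. G z = c) (cosparse UNIV)"
proof -
  define X where "X = {z. \<not> (G analytic_on {z} \<and> deriv G z = 0)}"
  have "eventually (\<lambda>z. G analytic_on {z} \<and> deriv G z = 0) (cosparse UNIV)"
    by (intro eventually_conj meromorphic_on_imp_analytic_cosparse G zero)
  then have X: "X sparse_in UNIV" by (simp add: eventually_cosparse X_def)
  have "X \<noteq> UNIV"
  proof
    assume "X = UNIV"
    moreover have "countable X" using sparse_imp_countable[OF open_UNIV X] by simp
    ultimately show False using uncountable_UNIV_complex by simp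
  qed
  moreover have "open (- X)" using sparse_in_UNIV_imp_closed[OF X] by (simp add: open_Compl)
  ultimately obtain z0 \<rho> where z0: "\<rho> > 0" "ball z0 \<rho> \<subseteq> - X"
    by (metis Compl_iff UNIV_eq_I open_contains_ball)
  have "(G has_field_derivative 0) (at z within ball z0 \<rho>)" if "z \<in> ball z0 \<rho>" for z
  proof -
    have "G analytic_on {z}" "deriv G z = 0" using that z0 by (auto simp: X_def)
    then show ?thesis
      by (metis DERIV_deriv_iff_field_differentiable analytic_on_imp_differentiable_at has_field_derivative_at_within singletonI)
  qed
  then obtain c where c: "\<And>z. z \<in> ball z0 \<rho> \<Longrightarrow> G z = c"
    using has_field_derivative_zero_constant[OF convex_ball, of z0 \<rho> G] by blast
  have "eventually (\<lambda>z. G z = c) (at z0)"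
    unfolding eventually_at using z0(1) c by (auto simp: dist_commute intro!: exI[of _ \<rho>])
  then have "\<not> eventually (\<lambda>z. G z \<noteq> c) (at z0)"
    using eventually_conj[of "\<lambda>z. G z = c" "at z0" "\<lambda>z. G z \<noteq> c"] by auto
  then have "\<not> eventually (\<lambda>z. G z \<noteq> c) (cosparse UNIV)"
    using eventually_cosparse_imp_eventually_at[of _ UNIV z0 UNIV] by auto
  then show ?thesis
    using meromorphic_imp_constant_or_avoid[OF G open_UNIV connected_UNIV, of c] by blast
qed

lemma countable_bad_shift_radii:
  assumes "nonzero_meromorphic f"
  shows "countable {r. \<exists>z. cmod z = r \<and> z + \<eta> \<in> bad_points f}"
proof -
  have "countable (bad_points f)"
    using sparse_imp_countable[OF open_UNIV bad_points_sparse[OF assms]] by simp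
  then have "countable ((\<lambda>z. cmod (z - \<eta>)) ` bad_points f)" by simp
  moreover have "{r. \<exists>z. cmod z = r \<and> z + \<eta> \<in> bad_points f} \<subseteq> (\<lambda>z. cmod (z - \<eta>)) ` bad_points f"
    by force
  ultimately show ?thesis by (rule countable_subset[rotated])
qed

lemma good_radius_exists:
  assumes "nonzero_meromorphic f" "t \<ge> 0"
  shows "\<exists>u. t \<le> u \<and> u \<le> t + 1 \<and> good_radius f u"
proof (rule ccontr)
  assume "\<not> ?thesis"
  then have "{t<..<t + 1} \<subseteq> {r. r > 0 \<and> \<not> good_radius f r}" using assms(2) by auto
  then have "countable {t<..<t + 1}" using countable_bad_radii[OF assms(1)] by (rule countable_subset)
  then show False using uncountable_open_interval[of t "t + 1"] by simp
qed

text \<open>The characteristic is only known to be increasing on good radii, so the growth lemma is applied to its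
  increasing regularisation, which agrees with it there.\<close>
definition char_envelope :: "(complex \<Rightarrow> complex) \<Rightarrow> real \<Rightarrow> real" where
  "char_envelope f t = Inf (char_sum f ` {u. max 1 t \<le> u \<and> good_radius f u})"

lemma char_envelope:
  assumes f: "nonzero_meromorphic f"
  shows char_envelope_mono: "t \<le> t' \<Longrightarrow> char_envelope f t \<le> char_envelope f t'"
    and char_envelope_eq: "1 \<le> t \<Longrightarrow> good_radius f t \<Longrightarrow> char_envelope f t = char_sum f t"
    and char_envelope_le: "1 \<le> t \<Longrightarrow> t \<le> u \<Longrightarrow> good_radius f u \<Longrightarrow> char_envelope f t \<le> char_sum f u"
proof -
  have bdd: "bdd_below (char_sum f ` {u. max 1 t \<le> u \<and> good_radius f u})" for t
    by (rule bdd_belowI[of _ 0]) (auto intro: char_sum_ge(3))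
  have ne: "char_sum f ` {u. max 1 t \<le> u \<and> good_radius f u} \<noteq> {}" for t
  proof -
    have "0 \<le> max 1 t" by simp
    then obtain u where "max 1 t \<le> u" "good_radius f u" using good_radius_exists[OF f] by blast
    then show ?thesis by blast
  qed
  show "char_envelope f t \<le> char_envelope f t'" if "t \<le> t'"
    unfolding char_envelope_def by (rule cInf_superset_mono[OF ne bdd]) (use that in auto)
  show "char_envelope f t = char_sum f t" if "1 \<le> t" "good_radius f t"
    unfolding char_envelope_def by (rule cInf_eq_minimum) (use that in \<open>auto intro!: char_sum_mono f\<close>)
  show "char_envelope f t \<le> char_sum f u" if "1 \<le> t" "t \<le> u" "good_radius f u"
    unfolding char_envelope_def by (rule cInf_lower[OF _ bdd]) (use that in auto)
qed

text \<open>The hyper order speaks of \<open>nevanlinna_char\<close>, which is known to equal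
  \<open>char_sum\<close> on good radii. One of these lies in [t, t + 1], which is why t + 1
  appears.\<close>

lemma char_envelope_growth:
  assumes f: "nonzero_meromorphic f" and \<sigma>: "0 < \<sigma>"
    and hyper: "eventually (\<lambda>r. log_plus (log_plus (nevanlinna_char f r)) / ln r < \<sigma>) at_top"
  shows "\<exists>x0. \<forall>t\<ge>x0. log_plus (char_envelope f t) \<le> (t + 1) powr \<sigma>"
proof -
  obtain x0 where x0: "\<And>r. r \<ge> x0 \<Longrightarrow> log_plus (log_plus (nevanlinna_char f r)) / ln r < \<sigma>"
    using hyper by (auto simp: eventually_at_top_linorder)
  have "log_plus (char_envelope f t) \<le> (t + 1) powr \<sigma>" if t: "t \<ge> max x0 2" for t
  proof -
    obtain u where u: "t \<le> u" "u \<le> t + 1" "good_radius f u" using good_radius_exists[OF f, of t] t by auto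
    have u1: "u > 1" "u \<ge> x0" using u t by auto
    define T where "T = nevanlinna_char f u"
    have "log_plus (log_plus T) / ln u < \<sigma>" unfolding T_def by (rule x0[OF u1(2)])
    then have "ln (max 1 (log_plus T)) < \<sigma> * ln u" using u1 by (simp add: log_plus_def field_simps)
    moreover have "exp (ln (max 1 (log_plus T))) = max 1 (log_plus T)" by (rule exp_ln) simp
    ultimately have "max 1 (log_plus T) \<le> exp (\<sigma> * ln u)" by (metis exp_less_cancel_iff less_imp_le)
    then have "log_plus T \<le> u powr \<sigma>" using u1 by (simp add: powr_def)
    also have "\<dots> \<le> (t + 1) powr \<sigma>" using u u1 \<sigma> by (intro powr_mono2) auto
    finally have "log_plus T \<le> (t + 1) powr \<sigma>" .
    moreover have "char_envelope f t \<le> T"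
      unfolding T_def nevanlinna_char_eq_char_sum[OF f u(3)] using char_envelope_le[OF f _ u(1,3)] t by simp
    ultimately show ?thesis using log_plus_mono order_trans by blast
  qed
  then show ?thesis by blast
qed

text \<open>Q stands for whatever the application demands of its circles beyond the conditions on f.
  Failing for only countably many radii, it is added to the exceptional set. The growth lemma is
  applied to log^+ of the envelope with increment ln K, which gives the factor K for the
  characteristic.\<close>

theorem regular_radii_exist:
  fixes \<eta> :: complex
  assumes tr: "transcendental_meromorphic f" and f: "nonzero_meromorphic f" and hyper: "hyper_order f < 1"
    and E: "finite_log_measure E" and Q: "countable {t. t > 0 \<and> \<not> Q t}" and K: "K > 1"
  shows "\<exists>x r d \<tau> \<alpha> \<beta>. regular_radii f \<eta> x r d \<tau> \<alpha> \<beta> K \<and>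
    eventually (\<lambda>k. \<forall>j\<le>4. Q (r k + real j * d k) \<and> r k + real j * d k \<notin> E) sequentially"
proof -
  obtain \<sigma>0 where \<sigma>0: "hyper_order f < ereal \<sigma>0" "ereal \<sigma>0 < 1" using ereal_dense2[OF hyper] by blast
  \<comment> \<open>\<sigma>0 could be nonpositive, and the growth lemma needs a positive exponent.
    The other two exponents are midpoints: \<sigma> + \<beta> = (1 + \<sigma>) / 2 < 1, and \<alpha>
    lies halfway between 1 - \<beta> and 1.\<close>
  define \<sigma> where "\<sigma> = max \<sigma>0 (1 / 2)"
  have \<sigma>: "0 < \<sigma>" "\<sigma> < 1" using \<sigma>0 by (auto simp: \<sigma>_def one_ereal_def)
  define \<beta> where "\<beta> = (1 - \<sigma>) / 2"
  define \<alpha> where "\<alpha> = 1 - \<beta> / 2"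
  have exps: "0 < \<beta>" "\<beta> < 1" "1 - \<beta> < \<alpha>" "\<alpha> < 1" "\<sigma> + \<beta> < 1" using \<sigma> by (auto simp: \<alpha>_def \<beta>_def field_simps)
  have "eventually (\<lambda>r. ereal (log_plus (log_plus (nevanlinna_char f r)) / ln r) < ereal \<sigma>0) at_top"
    using \<sigma>0(1) unfolding hyper_order_def by (rule Limsup_lessD)
  then have "eventually (\<lambda>r. log_plus (log_plus (nevanlinna_char f r)) / ln r < \<sigma>) at_top"
    by eventually_elim (auto simp: \<sigma>_def)
  then obtain x0 where x0: "\<And>t. t \<ge> x0 \<Longrightarrow> log_plus (char_envelope f t) \<le> (t + 1) powr \<sigma>"
    using char_envelope_growth[OF f \<sigma>(1)] by blast
  define B where "B = {t. t > 0 \<and> \<not> good_radius f t} \<union> {t. \<exists>z. cmod z = t \<and> z + \<eta> \<in> bad_points f} \<union> {t. t > 0 \<and> \<not> Q t}"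
  have "countable B" unfolding B_def using countable_bad_radii[OF f] countable_bad_shift_radii[OF f] Q by simp
  then have E': "finite_log_measure (E \<union> B)" by (rule finite_log_measure_Un_countable[OF E])
  define x where "x = (\<lambda>k::nat. (2::real) ^ k)"
  define d where "d = (\<lambda>k. x k powr \<beta>)"
  define P where "P = (\<lambda>k r. x k \<le> r \<and> r \<le> 2 * x k \<and> (\<forall>j\<le>4. r + real j * d k \<notin> E \<union> B) \<and>
    log_plus (char_envelope f (r + real 4 * d k)) - log_plus (char_envelope f r) < ln K)"
  have "eventually (\<lambda>k. \<exists>r. P k r) sequentially"
    unfolding P_def x_def d_def
    by (rule regular_growth_radius[OF _ _ x0 \<sigma>(1) exps(1,5) E', of x0 "ln K" 4])
       (use K in \<open>auto intro: log_plus_mono char_envelope_mono[OF f]\<close>)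
  define r where "r = (\<lambda>k. SOME r. P k r)"
  have P: "eventually (\<lambda>k. P k (r k)) sequentially"
    using \<open>eventually (\<lambda>k. \<exists>r. P k r) sequentially\<close> by eventually_elim (simp add: r_def someI_ex)
  define \<tau> where "\<tau> = (\<lambda>k. char_sum f (r k))"
  have x_lim: "filterlim x at_top sequentially" unfolding x_def by (rule filterlim_power2)
  have good: "eventually (\<lambda>k. x k \<ge> 3 \<and> x k \<le> r k \<and> (\<forall>j\<le>4. good_radius f (r k + real j * d k) \<and>
      (\<forall>z. cmod z = r k + real j * d k \<longrightarrow> z + \<eta> \<notin> bad_points f) \<and> Q (r k + real j * d k) \<and> r k + real j * d k \<notin> E)) sequentially"
  proof -
    have "eventually (\<lambda>k. x k \<ge> 3) sequentially" using x_lim by (simp add: filterlim_at_top)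
    with P show ?thesis
    proof eventually_elim
      case (elim k)
      have "r k + real j * d k > 0" for j
      proof -
        have "0 \<le> real j * d k" by (simp add: d_def)
        moreover have "r k > 0" using elim by (simp add: P_def)
        ultimately show ?thesis by linarith
      qed
      then show ?case using elim unfolding P_def B_def by blast
    qed
  qed
  have fast: "eventually (\<lambda>k. \<tau> k \<ge> C * ln (r k)) sequentially" for C
  proof -
    have "\<not> (\<forall>r0. \<exists>r\<ge>r0. good_radius f r \<and> char_sum f r \<le> C * ln r)"
      using slow_characteristic_imp_rational[OF _ f, of C] tr by (auto simp: transcendental_meromorphic_def)
    then obtain r0 where r0: "\<And>r. r \<ge> r0 \<Longrightarrow> good_radius f r \<Longrightarrow> char_sum f r > C * ln r" by (meson not_le)
    have "eventually (\<lambda>k. x k \<ge> r0) sequentially" using x_lim by (simp add: filterlim_at_top)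
    with good show ?thesis
    proof eventually_elim
      case (elim k)
      then have "good_radius f (r k)" "r k \<ge> r0" by force+
      then show ?case unfolding \<tau>_def using r0 by (simp add: less_imp_le)
    qed
  qed
  have "regular_radii f \<eta> x r d \<tau> \<alpha> \<beta> K"
  proof
    show "nonzero_meromorphic f" "0 < \<beta>" "\<beta> < 1" "1 - \<beta> < \<alpha>" "\<alpha> < 1" "filterlim x at_top sequentially"
      "d = (\<lambda>k. x k powr \<beta>)" "\<tau> = (\<lambda>k. char_sum f (r k))" using f exps x_lim by (simp_all add: d_def \<tau>_def)
    show "eventually (\<lambda>k. x k \<le> r k \<and> r k \<le> 2 * x k) sequentially" using P by eventually_elim (simp add: P_def)
    show "eventually (\<lambda>k. \<forall>j\<le>4. good_radius f (r k + real j * d k) \<and>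
      (\<forall>z. cmod z = r k + real j * d k \<longrightarrow> z + \<eta> \<notin> bad_points f)) sequentially"
      using good by eventually_elim blast
    show "eventually (\<lambda>k. char_sum f (r k + 4 * d k) \<le> K * \<tau> k) sequentially"
      using good P fast[of 1]
    proof eventually_elim
      case (elim k)
      have d0: "0 \<le> d k" by (simp add: d_def)
      have g0: "good_radius f (r k)" "r k \<ge> 3" using elim(1) by force+
      have g4: "good_radius f (r k + 4 * d k)"
        using elim(1) by (auto dest!: spec[of _ 4])
      have "exp 1 \<le> (3::real)" by (rule exp_le)
      then have "ln (r k) \<ge> 1" using g0 by (subst ln_ge_iff) auto
      then have \<tau>1: "\<tau> k \<ge> 1" using elim(3) by simp
      have "log_plus (char_sum f (r k + 4 * d k)) - log_plus (\<tau> k) < ln K"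
        using elim(2) char_envelope_eq[OF f _ g4] char_envelope_eq[OF f _ g0(1)] g0(2) d0 by (simp add: P_def \<tau>_def)
      then have "ln (max 1 (char_sum f (r k + 4 * d k))) < ln (K * \<tau> k)"
        using \<tau>1 K by (simp add: log_plus_def max_absorb2 ln_mult)
      then have "max 1 (char_sum f (r k + 4 * d k)) < K * \<tau> k" using \<tau>1 K by (subst (asm) ln_less_cancel_iff) auto
      then show ?case by simp
    qed
    show "(\<lambda>k. ln (x k)) \<in> o(\<tau>)"
    proof (rule landau_o.smallI)
      fix c :: real assume c: "c > 0"
      show "eventually (\<lambda>k. norm (ln (x k)) \<le> c * norm (\<tau> k)) sequentially"
        using good fast[of "1 / c"]
      proof eventually_elim
        case (elim k)
        have "0 \<le> ln (x k)" "ln (x k) \<le> ln (r k)" using elim(1) by auto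
        moreover have "ln (r k) \<le> c * \<tau> k" using elim(2) c by (simp add: field_simps)
        ultimately have "ln (x k) \<le> c * \<tau> k" "0 \<le> c * \<tau> k" by linarith+
        then show ?case using \<open>0 \<le> ln (x k)\<close> c by (simp add: zero_le_mult_iff)
      qed
    qed
  qed
  moreover have "eventually (\<lambda>k. \<forall>j\<le>4. Q (r k + real j * d k) \<and> r k + real j * d k \<notin> E) sequentially"
    using good by eventually_elim blast
  ultimately show ?thesis by blast
qed

text \<open>The smallness of s is known only off E, which the radii avoid; T(R j k, f) <= K * \<tau>
  k then turns it into o(\<tau>).\<close>

lemma (in regular_radii) small_function_small:
  assumes s: "nonzero_meromorphic s" and j: "j \<le> 4"
    and good: "eventually (\<lambda>k. \<forall>j\<le>4. good_radius s (R j k) \<and> R j k \<notin> E) sequentially"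
    and small: "nevanlinna_char s \<in> o[inf at_top (principal (- E))](nevanlinna_char f)"
  shows "(\<lambda>k. char_sum s (R j k)) \<in> o(\<tau>)"
proof -
  have "filterlim (R j) at_top sequentially"
    by (rule filterlim_at_top_mono[OF x_lim]) (use ranges j in \<open>auto elim!: eventually_mono\<close>)
  moreover have "eventually (\<lambda>k. R j k \<in> - E) sequentially" using good by eventually_elim (use j in auto)
  ultimately have "filterlim (R j) (inf at_top (principal (- E))) sequentially"
    by (simp add: filterlim_inf filterlim_principal)
  from landau_o.small.compose[OF small this]
  have "(\<lambda>k. nevanlinna_char s (R j k)) \<in> o(\<lambda>k. nevanlinna_char f (R j k))" .
  also have "(\<lambda>k. nevanlinna_char f (R j k)) \<in> O(\<tau>)"
  proof (rule bigo_of_le)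
    show "(\<lambda>k. K * \<tau> k + 0) \<in> O(\<tau>)" by (rule big_\<tau>)
    show "eventually (\<lambda>k. 0 \<le> nevanlinna_char f (R j k) \<and> nevanlinna_char f (R j k) \<le> K * \<tau> k + 0) sequentially"
      using good_f_at[OF j] char_f_le[OF j] ranges
    proof eventually_elim
      case (elim k)
      have "1 \<le> R j k" using elim(3) j by (auto intro: order_trans[of _ "x k"])
      then show ?case using char_sum_ge(3)[OF elim(1)] nevanlinna_char_eq_char_sum[OF f elim(1)] elim(2) by simp
    qed
  qed
  finally have 1: "(\<lambda>k. nevanlinna_char s (R j k)) \<in> o(\<tau>)" .
  have "eventually (\<lambda>k. nevanlinna_char s (R j k) = char_sum s (R j k)) sequentially"
    using good by eventually_elim (use j nevanlinna_char_eq_char_sum[OF s] in blast)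
  with 1 show ?thesis by (rule landau_o.small.in_cong[THEN iffD1, rotated])
qed

theorem corollary1p2:
  fixes f s :: "complex \<Rightarrow> complex" and \<eta> :: complex and n :: nat
  assumes "transcendental_meromorphic f"
    and "hyper_order f < 1"
    and "deficiency_infinity f > 1 / 2"
    and "\<eta> \<noteq> 0"
    and "n \<ge> 3"
    and "small_function s f"
    and "s \<noteq> (\<lambda>z. 0)"
  shows "infinite (zeros_of (\<lambda>z. f z ^ n * f (z + \<eta>) - s z))"
proof
  assume "finite (zeros_of (\<lambda>z. f z ^ n * f (z + \<eta>) - s z))"
  then have Z: "finite {a. isolated_zero (\<lambda>z. f z ^ n * f (z + \<eta>) - s z) a}" by (simp add: zeros_of_def)
  have nonzero: "nonzero_meromorphic g" if "g nicely_meromorphic_on UNIV" "g \<noteq> (\<lambda>z. 0)" for g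
    using nicely_meromorphic_imp_constant_or_avoid[OF that(1) open_UNIV connected_UNIV, of 0] that
    by (auto simp: nonzero_meromorphic_def nicely_meromorphic_on_def)
  have "f \<noteq> (\<lambda>z. 0)"
  proof
    assume "f = (\<lambda>z. 0)"
    then have "rational_function f" unfolding rational_function_def by (intro exI[of _ 0] exI[of _ 1]) auto
    then show False using assms(1) by (simp add: transcendental_meromorphic_def)
  qed
  then have f: "nonzero_meromorphic f" using assms(1) nonzero by (simp add: transcendental_meromorphic_def)
  have s: "nonzero_meromorphic s" using assms(6,7) nonzero by (simp add: small_function_def)
  obtain E where E: "finite_log_measure E" "nevanlinna_char s \<in> o[inf at_top (principal (- E))](nevanlinna_char f)"
    using assms(6) by (auto simp: small_function_def S_class_def)
  obtain \<rho> where \<rho>: "\<rho> < 1 / 2" "eventually (\<lambda>r. integrated_pole_count f r / nevanlinna_char f r < \<rho>) at_top"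
  proof -
    define L where "L = Limsup at_top (\<lambda>r. ereal (integrated_pole_count f r / nevanlinna_char f r))"
    have "L < ereal (1 / 2)"
      using assms(3) unfolding deficiency_infinity_def L_def[symmetric]
      by (cases L) (auto simp: one_ereal_def numeral_eq_ereal divide_ereal_def)
    then obtain \<rho> where "L < ereal \<rho>" "ereal \<rho> < ereal (1 / 2)" using ereal_dense2 by blast
    moreover from this(1) have "eventually (\<lambda>r. ereal (integrated_pole_count f r / nevanlinna_char f r) < ereal \<rho>) at_top"
      unfolding L_def by (rule Limsup_lessD)
    ultimately show ?thesis using that by simp
  qed
  \<comment> \<open>m(r, f) exceeds (1/2 + \<epsilon>0) T. The estimates will give 4 (1/2 +
    \<epsilon>0) <= 1 + (1 + \<epsilon>)^2 + \<epsilon>0 / 2, and \<epsilon> <= 1 makes the right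
    side at most 2 + 3 \<epsilon> + \<epsilon>0 / 2. With \<epsilon> <= \<epsilon>0 this is less
    than the left side.\<close>
  define \<epsilon>0 where "\<epsilon>0 = 1 / 2 - \<rho>"
  define \<epsilon> where "\<epsilon> = min 1 \<epsilon>0"
  have \<epsilon>: "0 < \<epsilon>" "\<epsilon> \<le> 1" "\<epsilon> \<le> \<epsilon>0" "0 < \<epsilon>0" using \<rho> by (auto simp: \<epsilon>0_def \<epsilon>_def)
  define G where "G = (\<lambda>z. f z ^ n * f (z + \<eta>) * inverse (s z))"
  have G: "nonzero_meromorphic G"
    unfolding G_def by (intro nonzero_meromorphic_mult nonzero_meromorphic_power nonzero_meromorphic_shift nonzero_meromorphic_inverse f s)
  have Gm: "G meromorphic_on UNIV" using G by (simp add: nonzero_meromorphic_def)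
  \<comment> \<open>If G is constant, the value 1 included, then h degenerates; but then m(r, G) is
    bounded and the same inequality holds trivially.\<close>
  define nonconst where "nonconst \<longleftrightarrow> nonzero_meromorphic (\<lambda>z. G z - 1) \<and> nonzero_meromorphic (deriv G)"
  obtain c where c: "\<not> nonconst \<Longrightarrow> eventually (\<lambda>z. G z = c) (cosparse UNIV)"
  proof (cases nonconst)
    case False
    have m: "(\<lambda>z. G z - 1) meromorphic_on UNIV" "deriv G meromorphic_on UNIV"
      using Gm by (auto intro!: meromorphic_intros)
    from False consider "eventually (\<lambda>z. G z - 1 = 0) (cosparse UNIV)" | "eventually (\<lambda>z. deriv G z = 0) (cosparse UNIV)"
      using meromorphic_imp_constant_or_avoid[OF m(1) open_UNIV connected_UNIV, of 0]
        meromorphic_imp_constant_or_avoid[OF m(2) open_UNIV connected_UNIV, of 0] m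
      unfolding nonconst_def nonzero_meromorphic_def by blast
    then show ?thesis
    proof cases
      case 1
      then have "eventually (\<lambda>z. G z = 1) (cosparse UNIV)" by simp
      then show ?thesis using that by blast
    next
      case 2
      then show ?thesis using deriv_zero_imp_constant[OF Gm] that by blast
    qed
  qed (use that in blast)
  define Q where "Q = (\<lambda>t. good_radius s t \<and> (if nonconst then good_radius (\<lambda>z. G z - 1) t \<and> good_radius (deriv G) t
    else \<forall>z. cmod z = t \<longrightarrow> G z = c))"
  have "countable {t. t > 0 \<and> \<not> Q t}"
  proof (cases nonconst)
    case True
    have "{t. t > 0 \<and> \<not> Q t} \<subseteq> {t. t > 0 \<and> \<not> good_radius s t} \<union> {t. t > 0 \<and> \<not> good_radius (\<lambda>z. G z - 1) t}
        \<union> {t. t > 0 \<and> \<not> good_radius (deriv G) t}" by (auto simp: Q_def True)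
    moreover have "countable \<dots>"
      using True s countable_bad_radii unfolding nonconst_def by (intro countable_Un) blast+
    ultimately show ?thesis by (rule countable_subset)
  next
    case False
    have "{z. G z \<noteq> c} sparse_in UNIV" using c[OF False] by (simp add: eventually_cosparse)
    then have "countable {z. G z \<noteq> c}" using sparse_imp_countable[OF open_UNIV] by force
    then have "countable (cmod ` {z. G z \<noteq> c})" by simp
    moreover have "{t. t > 0 \<and> \<not> Q t} \<subseteq> {t. t > 0 \<and> \<not> good_radius s t} \<union> cmod ` {z. G z \<noteq> c}"
      by (auto simp: Q_def False)
    ultimately show ?thesis using countable_bad_radii[OF s] by (meson countable_Un countable_subset)
  qed
  from regular_radii_exist[OF assms(1) f assms(2) E(1) this, of "1 + \<epsilon>" \<eta>] \<epsilon>(1)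
  obtain x r d \<tau> \<alpha> \<beta> where rr: "regular_radii f \<eta> x r d \<tau> \<alpha> \<beta> (1 + \<epsilon>)"
    and Qr: "eventually (\<lambda>k. \<forall>j\<le>4. Q (r k + real j * d k) \<and> r k + real j * d k \<notin> E) sequentially" by auto
  interpret regular_radii f \<eta> x r d \<tau> \<alpha> \<beta> "1 + \<epsilon>" by (rule rr)
  have gs: "eventually (\<lambda>k. \<forall>j\<le>4. good_radius s (R j k) \<and> R j k \<notin> E) sequentially"
    using Qr by eventually_elim (auto simp: Q_def)
  have sm: "(\<lambda>k. char_sum s (R j k)) \<in> o(\<tau>)" if "j \<le> 4" for j
    by (rule small_function_small[OF s that gs E(2)])
  have sm0: "(\<lambda>k. char_sum s (r k)) \<in> o(\<tau>)" using sm[of 0] by simp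
  have gs0: "eventually (\<lambda>k. good_radius s (r k)) sequentially"
    using gs by eventually_elim (auto dest: spec[of _ 0])
  have r3: "eventually (\<lambda>k. r k \<ge> 3 \<and> r k \<ge> x k) sequentially"
    using ranges r_range by eventually_elim auto
  have ps: "(\<lambda>k. circle_prox s (r k)) \<in> o(\<tau>)"
    by (rule smallo_of_le[OF sm0])
       (use eventually_conj[OF gs0 r3] in \<open>auto elim!: eventually_mono intro: circle_prox_nonneg_general char_sum_ge(1)\<close>)
  obtain err1 where err1: "err1 \<in> o(\<tau>)"
    "eventually (\<lambda>k. (real n + 1) * circle_prox f (r k) \<le> circle_prox G (r k) + err1 k) sequentially"
    using prox_f_le_prox_G[OF gs0 ps, of n] unfolding G_def by blast
  obtain err2 where err2: "err2 \<in> o(\<tau>)"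
    "eventually (\<lambda>k. circle_prox G (r k) \<le> pole_sum (\<lambda>z. inverse (f z)) (r k)
      + pole_sum (\<lambda>z. inverse (f (z + \<eta>))) (r k) + err2 k) sequentially"
  proof (cases nonconst)
    case True
    then have "eventually (\<lambda>k. \<forall>j\<le>4. good_radius s (R j k) \<and> good_radius (\<lambda>z. G z - 1) (R j k) \<and> good_radius (deriv G) (R j k)) sequentially"
      using Qr by (simp add: Q_def) (auto elim!: eventually_mono)
    then show ?thesis
      using prox_G_nonconstant[OF s, of n] sm0 sm[of 2] Z True that unfolding G_def nonconst_def by auto
  next
    case False
    have "eventually (\<lambda>k. circle_prox G (r k) \<le> pole_sum (\<lambda>z. inverse (f z)) (r k)
      + pole_sum (\<lambda>z. inverse (f (z + \<eta>))) (r k) + log_plus (cmod c)) sequentially"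
      using Qr r3
    proof eventually_elim
      case (elim k)
      have "circle_prox G (r k) = circle_prox (\<lambda>_. c) (r k)"
        using elim False by (intro circle_prox_cong) (auto simp: Q_def dest: spec[of _ 0])
      moreover have "pole_sum (\<lambda>z. inverse (f z)) (r k) \<ge> 0" "pole_sum (\<lambda>z. inverse (f (z + \<eta>))) (r k) \<ge> 0"
        using elim by (auto intro!: pole_sum_nonneg)
      ultimately show ?case by (simp add: circle_prox_const)
    qed
    then show ?thesis using that const_small by blast
  qed
  obtain err3 where err3: "err3 \<in> o(\<tau>)"
    "eventually (\<lambda>k. pole_sum (\<lambda>z. inverse (f z)) (r k) + pole_sum (\<lambda>z. inverse (f (z + \<eta>))) (r k)
      \<le> (1 + (1 + \<epsilon>) * (1 + \<epsilon>)) * \<tau> k + err3 k) sequentially"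
    using zeros_f_le[OF \<epsilon>(1)] by blast
  have err: "(\<lambda>k. err1 k + err2 k + err3 k) \<in> o(\<tau>)" by (intro small_add err1 err2 err3)
  have "eventually (\<lambda>k. \<bar>err1 k + err2 k + err3 k\<bar> \<le> \<epsilon>0 / 2 * \<bar>\<tau> k\<bar>) sequentially"
    using landau_o.smallD[OF err, of "\<epsilon>0 / 2"] \<epsilon>(4) by simp
  moreover have "eventually (\<lambda>k. integrated_pole_count f (r k) / nevanlinna_char f (r k) < \<rho>) sequentially"
  proof (rule eventually_compose_filterlim[OF \<rho>(2)])
    show "filterlim r at_top sequentially"
      by (rule filterlim_at_top_mono[OF x_lim]) (use r3 in \<open>auto elim!: eventually_mono\<close>)
  qed
  ultimately have "eventually (\<lambda>k. False) sequentially"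
    using err1(2) err2(2) err3(2) \<tau>_ge[of 1] good_f_at[of 0, simplified]
  proof eventually_elim
    case (elim k)
    define m where "m = circle_prox f (r k)"
    have gf: "good_radius f (r k)" by fact
    have "pole_sum f (r k) < \<rho> * \<tau> k"
      using elim(2,6) integrated_pole_count_eq_pole_sum[OF f gf] nevanlinna_char_eq_char_sum[OF f gf]
      by (simp add: \<tau>_def field_simps)
    then have m: "(1 - \<rho>) * \<tau> k \<le> m" unfolding m_def \<tau>_def char_sum_def by (simp add: left_diff_distrib)
    have "m \<ge> 0" unfolding m_def by (rule circle_prox_nonneg_general)
    \<comment> \<open>n >= 3 enters here: four copies of m(r, f), each more than half of T, must
      exceed the two copies of T that bound the zeros.\<close>
    then have "4 * m \<le> (real n + 1) * m" using assms(5) by (intro mult_right_mono) auto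
    also have "\<dots> \<le> (1 + (1 + \<epsilon>) * (1 + \<epsilon>)) * \<tau> k + (err1 k + err2 k + err3 k)"
      using elim(3-5) unfolding m_def by linarith
    also have "err1 k + err2 k + err3 k \<le> \<epsilon>0 / 2 * \<tau> k"
      using order_trans[OF abs_ge_self elim(1)] elim(6) by simp
    finally have "4 * ((1 - \<rho>) * \<tau> k) \<le> (1 + (1 + \<epsilon>) * (1 + \<epsilon>) + \<epsilon>0 / 2) * \<tau> k" using m by (simp add: algebra_simps)
    then have "4 * (1 - \<rho>) \<le> 1 + (1 + \<epsilon>) * (1 + \<epsilon>) + \<epsilon>0 / 2" using elim(6) by simp
    moreover have "\<epsilon> * \<epsilon> \<le> \<epsilon>" using \<epsilon> mult_left_le[of \<epsilon> \<epsilon>] by simp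
    then have "1 + (1 + \<epsilon>) * (1 + \<epsilon>) \<le> 2 + 3 * \<epsilon>" by (simp add: algebra_simps)
    ultimately have "4 * (1 - \<rho>) \<le> 2 + 3 * \<epsilon>0 + \<epsilon>0 / 2" using \<epsilon> by linarith
    then show False using \<epsilon>(4) unfolding \<epsilon>0_def by (simp add: field_simps)
  qed
  then show False by simp
qed

end
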